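(* Let $R$ be a non-trivial commutative associative noetherian ring with unit, let $\Phi:R\to\mathbb Z_3$ be a fixed surjective ring homomorphism and $I=\ker\Phi$. There exists a non-associative hamiltonian quasimodule (over $R$ with respect to $\Phi$) if and only if there exists a finite cocyclic $\widehat{\mathrm K}$-torsion $R$-module $M$ such that $\mathrm{gen}(M)\ge 3$.
   Context: Modules are unitary left $R$-modules. A commutative Moufang loop is a loop $Q(+)$ (a quasigroup with neutral element $0$) satisfying $(x+x)+(a+b)=(x+a)+(x+b)$; it is automatically commutative. A quasimodule (over $R$, with respect to $\Phi$) is a commutative Moufang loop $Q(+)$ with a scalar multiplication $R\times Q\to Q$ satisfying $r(x+y)=rx+ry$, $(r+s)x=rx+sx$, $(rs)x=r(sx)$, $1x=x$, $0x=0$, and, moreover, $rx+(y+z)=(rx+y)+z$ for all $r\in I$, $x,y,z\in Q$. A quasimodule is a module iff $+$ is associative; non-associative means it is not a module. A subquasimodule is normal if it is a block of a congruence of the quasimodule; a quasimodule is hamiltonian if all its subquasimodules are normal. A module $M$ is cocyclic if its socle is a non-zero simple submodule that is essential (meets every non-zero submodule non-trivially). For a module $M$ put $\mathrm K(M)=\{x\in M: Ix=0\}$; define $\mathrm K_0(M)=0$, $\mathrm K_{\alpha+1}(M)/\mathrm K_\alpha(M)=\mathrm K(M/\mathrm K_\alpha(M))$, and unions at limit ordinals, and let $\widehat{\mathrm K}(M)=\bigcup_\alpha \mathrm K_\alpha(M)$. $M$ is $\widehat{\mathrm K}$-torsion if $\widehat{\mathrm K}(M)=M$. $\mathrm{gen}(M)$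 is the least number of generators of a finitely generated $M$. *)

theory Defs
  imports "HOL-Algebra.Algebra" "HOL-Number_Theory.Number_Theory"
begin

section \<open>Quasimodules\<close>

locale commutative_moufang_loop =
  fixes Q :: "('q, 'b) ring_scheme" (structure)
  assumes add_closed: "\<lbrakk>x \<in> carrier Q; y \<in> carrier Q\<rbrakk> \<Longrightarrow> x \<oplus> y \<in> carrier Q"
    and zero_closed: "\<zero> \<in> carrier Q"
    and left_division: "\<lbrakk>a \<in> carrier Q; b \<in> carrier Q\<rbrakk> \<Longrightarrow> \<exists>!x. x \<in> carrier Q \<and> a \<oplus> x = b"
    and right_division: "\<lbrakk>a \<in> carrier Q; b \<in> carrier Q\<rbrakk> \<Longrightarrow> \<exists>!x. x \<in> carrier Q \<and> x \<oplus> a = b"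
    and zero_left: "x \<in> carrier Q \<Longrightarrow> \<zero> \<oplus> x = x"
    and zero_right: "x \<in> carrier Q \<Longrightarrow> x \<oplus> \<zero> = x"
    and moufang: "\<lbrakk>x \<in> carrier Q; a \<in> carrier Q; b \<in> carrier Q\<rbrakk>
        \<Longrightarrow> (x \<oplus> x) \<oplus> (a \<oplus> b) = (x \<oplus> a) \<oplus> (x \<oplus> b)"

text \<open>A quasimodule lives on the record type of modules, whose fields \<open>mult\<close> and \<open>one\<close>
  are ignored, exactly as for modules.\<close>

locale quasimodule = R?: cring R + Q?: commutative_moufang_loop Q
  for R :: "('r, 'a) ring_scheme" (structure) and \<Phi> :: "'r \<Rightarrow> int" and Q :: "('r, 'q) module" (structure) +
  assumes smult_closed: "\<lbrakk>r \<in> carrier R; x \<in> carrier Q\<rbrakk> \<Longrightarrow> r \<odot>\<^bsub>Q\<^esub> x \<in> carrier Q"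
    and smult_add: "\<lbrakk>r \<in> carrier R; x \<in> carrier Q; y \<in> carrier Q\<rbrakk>
        \<Longrightarrow> r \<odot>\<^bsub>Q\<^esub> (x \<oplus>\<^bsub>Q\<^esub> y) = r \<odot>\<^bsub>Q\<^esub> x \<oplus>\<^bsub>Q\<^esub> r \<odot>\<^bsub>Q\<^esub> y"
    and add_smult: "\<lbrakk>r \<in> carrier R; s \<in> carrier R; x \<in> carrier Q\<rbrakk>
        \<Longrightarrow> (r \<oplus> s) \<odot>\<^bsub>Q\<^esub> x = r \<odot>\<^bsub>Q\<^esub> x \<oplus>\<^bsub>Q\<^esub> s \<odot>\<^bsub>Q\<^esub> x"
    and mult_smult: "\<lbrakk>r \<in> carrier R; s \<in> carrier R; x \<in> carrier Q\<rbrakk>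
        \<Longrightarrow> (r \<otimes> s) \<odot>\<^bsub>Q\<^esub> x = r \<odot>\<^bsub>Q\<^esub> (s \<odot>\<^bsub>Q\<^esub> x)"
    and one_smult: "x \<in> carrier Q \<Longrightarrow> \<one> \<odot>\<^bsub>Q\<^esub> x = x"
    and zero_smult: "x \<in> carrier Q \<Longrightarrow> \<zero> \<odot>\<^bsub>Q\<^esub> x = \<zero>\<^bsub>Q\<^esub>"
    and kernel_assoc:
      "\<lbrakk>r \<in> a_kernel R (residue_ring 3) \<Phi>; x \<in> carrier Q; y \<in> carrier Q; z \<in> carrier Q\<rbrakk>
        \<Longrightarrow> r \<odot>\<^bsub>Q\<^esub> x \<oplus>\<^bsub>Q\<^esub> (y \<oplus>\<^bsub>Q\<^esub> z) = (r \<odot>\<^bsub>Q\<^esub> x \<oplus>\<^bsub>Q\<^esub> y) \<oplus>\<^bsub>Q\<^esub> z"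

definition nonassociative_quasimodule ::
    "('r, 'a) ring_scheme \<Rightarrow> ('r \<Rightarrow> int) \<Rightarrow> ('r, 'q) module \<Rightarrow> bool" where
  "nonassociative_quasimodule R \<Phi> Q \<longleftrightarrow> quasimodule R \<Phi> Q \<and> \<not> module R Q"

definition subquasimodule ::
    "'q set \<Rightarrow> ('r, 'a) ring_scheme \<Rightarrow> ('r \<Rightarrow> int) \<Rightarrow> ('r, 'q) module \<Rightarrow> bool" where
  "subquasimodule H R \<Phi> Q \<longleftrightarrow> H \<subseteq> carrier Q \<and> quasimodule R \<Phi> (Q\<lparr>carrier := H\<rparr>)"

text \<open>Compatibility with the two divisions and with negation need not be required: the
  solution of \<open>a + x = b\<close> is \<open>(- 1) a + b\<close>.\<close>

definition quasimodule_congruence ::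
    "('q \<times> 'q) set \<Rightarrow> ('r, 'a) ring_scheme \<Rightarrow> ('r, 'q) module \<Rightarrow> bool" where
  "quasimodule_congruence \<theta> R Q \<longleftrightarrow>
     equiv (carrier Q) \<theta> \<and>
     (\<forall>x y u v. (x, y) \<in> \<theta> \<and> (u, v) \<in> \<theta> \<longrightarrow> (x \<oplus>\<^bsub>Q\<^esub> u, y \<oplus>\<^bsub>Q\<^esub> v) \<in> \<theta>) \<and>
     (\<forall>r\<in>carrier R. \<forall>x y. (x, y) \<in> \<theta> \<longrightarrow> (r \<odot>\<^bsub>Q\<^esub> x, r \<odot>\<^bsub>Q\<^esub> y) \<in> \<theta>)"

definition normal_subquasimodule ::
    "'q set \<Rightarrow> ('r, 'a) ring_scheme \<Rightarrow> ('r \<Rightarrow> int) \<Rightarrow> ('r, 'q) module \<Rightarrow> bool" where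
  "normal_subquasimodule H R \<Phi> Q \<longleftrightarrow>
     subquasimodule H R \<Phi> Q \<and> (\<exists>\<theta>. quasimodule_congruence \<theta> R Q \<and> H \<in> carrier Q // \<theta>)"

definition hamiltonian_quasimodule ::
    "('r, 'a) ring_scheme \<Rightarrow> ('r \<Rightarrow> int) \<Rightarrow> ('r, 'q) module \<Rightarrow> bool" where
  "hamiltonian_quasimodule R \<Phi> Q \<longleftrightarrow>
     quasimodule R \<Phi> Q \<and>
     (\<forall>H. subquasimodule H R \<Phi> Q \<longrightarrow> normal_subquasimodule H R \<Phi> Q)"

lemma (in quasimodule) module_iff_associative:
  "module R Q \<longleftrightarrow>
     (\<forall>x\<in>carrier Q. \<forall>y\<in>carrier Q. \<forall>z\<in>carrier Q. (x \<oplus>\<^bsub>Q\<^esub> y) \<oplus>\<^bsub>Q\<^esub> z = x \<oplus>\<^bsub>Q\<^esub> (y \<oplus>\<^bsub>Q\<^esub> z))"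
  (is "_ \<longleftrightarrow> ?assoc")
proof
  assume "module R Q"
  then interpret M: module R Q .
  show ?assoc by (simp add: M.M.a_assoc)
next
  assume assoc: ?assoc
  have comm: "x \<oplus>\<^bsub>Q\<^esub> y = y \<oplus>\<^bsub>Q\<^esub> x" if x: "x \<in> carrier Q" and y: "y \<in> carrier Q" for x y
  proof -
    have "x \<oplus>\<^bsub>Q\<^esub> (x \<oplus>\<^bsub>Q\<^esub> y) = x \<oplus>\<^bsub>Q\<^esub> (y \<oplus>\<^bsub>Q\<^esub> x)"
      using moufang[OF x Q.zero_closed y] moufang[OF x y Q.zero_closed] x y assoc
      by (simp add: zero_left zero_right add_closed)
    then show ?thesis
      using left_division[OF x add_closed[OF x add_closed[OF x y]]] x y add_closed by metis
  qed
  have "abelian_group Q"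
  proof (rule abelian_groupI)
    fix x assume "x \<in> carrier Q"
    then show "\<exists>y\<in>carrier Q. y \<oplus>\<^bsub>Q\<^esub> x = \<zero>\<^bsub>Q\<^esub>"
      using right_division[of x "\<zero>\<^bsub>Q\<^esub>"] Q.zero_closed by blast
  qed (use assoc in \<open>auto simp: add_closed Q.zero_closed zero_left zero_right comm\<close>)
  then show "module R Q"
    by (intro moduleI R.is_cring)
      (auto simp: smult_closed smult_add add_smult mult_smult one_smult)
qed


section \<open>Modules\<close>

definition generated_submodule ::
    "('r, 'a) ring_scheme \<Rightarrow> ('r, 'm) module \<Rightarrow> 'm set \<Rightarrow> 'm set" where
  "generated_submodule R M A = \<Inter>{H. submodule H R M \<and> A \<subseteq> H}"

text \<open>Only meaningful for finitely generated modules.\<close>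

definition gen :: "('r, 'a) ring_scheme \<Rightarrow> ('r, 'm) module \<Rightarrow> nat" where
  "gen R M = (LEAST n. \<exists>A. A \<subseteq> carrier M \<and> finite A \<and> card A = n \<and>
                           generated_submodule R M A = carrier M)"

definition simple_submodule ::
    "'m set \<Rightarrow> ('r, 'a) ring_scheme \<Rightarrow> ('r, 'm) module \<Rightarrow> bool" where
  "simple_submodule S R M \<longleftrightarrow>
     submodule S R M \<and> S \<noteq> {\<zero>\<^bsub>M\<^esub>} \<and>
     (\<forall>T. submodule T R M \<and> T \<subseteq> S \<longrightarrow> T = {\<zero>\<^bsub>M\<^esub>} \<or> T = S)"

definition essential_submodule ::
    "'m set \<Rightarrow> ('r, 'a) ring_scheme \<Rightarrow> ('r, 'm) module \<Rightarrow> bool" where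
  "essential_submodule S R M \<longleftrightarrow>
     submodule S R M \<and> (\<forall>N. submodule N R M \<and> N \<noteq> {\<zero>\<^bsub>M\<^esub>} \<longrightarrow> S \<inter> N \<noteq> {\<zero>\<^bsub>M\<^esub>})"

text \<open>The sum of all simple submodules.\<close>

definition socle :: "('r, 'a) ring_scheme \<Rightarrow> ('r, 'm) module \<Rightarrow> 'm set" where
  "socle R M = generated_submodule R M (\<Union>{S. simple_submodule S R M})"

definition cocyclic :: "('r, 'a) ring_scheme \<Rightarrow> ('r, 'm) module \<Rightarrow> bool" where
  "cocyclic R M \<longleftrightarrow>
     module R M \<and> simple_submodule (socle R M) R M \<and> essential_submodule (socle R M) R M"

text \<open>The elements of \<open>M/N\<close> are the cosets \<open>x + N\<close>; \<open>r (x + N)\<close> is written as the set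
  \<open>{r y | y \<in> x + N} + N\<close>, which is the coset \<open>r x + N\<close>.\<close>

definition quotient_module :: "('r, 'm) module \<Rightarrow> 'm set \<Rightarrow> ('r, 'm set) module" where
  "quotient_module M N =
     \<lparr>carrier = a_rcosets\<^bsub>M\<^esub> N, monoid.mult = undefined, one = undefined,
      ring.zero = N, add = (<+>\<^bsub>M\<^esub>),
      smult = (\<lambda>r C. ((\<lambda>y. r \<odot>\<^bsub>M\<^esub> y) ` C) <+>\<^bsub>M\<^esub> N)\<rparr>"

definition K :: "('r, 'a) ring_scheme \<Rightarrow> ('r \<Rightarrow> int) \<Rightarrow> ('r, 'm) module \<Rightarrow> 'm set" where
  "K R \<Phi> M = {x \<in> carrier M. \<forall>r\<in>a_kernel R (residue_ring 3) \<Phi>. r \<odot>\<^bsub>M\<^esub> x = \<zero>\<^bsub>M\<^esub>}"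

text \<open>HOL has no type of ordinals. The transfinite sequence \<open>K\<^sub>\<alpha>(M)\<close> is represented
  by the set of its members, generated by the start, successor and limit steps. The union
  of a set of cosets is its preimage in \<open>M\<close>, so that the successor of \<open>N\<close> is the submodule
  \<open>N'\<close> with \<open>N'/N = K(M/N)\<close>. A union of a non-empty chain of earlier members is
  either one of them or their limit.\<close>

inductive_set K_sequence ::
    "('r, 'a) ring_scheme \<Rightarrow> ('r \<Rightarrow> int) \<Rightarrow> ('r, 'm) module \<Rightarrow> 'm set set"
  for R :: "('r, 'a) ring_scheme" and \<Phi> :: "'r \<Rightarrow> int" and M :: "('r, 'm) module" where
  zero: "{\<zero>\<^bsub>M\<^esub>} \<in> K_sequence R \<Phi> M"
| succ: "N \<in> K_sequence R \<Phi> M \<Longrightarrow> \<Union>(K R \<Phi> (quotient_module M N)) \<in> K_sequence R \<Phi> M"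
| limit: "\<lbrakk>C \<noteq> {}; chain\<^sub>\<subseteq> C; \<And>N. N \<in> C \<Longrightarrow> N \<in> K_sequence R \<Phi> M\<rbrakk>
    \<Longrightarrow> \<Union>C \<in> K_sequence R \<Phi> M"

definition K_hat :: "('r, 'a) ring_scheme \<Rightarrow> ('r \<Rightarrow> int) \<Rightarrow> ('r, 'm) module \<Rightarrow> 'm set" where
  "K_hat R \<Phi> M = \<Union>(K_sequence R \<Phi> M)"

definition K_hat_torsion :: "('r, 'a) ring_scheme \<Rightarrow> ('r \<Rightarrow> int) \<Rightarrow> ('r, 'm) module \<Rightarrow> bool" where
  "K_hat_torsion R \<Phi> M \<longleftrightarrow> K_hat R \<Phi> M = carrier M"

lemma quotient_module_smult:
  fixes R (structure) and M :: "('r, 'm) module"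
  assumes "module R M" and N: "submodule N R M" and r: "r \<in> carrier R" and x: "x \<in> carrier M"
  shows "r \<odot>\<^bsub>quotient_module M N\<^esub> (N +>\<^bsub>M\<^esub> x) = N +>\<^bsub>M\<^esub> (r \<odot>\<^bsub>M\<^esub> x)"
proof -
  interpret module R M by fact
  note E = submoduleE[OF N]
  have sub: "n \<in> carrier M" if "n \<in> N" for n using E(1) that by blast
  have z: "\<zero>\<^bsub>M\<^esub> \<in> N" using N subgroup.one_closed[OF submodule.axioms(1)[OF N]] by simp
  have "(\<exists>n\<in>N. \<exists>m\<in>N. y = r \<odot>\<^bsub>M\<^esub> (n \<oplus>\<^bsub>M\<^esub> x) \<oplus>\<^bsub>M\<^esub> m) \<longleftrightarrow> (\<exists>n\<in>N. y = n \<oplus>\<^bsub>M\<^esub> r \<odot>\<^bsub>M\<^esub> x)" for y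
  proof
    assume "\<exists>n\<in>N. \<exists>m\<in>N. y = r \<odot>\<^bsub>M\<^esub> (n \<oplus>\<^bsub>M\<^esub> x) \<oplus>\<^bsub>M\<^esub> m"
    then obtain n m where nm: "n \<in> N" "m \<in> N" "y = r \<odot>\<^bsub>M\<^esub> (n \<oplus>\<^bsub>M\<^esub> x) \<oplus>\<^bsub>M\<^esub> m" by blast
    then have "y = (r \<odot>\<^bsub>M\<^esub> n \<oplus>\<^bsub>M\<^esub> m) \<oplus>\<^bsub>M\<^esub> r \<odot>\<^bsub>M\<^esub> x"
      using sub r x by (simp add: smult_r_distr M.a_ac)
    moreover have "r \<odot>\<^bsub>M\<^esub> n \<oplus>\<^bsub>M\<^esub> m \<in> N" using nm E r by blast
    ultimately show "\<exists>n\<in>N. y = n \<oplus>\<^bsub>M\<^esub> r \<odot>\<^bsub>M\<^esub> x" by blast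
  next
    assume "\<exists>n\<in>N. y = n \<oplus>\<^bsub>M\<^esub> r \<odot>\<^bsub>M\<^esub> x"
    then obtain n where n: "n \<in> N" "y = n \<oplus>\<^bsub>M\<^esub> r \<odot>\<^bsub>M\<^esub> x" by blast
    then have "y = r \<odot>\<^bsub>M\<^esub> (\<zero>\<^bsub>M\<^esub> \<oplus>\<^bsub>M\<^esub> x) \<oplus>\<^bsub>M\<^esub> n"
      using sub r x by (simp add: M.a_comm)
    then show "\<exists>n\<in>N. \<exists>m\<in>N. y = r \<odot>\<^bsub>M\<^esub> (n \<oplus>\<^bsub>M\<^esub> x) \<oplus>\<^bsub>M\<^esub> m" using n z by blast
  qed
  then show ?thesis
    unfolding quotient_module_def set_add_def' a_r_coset_def' by auto
qed

lemma Union_K_quotient_module: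
  fixes R :: "('r, 'a) ring_scheme" (structure) and M :: "('r, 'm) module"
  assumes "module R M" and N: "submodule N R M" and I: "a_kernel R (residue_ring 3) \<Phi> \<subseteq> carrier R"
  shows "\<Union>(K R \<Phi> (quotient_module M N)) =
           {x \<in> carrier M. \<forall>r\<in>a_kernel R (residue_ring 3) \<Phi>. r \<odot>\<^bsub>M\<^esub> x \<in> N}"
proof -
  interpret module R M by fact
  interpret N: abelian_subgroup N M
    by (rule abelian_subgroupI3)
      (use N in \<open>auto intro: additive_subgroup.intro submodule.axioms M.abelian_group_axioms\<close>)
  have coset: "N +>\<^bsub>M\<^esub> y = N \<longleftrightarrow> y \<in> N" if "y \<in> carrier M" for y
    using that N.a_rcos_const[of y] N.a_rcos_self[of y] by auto
  have mem: "N +>\<^bsub>M\<^esub> x \<in> K R \<Phi> (quotient_module M N) \<longleftrightarrow>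
      (\<forall>r\<in>a_kernel R (residue_ring 3) \<Phi>. r \<odot>\<^bsub>M\<^esub> x \<in> N)" if x: "x \<in> carrier M" for x
  proof -
    have "N +>\<^bsub>M\<^esub> x \<in> a_rcosets\<^bsub>M\<^esub> N" using x N.a_subset by (simp add: M.a_rcosetsI)
    moreover have "r \<odot>\<^bsub>quotient_module M N\<^esub> (N +>\<^bsub>M\<^esub> x) = N \<longleftrightarrow> r \<odot>\<^bsub>M\<^esub> x \<in> N"
      if "r \<in> a_kernel R (residue_ring 3) \<Phi>" for r
    proof -
      have "r \<in> carrier R" using that I by blast
      then show ?thesis
        using x by (simp add: coset quotient_module_smult[OF \<open>module R M\<close> N])
    qed
    moreover have "\<zero>\<^bsub>quotient_module M N\<^esub> = N"
      and "carrier (quotient_module M N) = a_rcosets\<^bsub>M\<^esub> N"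
      by (simp_all add: quotient_module_def)
    ultimately show ?thesis by (simp add: K_def)
  qed
  have "K R \<Phi> (quotient_module M N) \<subseteq> a_rcosets\<^bsub>M\<^esub> N"
    by (auto simp: K_def quotient_module_def)
  then have rep: "x \<in> carrier M \<and> C = N +>\<^bsub>M\<^esub> x"
    if C: "C \<in> K R \<Phi> (quotient_module M N)" and x: "x \<in> C" for C x
  proof -
    from C \<open>K R \<Phi> (quotient_module M N) \<subseteq> a_rcosets\<^bsub>M\<^esub> N\<close> have "C \<in> a_rcosets\<^bsub>M\<^esub> N" ..
    then obtain y where "y \<in> carrier M" "C = N +>\<^bsub>M\<^esub> y"
      unfolding A_RCOSETS_def' by blast
    then show ?thesis
      using N.a_repr_independence' N.a_rcosets_carrier[OF \<open>C \<in> a_rcosets\<^bsub>M\<^esub> N\<close>] x by blast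
  qed
  show ?thesis
  proof (intro equalityI subsetI)
    fix x assume "x \<in> \<Union>(K R \<Phi> (quotient_module M N))"
    then show "x \<in> {x \<in> carrier M. \<forall>r\<in>a_kernel R (residue_ring 3) \<Phi>. r \<odot>\<^bsub>M\<^esub> x \<in> N}"
      using rep mem by blast
  next
    fix x assume "x \<in> {x \<in> carrier M. \<forall>r\<in>a_kernel R (residue_ring 3) \<Phi>. r \<odot>\<^bsub>M\<^esub> x \<in> N}"
    then show "x \<in> \<Union>(K R \<Phi> (quotient_module M N))"
      using mem N.a_rcos_self by blast
  qed
qed

end

theory Submission
  imports Defs
begin

text \<open>In a hamiltonian quasimodule \<open>Q\<close> every cyclic subquasimodule \<open>Rg\<close> is normal, so the defect
  \<open>c\<close> of associativity of a triple vanishes modulo each of its three members and is a multiple of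
  each. If the coefficient expressing \<open>c\<close> by a member were a unit modulo \<open>I\<close>, that member would
  associate with the other two; hence \<open>c\<close> is central, and the defect is a trilinear alternating map
  killed by \<open>I\<close>. For a triple \<open>u, v, w\<close> with \<open>c \<noteq> 0\<close> the elements of \<open>R\<^sup>3\<close> that evaluate to \<open>0\<close> at
  \<open>u, v, w\<close> form a submodule of \<open>I\<^sup>3\<close>. Let \<open>N\<close> be maximal among the submodules of \<open>R\<^sup>3\<close> that contain
  it and avoid a preimage \<open>p \<in> I\<^sup>3\<close> of \<open>c\<close>. Since \<open>c \<in> Ig\<close> whenever \<open>g\<close> is the value of an element
  outside \<open>I\<^sup>3\<close>, again \<open>N \<subseteq> I\<^sup>3\<close>, and \<open>R\<^sup>3/N\<close> is the required module; it is finite and torsion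
  because the annihilators of its elements satisfy the ascending chain condition.

  Conversely, let \<open>s\<close> generate the socle of \<open>M\<close>. A minimal generating set supplies functionals
  \<open>f\<^sub>1, f\<^sub>2, f\<^sub>3\<close> from \<open>M\<close> to \<open>\<int>\<^sub>3\<close> dual to three of its members, and
  \<open>x \<star> y = x + y + (f\<^sub>1 x f\<^sub>2 y - f\<^sub>2 x f\<^sub>1 y)(f\<^sub>3 x - f\<^sub>3 y) s\<close> is a non-associative quasimodule
  operation on \<open>M\<close> with the same cyclic subobjects. Every non-zero subquasimodule contains \<open>s\<close>,
  and modulo \<open>s\<close> both operations coincide.\<close>

section \<open>Rings over \<open>\<int>\<^sub>3\<close> and commutative Moufang loops\<close>

locale cring_onto_Z3 = cring R for R :: "('r, 'a) ring_scheme" (structure) +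
  fixes \<Phi> :: "'r \<Rightarrow> int"
  assumes Phi_hom: "\<Phi> \<in> ring_hom R (residue_ring 3)"
    and Phi_surj: "\<Phi> ` carrier R = carrier (residue_ring 3)"
begin

abbreviation I :: "'r set" where "I \<equiv> a_kernel R (residue_ring 3) \<Phi>"

lemma Phi_add: "\<lbrakk>r \<in> carrier R; s \<in> carrier R\<rbrakk> \<Longrightarrow> \<Phi> (r \<oplus> s) = (\<Phi> r + \<Phi> s) mod 3"
  using ring_hom_add[OF Phi_hom] by (simp add: residue_ring_def)

lemma Phi_mult: "\<lbrakk>r \<in> carrier R; s \<in> carrier R\<rbrakk> \<Longrightarrow> \<Phi> (r \<otimes> s) = (\<Phi> r * \<Phi> s) mod 3"
  using ring_hom_mult[OF Phi_hom] by (simp add: residue_ring_def)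

lemma Phi_one: "\<Phi> \<one> = 1"
  using ring_hom_one[OF Phi_hom] by (simp add: residue_ring_def)

lemma Phi_range: "r \<in> carrier R \<Longrightarrow> 0 \<le> \<Phi> r \<and> \<Phi> r \<le> 2"
  using ring_hom_closed[OF Phi_hom, of r] by (simp add: residue_ring_def)

lemma Phi_cases:
  assumes "r \<in> carrier R"
  obtains "\<Phi> r = 0" | "\<Phi> r = 1" | "\<Phi> r = 2"
  using Phi_range[OF assms] by linarith

lemma Phi_mod [simp]: "r \<in> carrier R \<Longrightarrow> \<Phi> r mod 3 = \<Phi> r"
  using Phi_range[of r] by simp

lemma Phi_zero: "\<Phi> \<zero> = 0"
  using Phi_add[of \<zero> \<zero>] Phi_range[of \<zero>] by (simp; presburger)

lemma Phi_minus:
  assumes "r \<in> carrier R"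
  shows "\<Phi> (\<ominus> r) = (- \<Phi> r) mod 3"
proof -
  have "(\<Phi> r + \<Phi> (\<ominus> r)) mod 3 = 0"
    using Phi_add[OF assms a_inv_closed[OF assms]] assms by (simp add: r_neg Phi_zero)
  then show ?thesis
    using Phi_range[of "\<ominus> r"] Phi_range[OF assms] assms by (simp; presburger)
qed

lemma I_iff: "r \<in> I \<longleftrightarrow> r \<in> carrier R \<and> \<Phi> r = 0"
  by (simp add: a_kernel_def' residue_ring_def)

lemma I_subset: "I \<subseteq> carrier R"
  by (auto simp: I_iff)

lemma Phi_diff:
  "\<lbrakk>r \<in> carrier R; s \<in> carrier R\<rbrakk> \<Longrightarrow> \<Phi> (r \<ominus> s) = (\<Phi> r - \<Phi> s) mod 3"
  by (simp add: minus_eq Phi_add Phi_minus mod_simps)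

lemma diff_in_I:
  "\<lbrakk>r \<in> carrier R; s \<in> carrier R\<rbrakk> \<Longrightarrow> r \<ominus> s \<in> I \<longleftrightarrow> \<Phi> r = \<Phi> s"
  using Phi_range[of r] Phi_range[of s] by (simp add: I_iff Phi_diff; presburger)

lemma Phi_onto:
  obtains r where "r \<in> carrier R" "\<Phi> r = k mod 3"
proof -
  have "k mod 3 \<in> \<Phi> ` carrier R"
    unfolding Phi_surj by (simp add: residue_ring_def)
  then show thesis using that by (metis imageE)
qed

text \<open>Each unit of Z_3 is its own inverse, so \<open>r\<close> itself serves as
  \<open>t\<close>: the residue of \<open>r\<close> squared is 1.\<close>

lemma inverse_mod_I:
  assumes r: "r \<in> carrier R" "\<Phi> r \<noteq> 0"
  obtains t i where "t \<in> carrier R" "i \<in> I" "t \<otimes> r = \<one> \<oplus> i"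
proof -
  have *: "\<Phi> (r \<otimes> r) = 1"
    using r by (cases rule: Phi_cases[OF r(1)]) (auto simp: Phi_mult)
  have "r \<otimes> r \<ominus> \<one> \<in> I"
    using r * by (simp add: diff_in_I Phi_one)
  moreover have "r \<otimes> r = \<one> \<oplus> (r \<otimes> r \<ominus> \<one>)"
    using r by algebra
  ultimately show thesis using that r by blast
qed

text \<open>Each residue has one of the representatives 0, 1, 1 + 1. An additive property of scalars
  therefore has to be checked only on \<open>I\<close> and at the unit.\<close>

lemma decompose:
  assumes r: "r \<in> carrier R"
  obtains (zero) "r \<in> I" | (one) i where "i \<in> I" "r = \<one> \<oplus> i"
  | (two) i where "i \<in> I" "r = (\<one> \<oplus> \<one>) \<oplus> i"
proof (cases rule: Phi_cases[OF r])
  case 1 then show thesis using zero r by (simp add: I_iff)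
next
  case 2
  then have "r \<ominus> \<one> \<in> I" using r by (simp add: diff_in_I Phi_one)
  moreover have "r = \<one> \<oplus> (r \<ominus> \<one>)" using r by algebra
  ultimately show thesis using one by blast
next
  case 3
  then have "r \<ominus> (\<one> \<oplus> \<one>) \<in> I" using r by (simp add: diff_in_I Phi_one Phi_add)
  moreover have "r = (\<one> \<oplus> \<one>) \<oplus> (r \<ominus> (\<one> \<oplus> \<one>))" using r by algebra
  ultimately show thesis using two by blast
qed

lemma I_mult: "\<lbrakk>r \<in> I; s \<in> carrier R\<rbrakk> \<Longrightarrow> s \<otimes> r \<in> I"
  by (simp add: I_iff Phi_mult)

lemma I_minus: "r \<in> I \<Longrightarrow> \<ominus> r \<in> I"
  by (simp add: I_iff Phi_minus)

lemma ideal_I: "ideal I R"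
proof (rule idealI)
  show "ring R" by unfold_locales
  show "subgroup I (add_monoid R)"
  proof (rule add.subgroupI)
    have "\<zero> \<in> I" by (simp add: I_iff Phi_zero)
    then show "I \<noteq> {}" by blast
  qed (auto simp: I_iff Phi_minus Phi_add)
qed (auto simp: I_iff Phi_mult)

end

section \<open>Consequences of the Moufang law\<close>

context commutative_moufang_loop
begin

lemma cancel_left:
  "\<lbrakk>a \<oplus> x = a \<oplus> y; a \<in> carrier Q; x \<in> carrier Q; y \<in> carrier Q\<rbrakk> \<Longrightarrow> x = y"
  using left_division[of a "a \<oplus> y"] add_closed by metis

lemma left_alternative:
  "\<lbrakk>x \<in> carrier Q; b \<in> carrier Q\<rbrakk> \<Longrightarrow> x \<oplus> (x \<oplus> b) = (x \<oplus> x) \<oplus> b"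
  using moufang[of x \<zero> b] by (simp add: zero_closed zero_left zero_right)

text \<open>Writing \<open>y\<close> as \<open>x + a\<close>, the Moufang law with second argument 0
  turns \<open>(x + x) + a\<close> into \<open>y + x\<close>, while left alternativity turns it into
  \<open>x + y\<close>.\<close>

lemma commute:
  assumes x: "x \<in> carrier Q" and y: "y \<in> carrier Q"
  shows "x \<oplus> y = y \<oplus> x"
proof -
  obtain a where a: "a \<in> carrier Q" "x \<oplus> a = y" using left_division[OF x y] by blast
  have "(x \<oplus> x) \<oplus> a = (x \<oplus> a) \<oplus> x"
    using moufang[OF x a(1) zero_closed] x a by (simp add: zero_right)
  then show ?thesis using left_alternative[OF x a(1)] a by simp
qed

text \<open>The Moufang law gives \<open>(x + x) + (n + y) = (x + n) + (x + y) = x + y\<close>. By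
  left alternativity the left side is \<open>x + (x + (n + y))\<close>, and one \<open>x\<close> is
  cancelled.\<close>

lemma inverse_property:
  assumes x: "x \<in> carrier Q" and n: "n \<in> carrier Q" and xn: "x \<oplus> n = \<zero>" and y: "y \<in> carrier Q"
  shows "x \<oplus> (n \<oplus> y) = y"
proof -
  have "x \<oplus> (x \<oplus> (n \<oplus> y)) = x \<oplus> y"
    using moufang[OF x n y] left_alternative[OF x add_closed[OF n y]] x n y xn
    by (simp add: zero_left add_closed)
  then show ?thesis using cancel_left[OF _ x add_closed[OF x add_closed[OF n y]] y] by blast
qed

text \<open>The inner mapping \<open>a \<mapsto> - (x + y) + (x + (y + a))\<close> is an automorphism.\<close>

lemma inner_mapping_additive:
  assumes c: "x \<in> carrier Q" "y \<in> carrier Q" "a \<in> carrier Q" "b \<in> carrier Q"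
      "p \<in> carrier Q" "q \<in> carrier Q" "t \<in> carrier Q"
    and p: "x \<oplus> (y \<oplus> a) = (x \<oplus> y) \<oplus> p"
    and q: "x \<oplus> (y \<oplus> b) = (x \<oplus> y) \<oplus> q"
    and t: "x \<oplus> (y \<oplus> (a \<oplus> b)) = (x \<oplus> y) \<oplus> t"
  shows "t = p \<oplus> q"
proof -
  let ?s = "x \<oplus> y"
  note cl = c add_closed zero_closed
  \<comment> \<open>Adding the double of \<open>x + y\<close> lets the Moufang law split
    \<open>p + q\<close> into the two given equations and then recombine them for
    \<open>a + b\<close>.\<close>
  have "(?s \<oplus> ?s) \<oplus> (p \<oplus> q) = (x \<oplus> (y \<oplus> a)) \<oplus> (x \<oplus> (y \<oplus> b))"
    by (simp add: p q moufang cl)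
  also have "\<dots> = (x \<oplus> x) \<oplus> ((y \<oplus> y) \<oplus> (a \<oplus> b))"
    using moufang[of x "y \<oplus> a" "y \<oplus> b"] moufang[of y a b] by (simp add: cl)
  also have "\<dots> = (x \<oplus> x) \<oplus> ((y \<oplus> (a \<oplus> b)) \<oplus> (y \<oplus> \<zero>))"
    using moufang[of y "a \<oplus> b" \<zero>] by (simp add: cl zero_right)
  also have "\<dots> = (x \<oplus> (y \<oplus> (a \<oplus> b))) \<oplus> (x \<oplus> (y \<oplus> \<zero>))"
    using moufang[of x "y \<oplus> (a \<oplus> b)" "y \<oplus> \<zero>"] by (simp add: cl)
  also have "\<dots> = (?s \<oplus> t) \<oplus> (?s \<oplus> \<zero>)"
    by (simp add: t zero_right cl)
  also have "\<dots> = (?s \<oplus> ?s) \<oplus> t"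
    using moufang[of ?s t \<zero>] by (simp add: cl zero_right)
  finally show ?thesis by (rule cancel_left[symmetric]) (simp_all add: cl)
qed

end

section \<open>The centre of a quasimodule\<close>

context quasimodule
begin

abbreviation plus_Q :: "'q \<Rightarrow> 'q \<Rightarrow> 'q" (infixl "\<boxplus>" 65) where "x \<boxplus> y \<equiv> x \<oplus>\<^bsub>Q\<^esub> y"
abbreviation smult_Q :: "'r \<Rightarrow> 'q \<Rightarrow> 'q" (infixr "\<cdot>" 72) where "r \<cdot> x \<equiv> r \<odot>\<^bsub>Q\<^esub> x"

lemma smult_zero: "r \<in> carrier R \<Longrightarrow> r \<cdot> \<zero>\<^bsub>Q\<^esub> = \<zero>\<^bsub>Q\<^esub>"
  using mult_smult[of r \<zero> "\<zero>\<^bsub>Q\<^esub>"] by (simp add: zero_smult Q.zero_closed)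

lemma smult_neg: "x \<in> carrier Q \<Longrightarrow> x \<boxplus> (\<ominus> \<one>) \<cdot> x = \<zero>\<^bsub>Q\<^esub>"
  using add_smult[of \<one> "\<ominus> \<one>" x] by (simp add: one_smult zero_smult R.r_neg)

text \<open>Associating in the first position suffices: by commutativity such an element associates
  in every position.\<close>

definition center :: "'q set" where
  "center = {z \<in> carrier Q. \<forall>x\<in>carrier Q. \<forall>y\<in>carrier Q. z \<boxplus> (x \<boxplus> y) = (z \<boxplus> x) \<boxplus> y}"

lemma center_closed: "z \<in> center \<Longrightarrow> z \<in> carrier Q"
  by (simp add: center_def)

lemma center_assoc:
  assumes "z \<in> center" "x \<in> carrier Q" "y \<in> carrier Q"
  shows "(x \<boxplus> y) \<boxplus> z = x \<boxplus> (y \<boxplus> z)" "(x \<boxplus> z) \<boxplus> y = (x \<boxplus> y) \<boxplus> z"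
proof -
  have *: "z \<boxplus> (u \<boxplus> v) = (z \<boxplus> u) \<boxplus> v" if "u \<in> carrier Q" "v \<in> carrier Q" for u v
    using assms(1) that by (simp add: center_def)
    have "z \<in> carrier Q" using assms center_closed by blast
    then have "(x \<boxplus> y) \<boxplus> z = x \<boxplus> (y \<boxplus> z) \<and> (x \<boxplus> z) \<boxplus> y = (x \<boxplus> y) \<boxplus> z"
      using *[of y x] *[of x y] assms Q.commute[of z] Q.commute[of x y] Q.commute[of x "y \<boxplus> z"]
        Q.commute[of "x \<boxplus> y" z]
      by (simp add: Q.add_closed)
    then show "(x \<boxplus> y) \<boxplus> z = x \<boxplus> (y \<boxplus> z)" "(x \<boxplus> z) \<boxplus> y = (x \<boxplus> y) \<boxplus> z" by simp_all
qed

lemma center_add: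
  assumes "z \<in> center" "w \<in> center"
  shows "z \<boxplus> w \<in> center"
proof -
  have "(z \<boxplus> w) \<boxplus> (x \<boxplus> y) = ((z \<boxplus> w) \<boxplus> x) \<boxplus> y" if "x \<in> carrier Q" "y \<in> carrier Q" for x y
  proof -
    have zw: "z \<in> carrier Q" "w \<in> carrier Q" using assms center_closed by auto
    have *: "u \<boxplus> (a \<boxplus> b) = (u \<boxplus> a) \<boxplus> b" if "u \<in> center" "a \<in> carrier Q" "b \<in> carrier Q" for u a b
      using that by (simp add: center_def)
    show ?thesis
      using *[OF assms(1), of w "x \<boxplus> y"] *[OF assms(2), of x y] *[OF assms(1), of "w \<boxplus> x" y]
        *[OF assms(1), of w x] that zw by (simp add: Q.add_closed)
  qed
  then show ?thesis using assms by (simp add: center_def Q.add_closed)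
qed

end

section \<open>Associativity defects in hamiltonian quasimodules\<close>

locale hamiltonian = R?: cring_onto_Z3 R \<Phi> + quasimodule R \<Phi> Q
  for R :: "('r, 'a) ring_scheme" (structure) and \<Phi> and Q :: "('r, 'q) module" (structure) +
  assumes hamiltonian: "hamiltonian_quasimodule R \<Phi> Q"
begin

lemmas Q_closed = Q.add_closed Q.zero_closed smult_closed

lemma I_smult_center: "\<lbrakk>r \<in> I; x \<in> carrier Q\<rbrakk> \<Longrightarrow> r \<cdot> x \<in> center"
  unfolding center_def using kernel_assoc smult_closed I_subset by blast

text \<open>Sums of multiples of \<open>g\<close> are again multiples because
  \<open>r g + s g = (r + s) g\<close>, so closure holds although the loop need not be
  associative.\<close>

lemma subquasimodule_cyclic:
  assumes g: "g \<in> carrier Q"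
  shows "subquasimodule ((\<lambda>r. r \<cdot> g) ` carrier R) R \<Phi> Q" (is "subquasimodule ?H R \<Phi> Q")
proof -
  have sub: "?H \<subseteq> carrier Q" using g smult_closed by blast
  have add: "x \<boxplus> y \<in> ?H" if "x \<in> ?H" "y \<in> ?H" for x y
  proof -
    from that obtain r s where "r \<in> carrier R" "s \<in> carrier R" "x = r \<cdot> g" "y = s \<cdot> g" by auto
    then have "x \<boxplus> y = (r \<oplus> s) \<cdot> g" "r \<oplus> s \<in> carrier R" using g by (simp_all add: add_smult)
    then show ?thesis by blast
  qed
  have smult: "r \<cdot> x \<in> ?H" if r: "r \<in> carrier R" and x: "x \<in> ?H" for r x
  proof -
    from x obtain s where "s \<in> carrier R" "x = s \<cdot> g" by auto
    then have "r \<cdot> x = (r \<otimes> s) \<cdot> g" "r \<otimes> s \<in> carrier R" using g r by (simp_all add: mult_smult)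
    then show ?thesis by blast
  qed
  have zero: "\<zero>\<^bsub>Q\<^esub> \<in> ?H"
    using g zero_smult[OF g] by (metis R.zero_closed imageI)
  \<comment> \<open>Division does not leave \<open>Rg\<close>: the solution of
    \<open>a + x = b\<close> is \<open>(-1) a + b\<close>, which is built from the quasimodule
    operations.\<close>
  have div: "\<exists>!x. x \<in> ?H \<and> a \<boxplus> x = b" if ab: "a \<in> ?H" "b \<in> ?H" for a b
  proof -
    have aQ: "a \<in> carrier Q" "b \<in> carrier Q" using ab sub by auto
    have n: "(\<ominus> \<one>) \<cdot> a \<boxplus> b \<in> ?H" using add smult ab by simp
    moreover have "a \<boxplus> ((\<ominus> \<one>) \<cdot> a \<boxplus> b) = b"
      using aQ by (simp add: Q.inverse_property smult_neg smult_closed)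
    moreover have "x = x'" if "x \<in> ?H" "a \<boxplus> x = b" "x' \<in> ?H" "a \<boxplus> x' = b" for x x'
      using Q.cancel_left[of a x x'] that aQ sub by auto
    ultimately show ?thesis by blast
  qed
  have "quasimodule R \<Phi> (Q\<lparr>carrier := ?H\<rparr>)"
  proof (intro quasimodule.intro commutative_moufang_loop.intro quasimodule_axioms.intro, goal_cases)
    case (4 a b)
    then show ?case using div[of a b] by simp
  next
    case (5 a b)
    then have "a \<in> ?H" "b \<in> ?H" by simp_all
    then have "x \<boxplus> a = a \<boxplus> x" if "x \<in> ?H" for x
      using that sub by (intro Q.commute) (auto simp only: subset_iff)
    then have "x \<in> ?H \<and> x \<boxplus> a = b \<longleftrightarrow> x \<in> ?H \<and> a \<boxplus> x = b" for x by metis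
    then have "\<exists>!x. x \<in> ?H \<and> x \<boxplus> a = b"
      using div[OF \<open>a \<in> ?H\<close> \<open>b \<in> ?H\<close>] by presburger
    then show ?case by simp
  next
    case (8 x a b)
    then have "x \<in> ?H" "a \<in> ?H" "b \<in> ?H" by simp_all
    then have "x \<in> carrier Q" "a \<in> carrier Q" "b \<in> carrier Q" using sub by blast+
    then show ?case using Q.moufang by simp
  qed (use sub add zero smult g in \<open>auto simp: smult_closed R.is_cring Q.zero_left Q.zero_right
        smult_add add_smult mult_smult one_smult zero_smult subset_iff kernel_assoc\<close>)
  then show ?thesis using sub by (simp add: subquasimodule_def)
qed

text \<open>Normality only makes \<open>Rg\<close> some block of a congruence; since it contains 0,
  it is the block of 0.\<close>

lemma cyclic_congruence:
  assumes g: "g \<in> carrier Q"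
  obtains \<theta> where "quasimodule_congruence \<theta> R Q"
    "\<And>x. (x, \<zero>\<^bsub>Q\<^esub>) \<in> \<theta> \<longleftrightarrow> (\<exists>r\<in>carrier R. x = r \<cdot> g)"
proof -
  let ?H = "(\<lambda>r. r \<cdot> g) ` carrier R"
  from hamiltonian subquasimodule_cyclic[OF g]
  obtain \<theta> where \<theta>: "quasimodule_congruence \<theta> R Q" "?H \<in> carrier Q // \<theta>"
    unfolding hamiltonian_quasimodule_def normal_subquasimodule_def by blast
  have eq: "equiv (carrier Q) \<theta>" using \<theta>(1) by (simp add: quasimodule_congruence_def)
  have "\<zero>\<^bsub>Q\<^esub> \<in> ?H" using zero_smult[OF g] by (metis R.zero_closed imageI)
  then have "?H = \<theta> `` {\<zero>\<^bsub>Q\<^esub>}"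
    using \<theta>(2) eq by (metis Image_singleton_iff equiv_class_eq quotientE)
  moreover have "(x, \<zero>\<^bsub>Q\<^esub>) \<in> \<theta> \<longleftrightarrow> (\<zero>\<^bsub>Q\<^esub>, x) \<in> \<theta>" for x
    using eq by (meson equivE symE)
  ultimately have "(x, \<zero>\<^bsub>Q\<^esub>) \<in> \<theta> \<longleftrightarrow> (\<exists>r\<in>carrier R. x = r \<cdot> g)" for x by auto
  with \<theta>(1) show thesis by (rule that)
qed

text \<open>Modulo \<open>Rg\<close> one of the three elements becomes \<open>0\<close>, and then both bracketings agree.\<close>

lemma defect_in_cyclic:
  assumes c: "x \<in> carrier Q" "y \<in> carrier Q" "z \<in> carrier Q" "c \<in> carrier Q"
    and eq: "x \<boxplus> (y \<boxplus> z) = ((x \<boxplus> y) \<boxplus> z) \<boxplus> c"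
    and g: "g \<in> {x, y, z}"
  shows "\<exists>r\<in>carrier R. c = r \<cdot> g"
proof -
  have gQ: "g \<in> carrier Q" using g c by auto
  obtain \<theta> where \<theta>: "quasimodule_congruence \<theta> R Q"
    and zero: "\<And>x. (x, \<zero>\<^bsub>Q\<^esub>) \<in> \<theta> \<longleftrightarrow> (\<exists>r\<in>carrier R. x = r \<cdot> g)"
    using cyclic_congruence[OF gQ] by blast
  have equiv: "equiv (carrier Q) \<theta>" using \<theta> by (simp add: quasimodule_congruence_def)
  have r: "(u, u) \<in> \<theta>" if "u \<in> carrier Q" for u using equiv that by (meson equivE refl_onD)
  have tr: "(u, w) \<in> \<theta>" if "(u, v) \<in> \<theta>" "(v, w) \<in> \<theta>" for u v w
    using equiv that by (meson equivE transD)
  have sy: "(v, u) \<in> \<theta>" if "(u, v) \<in> \<theta>" for u v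
    using equiv that by (meson equivE symD)
  have ad: "(u \<boxplus> v, u' \<boxplus> v') \<in> \<theta>" if "(u, u') \<in> \<theta>" "(v, v') \<in> \<theta>" for u v u' v'
    using \<theta> that unfolding quasimodule_congruence_def by blast
  have g0: "(g, \<zero>\<^bsub>Q\<^esub>) \<in> \<theta>" using zero one_smult[OF gQ] R.one_closed by metis
  let ?p = "(x \<boxplus> y) \<boxplus> z"
  define x' y' z' where d: "x' = (if g = x then \<zero>\<^bsub>Q\<^esub> else x)" "y' = (if g = y then \<zero>\<^bsub>Q\<^esub> else y)"
    "z' = (if g = z then \<zero>\<^bsub>Q\<^esub> else z)"
  have d': "(x, x') \<in> \<theta>" "(y, y') \<in> \<theta>" "(z, z') \<in> \<theta>" using g0 r c by (auto simp: d)
  have c': "x' \<in> carrier Q" "y' \<in> carrier Q" "z' \<in> carrier Q" using c by (auto simp: d Q.zero_closed)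
  have "x' \<boxplus> (y' \<boxplus> z') = (x' \<boxplus> y') \<boxplus> z'"
    using g c by (auto simp: d Q_closed Q.zero_left Q.zero_right)
  then have "(?p \<boxplus> c, ?p) \<in> \<theta>"
    using ad[OF d'(1) ad[OF d'(2,3)]] ad[OF ad[OF d'(1,2)] d'(3)] sy tr eq by metis
  \<comment> \<open>Adding the negative of the common left bracketing isolates \<open>c\<close>; the
    inverse property cancels it without any associativity.\<close>
  then have "(((\<ominus> \<one>) \<cdot> ?p) \<boxplus> (?p \<boxplus> c), ((\<ominus> \<one>) \<cdot> ?p) \<boxplus> ?p) \<in> \<theta>"
    using ad r c by (simp add: Q_closed)
  moreover have "((\<ominus> \<one>) \<cdot> ?p) \<boxplus> (?p \<boxplus> c) = c" "((\<ominus> \<one>) \<cdot> ?p) \<boxplus> ?p = \<zero>\<^bsub>Q\<^esub>"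
    using Q.inverse_property[of "(\<ominus> \<one>) \<cdot> ?p" ?p c] smult_neg[of ?p] Q.commute[of ?p "(\<ominus> \<one>) \<cdot> ?p"] c
    by (simp_all add: Q_closed)
  ultimately show ?thesis using zero by simp
qed

text \<open>Modulo \<open>I\<close> the scalar \<open>m\<close> is 0, 1 or -1, and multiples by
  elements of \<open>I\<close> are central. For 1 the claim is the alternative law, for -1 the
  inverse property.\<close>

lemma multiple_associates:
  assumes c: "x \<in> carrier Q" "y \<in> carrier Q" and m: "m \<in> carrier R"
  shows "x \<boxplus> (y \<boxplus> m \<cdot> y) = (x \<boxplus> y) \<boxplus> m \<cdot> y"
proof -
  have alt: "x \<boxplus> (y \<boxplus> y) = (x \<boxplus> y) \<boxplus> y"
    using Q.left_alternative[of y x] c Q.commute by (simp add: Q_closed)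
  \<comment> \<open>A central summand can be added to \<open>n\<close> without disturbing the
    identity, which reduces \<open>m\<close> to its residue.\<close>
  have c1: "x \<boxplus> (y \<boxplus> (n \<boxplus> z)) = (x \<boxplus> y) \<boxplus> (n \<boxplus> z)"
    if "x \<boxplus> (y \<boxplus> n) = (x \<boxplus> y) \<boxplus> n" "n \<in> carrier Q" "z \<in> center" for n z
    using that c center_assoc[OF that(3)] center_closed by (metis Q_closed(1))
  have z: "i \<cdot> y \<in> center" if "i \<in> I" for i using I_smult_center that c by blast
  show ?thesis
  proof (cases rule: Phi_cases[OF m])
    case 1
    then have "m \<in> I" using m by (simp add: I_iff)
    then show ?thesis using center_assoc(1)[OF z[of m]] c by simp
  next
    case 2
    then have "m \<ominus> \<one> \<in> I" using m by (simp add: diff_in_I Phi_one)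
    moreover have "m = \<one> \<oplus> (m \<ominus> \<one>)" using m by algebra
    ultimately show ?thesis using c1[OF alt c(2) z] c I_subset add_smult[of \<one> "m \<ominus> \<one>" y] m
      by (simp add: one_smult)
  next
    case 3
    then have "m \<ominus> (\<ominus> \<one>) \<in> I" using m by (simp add: diff_in_I Phi_one Phi_minus)
    moreover have "m = (\<ominus> \<one>) \<oplus> (m \<ominus> (\<ominus> \<one>))" using m by algebra
    moreover have "x \<boxplus> (y \<boxplus> (\<ominus> \<one>) \<cdot> y) = (x \<boxplus> y) \<boxplus> (\<ominus> \<one>) \<cdot> y"
    proof -
      let ?n = "(\<ominus> \<one>) \<cdot> y"
      have "?n \<boxplus> (y \<boxplus> x) = x"
        using Q.inverse_property[of ?n y x] smult_neg[OF c(2)] c Q.commute by (simp add: Q_closed)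
      then show ?thesis using smult_neg[OF c(2)] c Q.commute
        by (metis Q.zero_right R.add.inv_closed R.one_closed Q_closed(1,3))
    qed
    ultimately show ?thesis using c1[of "(\<ominus> \<one>) \<cdot> y"] c z m add_smult[of "\<ominus> \<one>" "m \<ominus> (\<ominus> \<one>)" y]
      by (metis Q_closed(3) R.add.inv_closed R.one_closed R.minus_closed)
  qed
qed

text \<open>If \<open>c = rz\<close> with \<open>r\<close> outside \<open>I\<close>, then \<open>z\<close> is a multiple of \<open>c\<close>, hence of \<open>y\<close>, up to a central
  element; so the triple associates and \<open>c = 0\<close>.\<close>

lemma defect_in_I_smult:
  assumes c: "x \<in> carrier Q" "y \<in> carrier Q" "z \<in> carrier Q" "c \<in> carrier Q"
    and eq: "x \<boxplus> (y \<boxplus> z) = ((x \<boxplus> y) \<boxplus> z) \<boxplus> c"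
  shows "\<exists>r\<in>I. c = r \<cdot> z"
proof -
  obtain r where r: "r \<in> carrier R" "c = r \<cdot> z"
    using defect_in_cyclic[OF c eq, of z] by auto
  obtain q where q: "q \<in> carrier R" "c = q \<cdot> y"
    using defect_in_cyclic[OF c eq, of y] by auto
  show ?thesis
  proof (cases "r \<in> I")
    case False
    then have "\<Phi> r \<noteq> 0" using r by (simp add: I_iff)
    then obtain t i where t: "t \<in> carrier R" "i \<in> I" "t \<otimes> r = \<one> \<oplus> i"
      using inverse_mod_I r(1) by blast
    have i: "i \<in> carrier R" using t I_subset by blast
    define w where "w = (\<ominus> i) \<cdot> z"
    have w: "w \<in> center" unfolding w_def using t I_minus I_smult_center c by blast
    have "t \<otimes> r \<oplus> (\<ominus> i) = \<one>" using t(1,3) r i by algebra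
    then have "z = (t \<otimes> r \<oplus> (\<ominus> i)) \<cdot> z" using c by (simp add: one_smult)
    also have "\<dots> = t \<cdot> c \<boxplus> w"
      using add_smult[of "t \<otimes> r" "\<ominus> i" z] mult_smult[of t r z] t(1) r c i by (simp add: w_def)
    also have "t \<cdot> c = (t \<otimes> q) \<cdot> y" using q t c by (simp add: mult_smult)
    finally have z: "z = (t \<otimes> q) \<cdot> y \<boxplus> w" .
    have "x \<boxplus> (y \<boxplus> z) = (x \<boxplus> y) \<boxplus> z"
      using multiple_associates[OF c(1,2), of "t \<otimes> q"] t q center_assoc[OF w] c
      unfolding z by (metis Q_closed(1,3) R.m_closed)
    then have "((x \<boxplus> y) \<boxplus> z) \<boxplus> c = ((x \<boxplus> y) \<boxplus> z) \<boxplus> \<zero>\<^bsub>Q\<^esub>"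
      using eq c by (simp add: Q_closed Q.zero_right)
    then have "c = \<zero>\<^bsub>Q\<^esub>"
      by (rule Q.cancel_left) (use c in \<open>simp_all add: Q_closed\<close>)
    then have "c = \<zero> \<cdot> z" "\<zero> \<in> I" using c by (simp_all add: zero_smult I_iff Phi_zero)
    then show ?thesis by blast
  qed (use r in blast)
qed

section \<open>The defect as a trilinear alternating map\<close>

definition defect :: "'q \<Rightarrow> 'q \<Rightarrow> 'q \<Rightarrow> 'q" where
  "defect x y z = (THE c. c \<in> carrier Q \<and> ((x \<boxplus> y) \<boxplus> z) \<boxplus> c = x \<boxplus> (y \<boxplus> z))"

lemma
  assumes c: "x \<in> carrier Q" "y \<in> carrier Q" "z \<in> carrier Q"
  shows defect_closed: "defect x y z \<in> carrier Q"
    and defect_eq: "x \<boxplus> (y \<boxplus> z) = ((x \<boxplus> y) \<boxplus> z) \<boxplus> defect x y z"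
    and defect_unique: "\<And>c. \<lbrakk>c \<in> carrier Q; x \<boxplus> (y \<boxplus> z) = ((x \<boxplus> y) \<boxplus> z) \<boxplus> c\<rbrakk> \<Longrightarrow> defect x y z = c"
proof -
  have ex: "\<exists>!c. c \<in> carrier Q \<and> ((x \<boxplus> y) \<boxplus> z) \<boxplus> c = x \<boxplus> (y \<boxplus> z)"
    using Q.left_division[of "(x \<boxplus> y) \<boxplus> z" "x \<boxplus> (y \<boxplus> z)"] c by (simp add: Q_closed)
  from theI'[OF ex] show "defect x y z \<in> carrier Q"
    and e: "x \<boxplus> (y \<boxplus> z) = ((x \<boxplus> y) \<boxplus> z) \<boxplus> defect x y z"
    unfolding defect_def by simp_all
  fix c assume "c \<in> carrier Q" "x \<boxplus> (y \<boxplus> z) = ((x \<boxplus> y) \<boxplus> z) \<boxplus> c"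
  then show "defect x y z = c" using ex unfolding defect_def by (intro the1_equality) auto
qed

lemma defect_zeroI:
  "\<lbrakk>x \<in> carrier Q; y \<in> carrier Q; z \<in> carrier Q; x \<boxplus> (y \<boxplus> z) = (x \<boxplus> y) \<boxplus> z\<rbrakk> \<Longrightarrow> defect x y z = \<zero>\<^bsub>Q\<^esub>"
  using defect_unique[of x y z "\<zero>\<^bsub>Q\<^esub>"] by (simp add: Q_closed Q.zero_right)

lemma defect_multiple:
  "\<lbrakk>x \<in> carrier Q; y \<in> carrier Q; z \<in> carrier Q\<rbrakk> \<Longrightarrow> \<exists>r\<in>I. defect x y z = r \<cdot> z"
  by (rule defect_in_I_smult[OF _ _ _ defect_closed defect_eq])

lemma defect_center:
  "\<lbrakk>x \<in> carrier Q; y \<in> carrier Q; z \<in> carrier Q\<rbrakk> \<Longrightarrow> defect x y z \<in> center"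
  using defect_multiple I_smult_center by metis

lemma defect_of_center:
  "\<lbrakk>x \<in> carrier Q; y \<in> carrier Q; z \<in> center\<rbrakk> \<Longrightarrow> defect x y z = \<zero>\<^bsub>Q\<^esub>"
  by (rule defect_zeroI) (simp_all add: center_assoc center_closed)

text \<open>Multiplying the defining equation by \<open>i\<close> shows that \<open>i\<close> times
  the defect is the defect of \<open>i x\<close>, \<open>i y\<close>, \<open>i z\<close>. This
  vanishes because \<open>i z\<close> is central.\<close>

lemma I_smult_defect:
  assumes c: "x \<in> carrier Q" "y \<in> carrier Q" "z \<in> carrier Q" and i: "i \<in> I"
  shows "i \<cdot> defect x y z = \<zero>\<^bsub>Q\<^esub>"
proof -
  have iR: "i \<in> carrier R" using i I_subset by blast
  have "i \<cdot> x \<boxplus> (i \<cdot> y \<boxplus> i \<cdot> z) = ((i \<cdot> x \<boxplus> i \<cdot> y) \<boxplus> i \<cdot> z) \<boxplus> i \<cdot> defect x y z"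
    using arg_cong[OF defect_eq[OF c], of "\<lambda>t. i \<cdot> t"] iR c
    by (simp add: smult_add Q_closed defect_closed)
  then have "defect (i \<cdot> x) (i \<cdot> y) (i \<cdot> z) = i \<cdot> defect x y z"
    using c iR by (intro defect_unique) (simp_all add: Q_closed defect_closed)
  then show ?thesis
    using defect_of_center[of "i \<cdot> x" "i \<cdot> y" "i \<cdot> z"] c iR I_smult_center[OF i] by (simp add: Q_closed)
qed

text \<open>The inner mapping given by \<open>x\<close> and \<open>y\<close> sends \<open>z\<close>
  to \<open>z + defect x y z\<close>. It is additive, and the central defects can be collected at
  the end.\<close>

lemma defect_add:
  assumes c: "x \<in> carrier Q" "y \<in> carrier Q" "a \<in> carrier Q" "b \<in> carrier Q"
  shows "defect x y (a \<boxplus> b) = defect x y a \<boxplus> defect x y b"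
proof -
  note cl = c Q_closed(1) defect_closed
  have shift: "x \<boxplus> (y \<boxplus> z) = (x \<boxplus> y) \<boxplus> (z \<boxplus> defect x y z)" if z: "z \<in> carrier Q" for z
    using defect_eq[OF c(1,2) z] center_assoc(1)[OF defect_center[OF c(1,2) z], of "x \<boxplus> y" z] c z
    by (simp add: Q_closed)
  have "(a \<boxplus> b) \<boxplus> defect x y (a \<boxplus> b) = (a \<boxplus> defect x y a) \<boxplus> (b \<boxplus> defect x y b)"
    by (rule Q.inner_mapping_additive[OF c _ _ _ shift shift shift]) (simp_all add: cl)
  also have "\<dots> = (a \<boxplus> b) \<boxplus> (defect x y a \<boxplus> defect x y b)"
    using center_assoc[OF defect_center[OF c(1,2,3)]] center_assoc[OF defect_center[OF c(1,2,4)]]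
    by (metis cl Q.commute)
  finally show ?thesis
    by (rule Q.cancel_left) (simp_all add: cl)
qed

text \<open>On \<open>I\<close> both sides are 0, and at the unit they agree; additivity in the last
  argument gives all other scalars.\<close>

lemma defect_smult:
  assumes c: "x \<in> carrier Q" "y \<in> carrier Q" "z \<in> carrier Q" and r: "r \<in> carrier R"
  shows "defect x y (r \<cdot> z) = r \<cdot> defect x y z"
proof -
  have I: "defect x y (i \<cdot> z) = i \<cdot> defect x y z" if "i \<in> I" for i
    using that defect_of_center I_smult_center I_smult_defect c by simp
  have one: "defect x y (\<one> \<cdot> z) = \<one> \<cdot> defect x y z"
    using c by (simp add: one_smult defect_closed)
  have add: "defect x y ((s \<oplus> t) \<cdot> z) = (s \<oplus> t) \<cdot> defect x y z"
    if "s \<in> carrier R" "t \<in> carrier R" "defect x y (s \<cdot> z) = s \<cdot> defect x y z"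
      "defect x y (t \<cdot> z) = t \<cdot> defect x y z" for s t
    using that c by (simp add: add_smult defect_add Q_closed defect_closed)
  show ?thesis
    using r by (cases rule: decompose) (use I I_subset one in \<open>auto intro!: add\<close>)
qed

lemma defect_same_left:
  "\<lbrakk>x \<in> carrier Q; y \<in> carrier Q\<rbrakk> \<Longrightarrow> defect x x y = \<zero>\<^bsub>Q\<^esub>"
  by (rule defect_zeroI) (simp_all add: Q.left_alternative)

lemma defect_same_outer:
  "\<lbrakk>x \<in> carrier Q; y \<in> carrier Q\<rbrakk> \<Longrightarrow> defect x y x = \<zero>\<^bsub>Q\<^esub>"
  by (rule defect_zeroI) (simp_all, metis Q.commute Q_closed(1))

lemma defect_same_right:
  "\<lbrakk>x \<in> carrier Q; y \<in> carrier Q\<rbrakk> \<Longrightarrow> defect y x x = \<zero>\<^bsub>Q\<^esub>"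
  by (rule defect_zeroI) (simp_all, metis Q.commute Q_closed(1) Q.left_alternative)

text \<open>The element \<open>x + (a + (x + b))\<close> is expanded in two ways: once as a defect
  with last argument \<open>x + b\<close>, whose left bracketing the Moufang law regroups, and once
  by first rewriting \<open>a + (b + x)\<close>.\<close>

lemma defect_cyclic:
  assumes c: "x \<in> carrier Q" "a \<in> carrier Q" "b \<in> carrier Q"
  shows "defect a b x = defect x a b"
proof -
  let ?s = "(x \<boxplus> x) \<boxplus> (a \<boxplus> b)" and ?e = "defect a b x"
  note cl = c Q_closed(1) defect_closed
  have "defect x a (x \<boxplus> b) = defect x a b"
    using c by (simp add: defect_add defect_same_outer Q.zero_left defect_closed)
  then have "x \<boxplus> (a \<boxplus> (x \<boxplus> b)) = ?s \<boxplus> defect x a b"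
    using defect_eq[of x a "x \<boxplus> b"] c by (simp add: Q_closed Q.moufang)
  moreover have "x \<boxplus> (a \<boxplus> (x \<boxplus> b)) = x \<boxplus> (((a \<boxplus> b) \<boxplus> x) \<boxplus> ?e)"
    using defect_eq[of a b x] Q.commute[of x b] c by simp
  moreover have "\<dots> = (x \<boxplus> ((a \<boxplus> b) \<boxplus> x)) \<boxplus> ?e"
    using center_assoc(1)[OF defect_center[of a b x], of x "(a \<boxplus> b) \<boxplus> x"] c by (simp add: Q_closed)
  moreover have "x \<boxplus> ((a \<boxplus> b) \<boxplus> x) = ?s"
    using Q.commute[of "a \<boxplus> b" x] Q.left_alternative[of x "a \<boxplus> b"] c by (simp add: Q_closed)
  ultimately have "?s \<boxplus> ?e = ?s \<boxplus> defect x a b" by simp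
  then show ?thesis by (rule Q.cancel_left) (simp_all add: cl)
qed

text \<open>Evaluation of an element of R^3 at the triple. It need not be additive, since the loop
  is not associative; on \<open>I \<times> I \<times> I\<close> all its terms are central and it
  is.\<close>

definition combination :: "'q \<Rightarrow> 'q \<Rightarrow> 'q \<Rightarrow> 'r \<times> 'r \<times> 'r \<Rightarrow> 'q" where
  "combination u v w = (\<lambda>(a, b, d). (a \<cdot> u \<boxplus> b \<cdot> v) \<boxplus> d \<cdot> w)"

text \<open>As in Cramer's rule, the defect of the combination with two of \<open>u\<close>,
  \<open>v\<close>, \<open>w\<close> is one coefficient times \<open>defect u v w\<close>. A
  coefficient outside \<open>I\<close> can be inverted modulo \<open>I\<close>, which annihilates
  the defect.\<close>

lemma defect_in_I_combination:
  assumes c: "u \<in> carrier Q" "v \<in> carrier Q" "w \<in> carrier Q"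
    and r: "a \<in> carrier R" "b \<in> carrier R" "d \<in> carrier R"
    and I: "\<not> (a \<in> I \<and> b \<in> I \<and> d \<in> I)"
  shows "\<exists>r\<in>I. defect u v w = r \<cdot> combination u v w (a, b, d)"
proof -
  let ?g = "combination u v w (a, b, d)"
  have g: "?g \<in> carrier Q" using c r by (simp add: combination_def Q_closed)
  \<comment> \<open>Here \<open>k\<close> stands for whichever coefficient lies outside
    \<open>I\<close>, and \<open>x\<close>, \<open>y\<close> for the two elements that extract
    it.\<close>
  have main: ?thesis if k: "k \<in> carrier R" "k \<notin> I" and xy: "x \<in> carrier Q" "y \<in> carrier Q"
    and eq: "defect x y ?g = k \<cdot> defect u v w" for x y k
  proof -
    obtain i where i: "i \<in> I" "k \<cdot> defect u v w = i \<cdot> ?g"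
      using defect_multiple[OF xy g] eq by metis
    obtain t j where t: "t \<in> carrier R" "j \<in> I" "t \<otimes> k = \<one> \<oplus> j"
      using inverse_mod_I[of k] k by (auto simp: I_iff)
    have iR: "i \<in> carrier R" "j \<in> carrier R" using i t I_subset by auto
    have D: "defect u v w \<in> carrier Q" using c by (rule defect_closed)
    have "(t \<otimes> i) \<cdot> ?g = t \<cdot> (k \<cdot> defect u v w)" using t iR g i by (simp add: mult_smult)
    also have "\<dots> = (\<one> \<oplus> j) \<cdot> defect u v w" using t k c by (simp add: mult_smult[symmetric] defect_closed)
    also have "\<dots> = defect u v w" using iR D I_smult_defect[OF c t(2)] by (simp add: add_smult one_smult Q.zero_right)
    finally show ?thesis using I_mult[OF i(1) t(1)] by metis
  qed
  have exp: "defect x y ?g = (a \<cdot> defect x y u \<boxplus> b \<cdot> defect x y v) \<boxplus> d \<cdot> defect x y w"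
    if "x \<in> carrier Q" "y \<in> carrier Q" for x y
    using that c r by (simp add: combination_def defect_add defect_smult Q_closed)
  note z = defect_same_left defect_same_outer defect_same_right smult_zero Q.zero_left Q.zero_right
  have "defect v w ?g = a \<cdot> defect u v w"
    using exp[of v w] c r defect_cyclic[of u v w] by (simp add: z Q_closed defect_closed)
  moreover have "defect w u ?g = b \<cdot> defect u v w"
    using exp[of w u] c r defect_cyclic[of w u v] by (simp add: z Q_closed defect_closed)
  moreover have "defect u v ?g = d \<cdot> defect u v w"
    using exp[of u v] c r by (simp add: z Q_closed defect_closed)
  ultimately show ?thesis using main[of a v w] main[of b w u] main[of d u v] I c r by blast
qed

end

section \<open>Modules with a simple essential socle\<close>

context module
begin

lemma submodule_zero_mem: "submodule N R M \<Longrightarrow> \<zero>\<^bsub>M\<^esub> \<in> N"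
  using subgroup.one_closed[OF submodule.axioms(1)] by fastforce

lemma submodule_trivial: "submodule {\<zero>\<^bsub>M\<^esub>} R M"
  by (rule submoduleI) auto

lemma submodule_Union:
  assumes "C \<noteq> {}" and sub: "\<And>N. N \<in> C \<Longrightarrow> submodule N R M"
    and chain: "\<And>N N'. \<lbrakk>N \<in> C; N' \<in> C\<rbrakk> \<Longrightarrow> N \<subseteq> N' \<or> N' \<subseteq> N"
  shows "submodule (\<Union>C) R M"
proof (rule submoduleI)
  fix a b assume "a \<in> \<Union>C" "b \<in> \<Union>C"
  then obtain N N' where N: "N \<in> C" "N' \<in> C" "a \<in> N" "b \<in> N'" by blast
  from chain[OF N(1,2)] show "a \<oplus>\<^bsub>M\<^esub> b \<in> \<Union>C"
  proof
    assume "N \<subseteq> N'"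
    then show ?thesis using N submoduleE(5)[OF sub[OF N(2)], of a b] by blast
  next
    assume "N' \<subseteq> N"
    then show ?thesis using N submoduleE(5)[OF sub[OF N(1)], of a b] by blast
  qed
next
  fix r a assume "r \<in> carrier R" "a \<in> \<Union>C"
  then show "r \<odot>\<^bsub>M\<^esub> a \<in> \<Union>C" using submoduleE(4)[OF sub] by blast
next
  fix a assume "a \<in> \<Union>C"
  then show "\<ominus>\<^bsub>M\<^esub> a \<in> \<Union>C" using submoduleE(3)[OF sub] by blast
next
  show "\<Union>C \<subseteq> carrier M" using submoduleE(1)[OF sub] by blast
  show "\<zero>\<^bsub>M\<^esub> \<in> \<Union>C" using submodule_zero_mem[OF sub] \<open>C \<noteq> {}\<close> by blast
qed

lemma submodule_sum:
  assumes N: "submodule N R M" and H: "submodule H R M"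
  shows "submodule {n \<oplus>\<^bsub>M\<^esub> h | n h. n \<in> N \<and> h \<in> H} R M" (is "submodule ?S R M")
proof (rule submoduleI)
  note E = submoduleE[OF N] submoduleE[OF H]
  have c: "n \<in> carrier M" if "n \<in> N \<or> n \<in> H" for n using that E(1,7) by blast
  show "?S \<subseteq> carrier M" using c by auto
  show "\<zero>\<^bsub>M\<^esub> \<in> ?S"
    using submodule_zero_mem[OF N] submodule_zero_mem[OF H] by force
  fix a assume "a \<in> ?S"
  then obtain n h where a: "n \<in> N" "h \<in> H" "a = n \<oplus>\<^bsub>M\<^esub> h" by blast
  then have "\<ominus>\<^bsub>M\<^esub> a = \<ominus>\<^bsub>M\<^esub> n \<oplus>\<^bsub>M\<^esub> \<ominus>\<^bsub>M\<^esub> h" using c by (simp add: M.minus_add)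
  then show "\<ominus>\<^bsub>M\<^esub> a \<in> ?S" using a E(3,9) by blast
  { fix r assume r: "r \<in> carrier R"
    then have "r \<odot>\<^bsub>M\<^esub> a = r \<odot>\<^bsub>M\<^esub> n \<oplus>\<^bsub>M\<^esub> r \<odot>\<^bsub>M\<^esub> h" using a c by (simp add: smult_r_distr)
    then show "r \<odot>\<^bsub>M\<^esub> a \<in> ?S" using a r E(4,10) by blast }
  fix b assume "b \<in> ?S"
  then obtain n' h' where b: "n' \<in> N" "h' \<in> H" "b = n' \<oplus>\<^bsub>M\<^esub> h'" by blast
  then have "a \<oplus>\<^bsub>M\<^esub> b = (n \<oplus>\<^bsub>M\<^esub> n') \<oplus>\<^bsub>M\<^esub> (h \<oplus>\<^bsub>M\<^esub> h')" using a c by (simp add: M.a_ac)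
  moreover have "n \<oplus>\<^bsub>M\<^esub> n' \<in> N" "h \<oplus>\<^bsub>M\<^esub> h' \<in> H" using a b E(5,11) by auto
  ultimately show "a \<oplus>\<^bsub>M\<^esub> b \<in> ?S" by blast
qed

lemma submodule_cyclic:
  assumes x: "x \<in> carrier M"
  shows "submodule ((\<lambda>r. r \<odot>\<^bsub>M\<^esub> x) ` carrier R) R M" (is "submodule ?S R M")
proof (rule submoduleI)
  show "?S \<subseteq> carrier M" using x by auto
  show "\<zero>\<^bsub>M\<^esub> \<in> ?S" using x smult_l_null[OF x] by (metis R.zero_closed imageI)
  fix a assume "a \<in> ?S"
  then obtain r where a: "r \<in> carrier R" "a = r \<odot>\<^bsub>M\<^esub> x" by auto
  then have "\<ominus>\<^bsub>M\<^esub> a = (\<ominus> r) \<odot>\<^bsub>M\<^esub> x" "\<ominus> r \<in> carrier R" using x by (simp_all add: smult_l_minus)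
  then show "\<ominus>\<^bsub>M\<^esub> a \<in> ?S" by blast
  { fix s assume "s \<in> carrier R"
    then have "s \<odot>\<^bsub>M\<^esub> a = (s \<otimes> r) \<odot>\<^bsub>M\<^esub> x" "s \<otimes> r \<in> carrier R" using a x by (simp_all add: smult_assoc1)
    then show "s \<odot>\<^bsub>M\<^esub> a \<in> ?S" by blast }
  fix b assume "b \<in> ?S"
  then obtain s where b: "s \<in> carrier R" "b = s \<odot>\<^bsub>M\<^esub> x" by auto
  then have "a \<oplus>\<^bsub>M\<^esub> b = (r \<oplus> s) \<odot>\<^bsub>M\<^esub> x" "r \<oplus> s \<in> carrier R" using a x by (simp_all add: smult_l_distr)
  then show "a \<oplus>\<^bsub>M\<^esub> b \<in> ?S" by blast
qed

lemma submodule_sum_contains: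
  assumes N: "submodule N R M" and H: "submodule H R M"
  shows "N \<subseteq> {n \<oplus>\<^bsub>M\<^esub> h | n h. n \<in> N \<and> h \<in> H}" "H \<subseteq> {n \<oplus>\<^bsub>M\<^esub> h | n h. n \<in> N \<and> h \<in> H}"
proof -
  show "N \<subseteq> {n \<oplus>\<^bsub>M\<^esub> h | n h. n \<in> N \<and> h \<in> H}"
  proof
    fix x assume "x \<in> N"
    moreover from this have "x = x \<oplus>\<^bsub>M\<^esub> \<zero>\<^bsub>M\<^esub>" using submoduleE(1)[OF N] by auto
    ultimately show "x \<in> {n \<oplus>\<^bsub>M\<^esub> h | n h. n \<in> N \<and> h \<in> H}"
      using submodule_zero_mem[OF H] by blast
  qed
  show "H \<subseteq> {n \<oplus>\<^bsub>M\<^esub> h | n h. n \<in> N \<and> h \<in> H}"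
  proof
    fix x assume "x \<in> H"
    moreover from this have "x = \<zero>\<^bsub>M\<^esub> \<oplus>\<^bsub>M\<^esub> x" using submoduleE(1)[OF H] by auto
    ultimately show "x \<in> {n \<oplus>\<^bsub>M\<^esub> h | n h. n \<in> N \<and> h \<in> H}"
      using submodule_zero_mem[OF N] by blast
  qed
qed

lemma cyclic_self: "x \<in> carrier M \<Longrightarrow> x \<in> (\<lambda>r. r \<odot>\<^bsub>M\<^esub> x) ` carrier R"
  by (rule image_eqI[of _ _ \<one>]) auto

end

lemma generated_submodule_props:
  fixes R :: "('r, 'a) ring_scheme" and M :: "('r, 'm) module"
  assumes "module R M" and "A \<subseteq> carrier M"
  shows "submodule (generated_submodule R M A) R M" "A \<subseteq> generated_submodule R M A"
    "\<And>H. \<lbrakk>submodule H R M; A \<subseteq> H\<rbrakk> \<Longrightarrow> generated_submodule R M A \<subseteq> H"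
proof -
  interpret module R M by fact
  have car: "submodule (carrier M) R M" by (rule submoduleI) auto
  show "submodule (generated_submodule R M A) R M"
  proof (rule submoduleI)
    show "generated_submodule R M A \<subseteq> carrier M"
      unfolding generated_submodule_def using car assms by blast
  qed (auto simp: generated_submodule_def submodule_zero_mem dest: submoduleE)
qed (auto simp: generated_submodule_def)

text \<open>In a noetherian ring a non-empty chain of ideals contains its own union, so Zorn's lemma
  applies inside the family.\<close>

lemma (in noetherian_ring) maximal_ideal_in_family:
  assumes "F \<noteq> {}" "\<And>J. J \<in> F \<Longrightarrow> ideal J R"
  shows "\<exists>J\<in>F. \<forall>J'\<in>F. J \<subseteq> J' \<longrightarrow> J' = J"
proof (rule subset_Zorn_nonempty[OF assms(1)])
  fix C assume C: "C \<noteq> {}" "subset.chain F C"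
  then have CF: "C \<subseteq> F" by (simp add: subset_chain_def)
  then have "C \<subseteq> {I. ideal I R}" using assms(2) by auto
  then have "subset.chain {I. ideal I R} C" using C(2) by (simp add: subset_chain_def)
  then have "\<Union>C \<in> C" by (rule ideal_chain_is_trivial[OF C(1)])
  then show "\<Union>C \<in> F" using CF by blast
qed

section \<open>Finite extensions and the sequence of iterated kernels\<close>

locale Z3_module = R?: cring_onto_Z3 R \<Phi> + module R M
  for R :: "('r, 'a) ring_scheme" (structure) and \<Phi> and M :: "('r, 'm) module" (structure)
begin

lemma Z3_multiples:
  assumes s: "s \<in> carrier M" "\<And>r. r \<in> I \<Longrightarrow> r \<odot>\<^bsub>M\<^esub> s = \<zero>\<^bsub>M\<^esub>"
    and r: "r \<in> carrier R" "r' \<in> carrier R" "\<Phi> r = \<Phi> r'"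
  shows "r \<odot>\<^bsub>M\<^esub> s = r' \<odot>\<^bsub>M\<^esub> s"
proof -
  have "r = (r \<ominus> r') \<oplus> r'" using r by algebra
  then have "r \<odot>\<^bsub>M\<^esub> s = (r \<ominus> r') \<odot>\<^bsub>M\<^esub> s \<oplus>\<^bsub>M\<^esub> r' \<odot>\<^bsub>M\<^esub> s"
    using smult_l_distr[of "r \<ominus> r'" r' s] r s by simp
  moreover have "(r \<ominus> r') \<odot>\<^bsub>M\<^esub> s = \<zero>\<^bsub>M\<^esub>" using s(2) r diff_in_I by blast
  ultimately show ?thesis using r s by simp
qed

text \<open>Since \<open>I x\<close> lies in \<open>H\<close>, the sum of \<open>H\<close> and
  \<open>Rx\<close> is covered by the cosets of \<open>H\<close> at 0, \<open>x\<close> and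
  \<open>x + x\<close>.\<close>

lemma finite_submodule_extend:
  assumes H: "submodule H R M" "finite H" and x: "x \<in> carrier M"
    and I: "\<And>r. r \<in> I \<Longrightarrow> r \<odot>\<^bsub>M\<^esub> x \<in> H"
  shows "\<exists>H'. submodule H' R M \<and> finite H' \<and> x \<in> H'"
proof -
  let ?C = "(\<lambda>r. r \<odot>\<^bsub>M\<^esub> x) ` carrier R"
  let ?H' = "{n \<oplus>\<^bsub>M\<^esub> h | n h. n \<in> H \<and> h \<in> ?C}"
  note E = submoduleE[OF H(1)]
  have "?H' \<subseteq> (\<lambda>(n, k). n \<oplus>\<^bsub>M\<^esub> k \<odot>\<^bsub>M\<^esub> x) ` (H \<times> {\<zero>, \<one>, \<one> \<oplus> \<one>})"
  proof
    fix y assume "y \<in> ?H'"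
    then obtain n r where y: "n \<in> H" "r \<in> carrier R" "y = n \<oplus>\<^bsub>M\<^esub> r \<odot>\<^bsub>M\<^esub> x" by blast
    have "\<exists>k\<in>{\<zero>, \<one>, \<one> \<oplus> \<one>}. \<Phi> k = \<Phi> r"
      by (cases rule: Phi_cases[OF y(2)]) (auto simp: Phi_zero Phi_one Phi_add)
    then obtain k where k: "k \<in> {\<zero>, \<one>, \<one> \<oplus> \<one>}" "\<Phi> k = \<Phi> r" by blast
    then have kR: "k \<in> carrier R" by auto
    have "r \<ominus> k \<in> I" using diff_in_I[OF y(2) kR] k by simp
    then have "n \<oplus>\<^bsub>M\<^esub> (r \<ominus> k) \<odot>\<^bsub>M\<^esub> x \<in> H" using I y E(5) by blast
    moreover have "y = (n \<oplus>\<^bsub>M\<^esub> (r \<ominus> k) \<odot>\<^bsub>M\<^esub> x) \<oplus>\<^bsub>M\<^esub> k \<odot>\<^bsub>M\<^esub> x"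
    proof -
      have "(r \<ominus> k) \<oplus> k = r" using y kR by algebra
      then have "r \<odot>\<^bsub>M\<^esub> x = (r \<ominus> k) \<odot>\<^bsub>M\<^esub> x \<oplus>\<^bsub>M\<^esub> k \<odot>\<^bsub>M\<^esub> x"
        using smult_l_distr[of "r \<ominus> k" k x] y kR x by simp
      then show ?thesis using y kR x E(1) by (simp add: M.a_assoc subset_iff)
    qed
    ultimately show "y \<in> (\<lambda>(n, k). n \<oplus>\<^bsub>M\<^esub> k \<odot>\<^bsub>M\<^esub> x) ` (H \<times> {\<zero>, \<one>, \<one> \<oplus> \<one>})"
      using k(1) by (intro image_eqI[of _ _ "(n \<oplus>\<^bsub>M\<^esub> (r \<ominus> k) \<odot>\<^bsub>M\<^esub> x, k)"]) auto
  qed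
  then have "finite ?H'" using H(2) finite_subset by fastforce
  moreover have "x \<in> ?H'"
    using submodule_sum_contains(2)[OF H(1) submodule_cyclic[OF x]] cyclic_self[OF x] by blast
  ultimately show ?thesis using submodule_sum[OF H(1) submodule_cyclic[OF x]] by blast
qed

lemma finite_submodule_finite_set:
  assumes "finite A" and "\<And>x. x \<in> A \<Longrightarrow> \<exists>H. submodule H R M \<and> finite H \<and> x \<in> H"
  shows "\<exists>H. submodule H R M \<and> finite H \<and> A \<subseteq> H"
  using assms
proof (induction A)
  case empty
  show ?case using submodule_trivial by blast
next
  case (insert x A)
  obtain H where H: "submodule H R M" "finite H" "A \<subseteq> H" using insert by blast
  obtain H' where H': "submodule H' R M" "finite H'" "x \<in> H'" using insert by blast
  let ?S = "{n \<oplus>\<^bsub>M\<^esub> h | n h. n \<in> H \<and> h \<in> H'}"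
  have "?S = (\<lambda>(n, h). n \<oplus>\<^bsub>M\<^esub> h) ` (H \<times> H')" by auto
  then have "finite ?S" using H H' by simp
  then show ?case
    using submodule_sum[OF H(1) H'(1)] submodule_sum_contains[OF H(1) H'(1)] H H' by blast
qed

text \<open>This set is the preimage of \<open>K\<close> of the quotient by \<open>U\<close>;
  closure under scalars uses that \<open>r\<close> and \<open>a\<close> commute.\<close>

lemma submodule_K_step:
  assumes U: "submodule U R M"
  shows "submodule {x \<in> carrier M. \<forall>r\<in>I. r \<odot>\<^bsub>M\<^esub> x \<in> U} R M" (is "submodule ?U' R M")
proof (rule submoduleI)
  note E = submoduleE[OF U]
  fix a assume a: "a \<in> ?U'"
  then have "r \<odot>\<^bsub>M\<^esub> (\<ominus>\<^bsub>M\<^esub> a) \<in> U" if "r \<in> I" for r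
    using E(3) that I_subset by (auto simp: smult_r_minus subset_iff)
  then show "\<ominus>\<^bsub>M\<^esub> a \<in> ?U'" using a by auto
  fix b assume b: "b \<in> ?U'"
  then have "r \<odot>\<^bsub>M\<^esub> (a \<oplus>\<^bsub>M\<^esub> b) \<in> U" if "r \<in> I" for r
    using a E(5) that I_subset by (auto simp: smult_r_distr subset_iff)
  then show "a \<oplus>\<^bsub>M\<^esub> b \<in> ?U'" using a b by auto
next
  note E = submoduleE[OF U]
  fix a y assume a: "a \<in> carrier R" and y: "y \<in> ?U'"
  have "r \<odot>\<^bsub>M\<^esub> (a \<odot>\<^bsub>M\<^esub> y) \<in> U" if r: "r \<in> I" for r
  proof -
    have "r \<odot>\<^bsub>M\<^esub> (a \<odot>\<^bsub>M\<^esub> y) = a \<odot>\<^bsub>M\<^esub> (r \<odot>\<^bsub>M\<^esub> y)"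
      using a y r I_subset by (simp add: smult_assoc1[symmetric] R.m_comm subset_iff)
    then show ?thesis using E a y r by auto
  qed
  then show "a \<odot>\<^bsub>M\<^esub> y \<in> ?U'" using a y by auto
qed (use I_subset submodule_zero_mem[OF U] in \<open>auto simp: subset_iff\<close>)

lemma K_sequence_submodule: "N \<in> K_sequence R \<Phi> M \<Longrightarrow> submodule N R M"
proof (induction rule: K_sequence.induct)
  case zero
  show ?case by (rule submodule_trivial)
next
  case (succ N)
  show ?case
    unfolding Union_K_quotient_module[OF module_axioms succ(2) I_subset]
    by (rule submodule_K_step[OF succ(2)])
next
  case (limit C)
  then show ?case by (intro submodule_Union) (auto simp: chain_subset_def)
qed

end

text \<open>An elementwise form of being cocyclic with socle annihilated by \<open>I\<close>:
  \<open>s\<close> is a multiple of every non-zero element, so \<open>Rs\<close> is the least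
  non-zero submodule, and \<open>I_s\<close> makes it a copy of Z_3.\<close>

locale socle_generator = Z3_module R \<Phi> M
  for R :: "('r, 'a) ring_scheme" (structure) and \<Phi> and M :: "('r, 'm) module" (structure) +
  fixes s
  assumes s: "s \<in> carrier M" "s \<noteq> \<zero>\<^bsub>M\<^esub>"
    and I_s: "r \<in> I \<Longrightarrow> r \<odot>\<^bsub>M\<^esub> s = \<zero>\<^bsub>M\<^esub>"
    and s_in_cyclic: "\<lbrakk>x \<in> carrier M; x \<noteq> \<zero>\<^bsub>M\<^esub>\<rbrakk> \<Longrightarrow> \<exists>r\<in>carrier R. r \<odot>\<^bsub>M\<^esub> x = s"
begin

lemma s_in_submodule:
  assumes N: "submodule N R M" "N \<noteq> {\<zero>\<^bsub>M\<^esub>}"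
  shows "s \<in> N"
proof -
  obtain x where x: "x \<in> N" "x \<noteq> \<zero>\<^bsub>M\<^esub>" using N submodule_zero_mem by blast
  then show ?thesis using s_in_cyclic[of x] submoduleE(1,4)[OF N(1)] by blast
qed

text \<open>Every non-zero submodule contains \<open>Rs\<close>, so \<open>Rs\<close> is the only
  simple submodule and hence the whole socle.\<close>

lemma cocyclic: "cocyclic R M"
proof -
  let ?S = "(\<lambda>r. r \<odot>\<^bsub>M\<^esub> s) ` carrier R"
  have sub: "submodule ?S R M" using s(1) by (rule submodule_cyclic)
  have sS: "s \<in> ?S" using s(1) by (rule cyclic_self)
  have min: "?S \<subseteq> N" if "submodule N R M" "N \<noteq> {\<zero>\<^bsub>M\<^esub>}" for N
    using s_in_submodule[OF that] submoduleE(4)[OF that(1)] by blast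
  have simple: "simple_submodule ?S R M"
    unfolding simple_submodule_def using sub sS s min by blast
  have "N = ?S" if "simple_submodule N R M" for N
    using min[of N] that sub sS s unfolding simple_submodule_def by blast
  then have "{N. simple_submodule N R M} = {?S}" using simple by blast
  then have "socle R M = generated_submodule R M ?S" by (simp add: socle_def)
  also have "\<dots> = ?S"
    using generated_submodule_props(2)[OF module_axioms, of ?S] generated_submodule_props(3)[OF module_axioms _ sub] submoduleE(1)[OF sub]
    by blast
  finally have soc: "socle R M = ?S" .
  have "essential_submodule ?S R M"
    unfolding essential_submodule_def using sub sS s s_in_submodule by blast
  then show ?thesis
    unfolding cocyclic_def soc using simple module_axioms by blast
qed

text \<open>A counterexample \<open>x\<close> with maximal annihilator has a counterexample \<open>rx\<close>, \<open>r \<in> I\<close>, with the same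
  annihilator; but \<open>trx = s\<close> for some \<open>t\<close>, and \<open>tr\<close> kills \<open>rx\<close> without killing \<open>x\<close>.\<close>

lemma noetherian_induct:
  assumes noeth: "noetherian_ring R" and zero: "P \<zero>\<^bsub>M\<^esub>"
    and step: "\<And>x. \<lbrakk>x \<in> carrier M; \<And>r. r \<in> I \<Longrightarrow> P (r \<odot>\<^bsub>M\<^esub> x)\<rbrakk> \<Longrightarrow> P x"
    and x0: "x0 \<in> carrier M"
  shows "P x0"
proof (rule ccontr)
  assume "\<not> P x0"
  define ann where "ann x = {r \<in> carrier R. r \<odot>\<^bsub>M\<^esub> x = \<zero>\<^bsub>M\<^esub>}" for x
  let ?B = "{x \<in> carrier M. \<not> P x}"
  have ideal: "ideal (ann x) R" if x: "x \<in> carrier M" for x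
  proof (rule idealI)
    show "ring R" by unfold_locales
    show "subgroup (ann x) (add_monoid R)"
    proof (rule R.add.subgroupI)
      have "\<zero> \<in> ann x" using x by (simp add: ann_def)
      then show "ann x \<noteq> {}" by blast
    qed (use x in \<open>auto simp: ann_def smult_l_minus smult_l_distr\<close>)
    fix a y assume a: "a \<in> ann x" and y: "y \<in> carrier R"
    then show "y \<otimes> a \<in> ann x" using x by (auto simp: ann_def smult_assoc1)
    then show "a \<otimes> y \<in> ann x" using a y by (simp add: ann_def R.m_comm)
  qed
  have "ann ` ?B \<noteq> {}" using \<open>\<not> P x0\<close> x0 by blast
  then have "\<exists>J\<in>ann ` ?B. \<forall>J'\<in>ann ` ?B. J \<subseteq> J' \<longrightarrow> J' = J"
    by (rule noetherian_ring.maximal_ideal_in_family[OF noeth]) (use ideal in auto)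
  then obtain x where x: "x \<in> carrier M" "\<not> P x"
    and max: "\<And>y. \<lbrakk>y \<in> carrier M; \<not> P y; ann x \<subseteq> ann y\<rbrakk> \<Longrightarrow> ann y = ann x"
    by blast
  obtain r where r: "r \<in> I" "\<not> P (r \<odot>\<^bsub>M\<^esub> x)" using step x by blast
  have rR: "r \<in> carrier R" using r I_subset by blast
  have "ann x \<subseteq> ann (r \<odot>\<^bsub>M\<^esub> x)"
  proof
    fix a assume "a \<in> ann x"
    then have a: "a \<in> carrier R" "a \<odot>\<^bsub>M\<^esub> x = \<zero>\<^bsub>M\<^esub>" by (simp_all add: ann_def)
    then have "a \<odot>\<^bsub>M\<^esub> (r \<odot>\<^bsub>M\<^esub> x) = r \<odot>\<^bsub>M\<^esub> (a \<odot>\<^bsub>M\<^esub> x)"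
      using smult_assoc1[of a r x] smult_assoc1[of r a x] x rR by (simp add: R.m_comm)
    then show "a \<in> ann (r \<odot>\<^bsub>M\<^esub> x)" using a rR by (simp add: ann_def)
  qed
  then have ann: "ann (r \<odot>\<^bsub>M\<^esub> x) = ann x" using max[of "r \<odot>\<^bsub>M\<^esub> x"] x r rR by simp
  have "r \<odot>\<^bsub>M\<^esub> x \<noteq> \<zero>\<^bsub>M\<^esub>" using r zero by auto
  then obtain t where t: "t \<in> carrier R" "t \<odot>\<^bsub>M\<^esub> (r \<odot>\<^bsub>M\<^esub> x) = s"
    using s_in_cyclic[of "r \<odot>\<^bsub>M\<^esub> x"] x rR by auto
  have "(t \<otimes> r) \<odot>\<^bsub>M\<^esub> (r \<odot>\<^bsub>M\<^esub> x) = r \<odot>\<^bsub>M\<^esub> s"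
    using t x rR by (simp add: R.m_comm smult_assoc1)
  then have "t \<otimes> r \<in> ann (r \<odot>\<^bsub>M\<^esub> x)" using t rR I_s[OF r(1)] by (simp add: ann_def)
  then have "(t \<otimes> r) \<odot>\<^bsub>M\<^esub> x = \<zero>\<^bsub>M\<^esub>" unfolding ann by (simp add: ann_def)
  then show False using t x rR s by (simp add: smult_assoc1)
qed

text \<open>By induction the finitely many products of \<open>x\<close> with generators of
  \<open>I\<close> lie in a common finite submodule \<open>H\<close>. The scalars taking
  \<open>x\<close> into \<open>H\<close> form an ideal, so \<open>I x\<close> lies in
  \<open>H\<close>, and \<open>H\<close> can be extended by \<open>x\<close>.\<close>

lemma finite_submodule_element:
  assumes noeth: "noetherian_ring R" and x: "x \<in> carrier M"
  shows "\<exists>H. submodule H R M \<and> finite H \<and> x \<in> H"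
  using noeth _ _ x
proof (rule noetherian_induct)
  show "\<exists>H. submodule H R M \<and> finite H \<and> \<zero>\<^bsub>M\<^esub> \<in> H" using submodule_trivial by blast
next
  fix x assume x: "x \<in> carrier M"
    and IH: "\<And>r. r \<in> I \<Longrightarrow> \<exists>H. submodule H R M \<and> finite H \<and> r \<odot>\<^bsub>M\<^esub> x \<in> H"
  obtain A where A: "A \<subseteq> carrier R" "finite A" "I = Idl A"
    using noetherian_ring.finetely_gen[OF noeth ideal_I] by blast
  have "A \<subseteq> I" using R.genideal_self[OF A(1)] A(3) by simp
  then obtain H where H: "submodule H R M" "finite H" "(\<lambda>r. r \<odot>\<^bsub>M\<^esub> x) ` A \<subseteq> H"
    using finite_submodule_finite_set[of "(\<lambda>r. r \<odot>\<^bsub>M\<^esub> x) ` A"] IH A(2) by blast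
  note E = submoduleE[OF H(1)]
  let ?J = "{r \<in> carrier R. r \<odot>\<^bsub>M\<^esub> x \<in> H}"
  have "ideal ?J R"
  proof (rule idealI)
    show "ring R" by unfold_locales
    show "subgroup ?J (add_monoid R)"
    proof (rule R.add.subgroupI)
      have "\<zero> \<in> ?J" using x submodule_zero_mem[OF H(1)] by simp
      then show "?J \<noteq> {}" by blast
    qed (use x E in \<open>auto simp: smult_l_minus smult_l_distr\<close>)
    fix a y assume a: "a \<in> ?J" and y: "y \<in> carrier R"
    then show "y \<otimes> a \<in> ?J" using x E by (auto simp: smult_assoc1)
    then show "a \<otimes> y \<in> ?J" using a y by (simp add: R.m_comm)
  qed
  moreover have "A \<subseteq> ?J" using A H by auto
  ultimately have "I \<subseteq> ?J" unfolding A(3) by (rule R.genideal_minimal)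
  then show "\<exists>H. submodule H R M \<and> finite H \<and> x \<in> H"
    using finite_submodule_extend[OF H(1,2) x] by blast
qed

text \<open>Finiteness gives a maximal member \<open>U\<close> of the sequence, which must equal its
  successor. Then \<open>I x\<close> in \<open>U\<close> forces \<open>x\<close> in
  \<open>U\<close>, and the induction along \<open>I x\<close> reaches every element.\<close>

lemma K_hat_torsion:
  assumes noeth: "noetherian_ring R" and fin: "finite (carrier M)"
  shows "K_hat_torsion R \<Phi> M"
proof -
  let ?F = "K_sequence R \<Phi> M"
  note K_sub = submoduleE(1)[OF K_sequence_submodule]
  have "?F \<subseteq> Pow (carrier M)" using K_sub by blast
  then have "finite ?F" using fin by (simp add: finite_subset)
  then obtain U where U: "U \<in> ?F" and max: "\<forall>N\<in>?F. U \<subseteq> N \<longrightarrow> U = N"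
    using finite_has_maximal[of ?F] K_sequence.zero by (metis empty_iff)
  have sub: "submodule U R M" using U by (rule K_sequence_submodule)
  let ?U' = "{x \<in> carrier M. \<forall>r\<in>I. r \<odot>\<^bsub>M\<^esub> x \<in> U}"
  have "?U' \<in> ?F"
    using K_sequence.succ[OF U] Union_K_quotient_module[OF module_axioms sub I_subset] by simp
  moreover have "U \<subseteq> ?U'" using submoduleE(1,4)[OF sub] I_subset by auto
  ultimately have U': "U = ?U'" using max by blast
  have "x \<in> U" if x: "x \<in> carrier M" for x
    using noeth _ _ x
  proof (rule noetherian_induct)
    show "\<zero>\<^bsub>M\<^esub> \<in> U" using submodule_zero_mem[OF sub] .
  qed (use U' in blast)
  then show ?thesis
    using U K_sub unfolding K_hat_torsion_def K_hat_def by blast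
qed

end

section \<open>Quotients of the free module of rank three\<close>

definition free3 :: "('r, 'a) ring_scheme \<Rightarrow> ('r, 'r \<times> 'r \<times> 'r) module" where
  "free3 R = \<lparr>carrier = carrier R \<times> carrier R \<times> carrier R,
     monoid.mult = undefined, one = undefined, ring.zero = (\<zero>\<^bsub>R\<^esub>, \<zero>\<^bsub>R\<^esub>, \<zero>\<^bsub>R\<^esub>),
     add = (\<lambda>(a, b, d) (a', b', d'). (a \<oplus>\<^bsub>R\<^esub> a', b \<oplus>\<^bsub>R\<^esub> b', d \<oplus>\<^bsub>R\<^esub> d')),
     smult = (\<lambda>r (a, b, d). (r \<otimes>\<^bsub>R\<^esub> a, r \<otimes>\<^bsub>R\<^esub> b, r \<otimes>\<^bsub>R\<^esub> d))\<rparr>"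

lemma free3_simps:
  "carrier (free3 R) = carrier R \<times> carrier R \<times> carrier R"
  "\<zero>\<^bsub>free3 R\<^esub> = (\<zero>\<^bsub>R\<^esub>, \<zero>\<^bsub>R\<^esub>, \<zero>\<^bsub>R\<^esub>)"
  "(a, b, d) \<oplus>\<^bsub>free3 R\<^esub> (a', b', d') = (a \<oplus>\<^bsub>R\<^esub> a', b \<oplus>\<^bsub>R\<^esub> b', d \<oplus>\<^bsub>R\<^esub> d')"
  "r \<odot>\<^bsub>free3 R\<^esub> (a, b, d) = (r \<otimes>\<^bsub>R\<^esub> a, r \<otimes>\<^bsub>R\<^esub> b, r \<otimes>\<^bsub>R\<^esub> d)"
  by (simp_all add: free3_def)

lemma (in cring) module_free3: "module R (free3 R)"
proof (rule moduleI)
  show "abelian_group (free3 R)"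
  proof (rule abelian_groupI)
    fix x assume "x \<in> carrier (free3 R)"
    then obtain a b d where x: "x = (a, b, d)" "a \<in> carrier R" "b \<in> carrier R" "d \<in> carrier R"
      by (auto simp: free3_simps)
    then have "(\<ominus> a, \<ominus> b, \<ominus> d) \<oplus>\<^bsub>free3 R\<^esub> x = \<zero>\<^bsub>free3 R\<^esub>"
      by (simp add: free3_simps l_neg)
    then show "\<exists>y\<in>carrier (free3 R). y \<oplus>\<^bsub>free3 R\<^esub> x = \<zero>\<^bsub>free3 R\<^esub>"
      using x by (intro bexI[of _ "(\<ominus> a, \<ominus> b, \<ominus> d)"]) (simp_all add: free3_simps)
  qed (auto simp: free3_simps a_ac)
qed (auto simp: free3_simps is_cring l_distr r_distr m_assoc)

lemma (in cring) free3_minus: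
  assumes "a \<in> carrier R" "b \<in> carrier R" "d \<in> carrier R"
  shows "\<ominus>\<^bsub>free3 R\<^esub> (a, b, d) = (\<ominus> a, \<ominus> b, \<ominus> d)"
proof -
  interpret F: module R "free3 R" by (rule module_free3)
  show ?thesis
    by (rule F.M.minus_equality) (use assms in \<open>simp_all add: free3_simps l_neg\<close>)
qed

text \<open>The operations are computed on chosen preimages. When the fibres of \<open>h\<close> are
  cosets of a submodule this is the quotient, carried by an arbitrary type; when \<open>h\<close> is
  injective it is an isomorphic copy.\<close>

definition image_module :: "('r, 'm) module \<Rightarrow> ('m \<Rightarrow> 'x) \<Rightarrow> ('r, 'x) module" where
  "image_module F h = \<lparr>carrier = h ` carrier F,
     monoid.mult = undefined, one = undefined, ring.zero = h \<zero>\<^bsub>F\<^esub>,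
     add = (\<lambda>x y. h (inv_into (carrier F) h x \<oplus>\<^bsub>F\<^esub> inv_into (carrier F) h y)),
     smult = (\<lambda>r x. h (r \<odot>\<^bsub>F\<^esub> inv_into (carrier F) h x))\<rparr>"

lemma image_module_simps:
  "carrier (image_module F h) = h ` carrier F"
  "\<zero>\<^bsub>image_module F h\<^esub> = h \<zero>\<^bsub>F\<^esub>"
  by (simp_all add: image_module_def)

locale module_quotient_map = module R F
  for R :: "('r, 'a) ring_scheme" (structure) and F :: "('r, 'm) module" (structure) +
  fixes N :: "'m set" and h :: "'m \<Rightarrow> 'x"
  assumes N: "submodule N R F"
    and kernel: "\<lbrakk>x \<in> carrier F; y \<in> carrier F\<rbrakk> \<Longrightarrow> h x = h y \<longleftrightarrow> x \<ominus>\<^bsub>F\<^esub> y \<in> N"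
begin

text \<open>The chosen preimages differ from \<open>x\<close> and \<open>y\<close> by elements of
  \<open>N\<close>, and so do the sums.\<close>

lemma image_add:
  assumes x: "x \<in> carrier F" and y: "y \<in> carrier F"
  shows "h x \<oplus>\<^bsub>image_module F h\<^esub> h y = h (x \<oplus>\<^bsub>F\<^esub> y)"
proof -
  define x' y' where x': "x' = inv_into (carrier F) h (h x)" and y': "y' = inv_into (carrier F) h (h y)"
  have c: "x' \<in> carrier F" "y' \<in> carrier F" and "h x' = h x" "h y' = h y"
    using x y by (auto simp: x' y' inv_into_into f_inv_into_f)
  then have "x' \<ominus>\<^bsub>F\<^esub> x \<in> N" "y' \<ominus>\<^bsub>F\<^esub> y \<in> N" using kernel x y by blast+
  then have "(x' \<ominus>\<^bsub>F\<^esub> x) \<oplus>\<^bsub>F\<^esub> (y' \<ominus>\<^bsub>F\<^esub> y) \<in> N" by (rule submoduleE(5)[OF N])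
  moreover have "(x' \<ominus>\<^bsub>F\<^esub> x) \<oplus>\<^bsub>F\<^esub> (y' \<ominus>\<^bsub>F\<^esub> y) = (x' \<oplus>\<^bsub>F\<^esub> y') \<ominus>\<^bsub>F\<^esub> (x \<oplus>\<^bsub>F\<^esub> y)"
    using c x y by (simp add: M.minus_eq M.minus_add M.a_ac)
  ultimately have "h (x' \<oplus>\<^bsub>F\<^esub> y') = h (x \<oplus>\<^bsub>F\<^esub> y)" using kernel c x y by simp
  then show ?thesis by (simp add: image_module_def x' y')
qed

lemma image_smult:
  assumes r: "r \<in> carrier R" and x: "x \<in> carrier F"
  shows "r \<odot>\<^bsub>image_module F h\<^esub> h x = h (r \<odot>\<^bsub>F\<^esub> x)"
proof -
  define x' where x': "x' = inv_into (carrier F) h (h x)"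
  have c: "x' \<in> carrier F" and "h x' = h x"
    using x by (auto simp: x' inv_into_into f_inv_into_f)
  then have "x' \<ominus>\<^bsub>F\<^esub> x \<in> N" using kernel x by blast
  then have "r \<odot>\<^bsub>F\<^esub> (x' \<ominus>\<^bsub>F\<^esub> x) \<in> N" by (rule submoduleE(4)[OF N r])
  moreover have "r \<odot>\<^bsub>F\<^esub> (x' \<ominus>\<^bsub>F\<^esub> x) = r \<odot>\<^bsub>F\<^esub> x' \<ominus>\<^bsub>F\<^esub> r \<odot>\<^bsub>F\<^esub> x"
    using c x r by (simp add: M.minus_eq smult_r_distr smult_r_minus)
  ultimately have "h (r \<odot>\<^bsub>F\<^esub> x') = h (r \<odot>\<^bsub>F\<^esub> x)" using kernel c x r by simp
  then show ?thesis by (simp add: image_module_def x')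
qed

lemma module_image: "module R (image_module F h)"
proof (rule moduleI)
  show "abelian_group (image_module F h)"
  proof (rule abelian_groupI)
    fix x assume "x \<in> carrier (image_module F h)"
    then obtain x' where x: "x' \<in> carrier F" "x = h x'" by (auto simp: image_module_simps)
    then show "\<exists>y\<in>carrier (image_module F h). y \<oplus>\<^bsub>image_module F h\<^esub> x = \<zero>\<^bsub>image_module F h\<^esub>"
      by (intro bexI[of _ "h (\<ominus>\<^bsub>F\<^esub> x')"]) (simp_all add: image_module_simps image_add M.l_neg)
  qed (auto simp: image_module_simps image_add M.a_ac)
qed (auto simp: image_module_simps image_add image_smult smult_l_distr smult_r_distr smult_assoc1
      R.is_cring)

lemma image_zero_iff: "x \<in> carrier F \<Longrightarrow> h x = \<zero>\<^bsub>image_module F h\<^esub> \<longleftrightarrow> x \<in> N"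
proof -
  assume x: "x \<in> carrier F"
  have "\<ominus>\<^bsub>F\<^esub> \<zero>\<^bsub>F\<^esub> = \<zero>\<^bsub>F\<^esub>" by (rule M.minus_equality) simp_all
  then have "x \<ominus>\<^bsub>F\<^esub> \<zero>\<^bsub>F\<^esub> = x" using x unfolding a_minus_def by (metis M.r_zero)
  then show ?thesis unfolding image_module_simps kernel[OF x M.zero_closed] by (rule arg_cong)
qed

end

text \<open>This moves a finite module into a prescribed infinite carrier type.\<close>

lemma finite_inj_into_infinite:
  assumes "finite A" and "infinite (UNIV :: 'b set)"
  obtains j :: "'a \<Rightarrow> 'b" where "inj_on j A"
proof -
  obtain B :: "'b set" where "finite B" "card B = card A"
    using infinite_arbitrarily_large[OF assms(2)] by blast
  then obtain j where "bij_betw j A B" using finite_same_card_bij[OF assms(1)] by metis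
  then show thesis using that bij_betw_imp_inj_on by blast
qed

section \<open>Cocyclic quotients of R^3\<close>

context cring_onto_Z3
begin

text \<open>The last assumption places \<open>p\<close> in \<open>N + Rx\<close> for each
  \<open>x\<close> outside \<open>N\<close>; in the quotient the image of \<open>p\<close> becomes a
  multiple of every non-zero element.\<close>

lemma free3_essential_quotient:
  fixes h :: "'r \<times> 'r \<times> 'r \<Rightarrow> 'x"
  assumes map: "module_quotient_map R (free3 R) N h"
    and p: "p \<in> carrier (free3 R)" "p \<notin> N" "\<And>i. i \<in> I \<Longrightarrow> i \<odot>\<^bsub>free3 R\<^esub> p \<in> N"
    and ess: "\<And>x. \<lbrakk>x \<in> carrier (free3 R); x \<notin> N\<rbrakk> \<Longrightarrow>
      \<exists>r\<in>carrier R. \<exists>n\<in>N. p = n \<oplus>\<^bsub>free3 R\<^esub> r \<odot>\<^bsub>free3 R\<^esub> x"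
  shows "socle_generator R \<Phi> (image_module (free3 R) h) (h p)"
proof -
  interpret F: module_quotient_map R "free3 R" N h by (rule map)
  interpret M: module R "image_module (free3 R) h" by (rule F.module_image)
  show ?thesis
  proof unfold_locales
    show "h p \<in> carrier (image_module (free3 R) h)" using p by (simp add: image_module_simps)
    show "h p \<noteq> \<zero>\<^bsub>image_module (free3 R) h\<^esub>" using p F.image_zero_iff by blast
    show "r \<odot>\<^bsub>image_module (free3 R) h\<^esub> h p = \<zero>\<^bsub>image_module (free3 R) h\<^esub>" if "r \<in> I" for r
    proof -
      have "r \<in> carrier R" using that I_subset by blast
      then show ?thesis using p(3)[OF that] p(1) by (simp add: F.image_smult F.image_zero_iff)
    qed
    fix y assume y: "y \<in> carrier (image_module (free3 R) h)" "y \<noteq> \<zero>\<^bsub>image_module (free3 R) h\<^esub>"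
    then obtain x where x: "x \<in> carrier (free3 R)" "y = h x" by (auto simp: image_module_simps)
    then have "x \<notin> N" using y F.image_zero_iff by blast
    then obtain r n where r: "r \<in> carrier R" "n \<in> N" "p = n \<oplus>\<^bsub>free3 R\<^esub> r \<odot>\<^bsub>free3 R\<^esub> x"
      using ess x by blast
    have n: "n \<in> carrier (free3 R)" using r F.submoduleE(1)[OF F.N] by blast
    have "h p = h n \<oplus>\<^bsub>image_module (free3 R) h\<^esub> r \<odot>\<^bsub>image_module (free3 R) h\<^esub> h x"
      using r x n by (simp add: F.image_add F.image_smult)
    moreover have "h n = \<zero>\<^bsub>image_module (free3 R) h\<^esub>" using F.image_zero_iff n r by blast
    ultimately show "\<exists>r\<in>carrier R. r \<odot>\<^bsub>image_module (free3 R) h\<^esub> y = h p"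
      using r x y M.smult_closed by (intro bexI[of _ r]) simp_all
  qed
qed

text \<open>The images of the three unit vectors lie in one finite submodule, and they generate the
  quotient.\<close>

lemma free3_quotient_finite:
  fixes h :: "'r \<times> 'r \<times> 'r \<Rightarrow> 'x"
  assumes map: "module_quotient_map R (free3 R) N h"
    and soc: "socle_generator R \<Phi> (image_module (free3 R) h) s"
    and noeth: "noetherian_ring R"
  shows "finite (h ` carrier (free3 R))"
proof -
  let ?M = "image_module (free3 R) h" and ?F = "free3 R"
  interpret F: module_quotient_map R "free3 R" N h by (rule map)
  interpret M: socle_generator R \<Phi> ?M s by (rule soc)
  define e1 e2 e3 where e: "e1 = (\<one>, \<zero>, \<zero>)" "e2 = (\<zero>, \<one>, \<zero>)" "e3 = (\<zero>, \<zero>, \<one>)"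
  have eF: "e1 \<in> carrier ?F" "e2 \<in> carrier ?F" "e3 \<in> carrier ?F" by (auto simp: e free3_simps)
  obtain H where H: "submodule H R ?M" "finite H" "{h e1, h e2, h e3} \<subseteq> H"
    using M.finite_submodule_finite_set[of "{h e1, h e2, h e3}"]
      M.finite_submodule_element[OF noeth] eF by (auto simp: image_module_simps)
  note E = M.submoduleE[OF H(1)]
  have "h x \<in> H" if x: "x \<in> carrier ?F" for x
  proof -
    obtain a b d where abd: "x = (a, b, d)" "a \<in> carrier R" "b \<in> carrier R" "d \<in> carrier R"
      using x by (auto simp: free3_simps)
    then have "x = (a \<odot>\<^bsub>?F\<^esub> e1 \<oplus>\<^bsub>?F\<^esub> b \<odot>\<^bsub>?F\<^esub> e2) \<oplus>\<^bsub>?F\<^esub> d \<odot>\<^bsub>?F\<^esub> e3"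
      by (simp add: e free3_simps)
    then have "h x = (a \<odot>\<^bsub>?M\<^esub> h e1 \<oplus>\<^bsub>?M\<^esub> b \<odot>\<^bsub>?M\<^esub> h e2) \<oplus>\<^bsub>?M\<^esub> d \<odot>\<^bsub>?M\<^esub> h e3"
      using abd eF by (simp add: F.image_add F.image_smult)
    then show ?thesis using E(4,5) abd H(3) by simp
  qed
  then have "h ` carrier ?F \<subseteq> H" by blast
  then show ?thesis using H(2) by (rule finite_subset)
qed

text \<open>Since \<open>N\<close> lies in \<open>I \<times> I \<times> I\<close>, the quotient maps
  onto the 27 elements of Z_3^3, whereas two generators produce at most 9 residue triples.\<close>

lemma free3_quotient_gen:
  fixes h :: "'r \<times> 'r \<times> 'r \<Rightarrow> 'x"
  assumes map: "module_quotient_map R (free3 R) N h" and NI: "N \<subseteq> I \<times> I \<times> I"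
    and fin: "finite (h ` carrier (free3 R))"
  shows "gen R (image_module (free3 R) h) \<ge> 3"
proof (rule ccontr)
  let ?M = "image_module (free3 R) h" and ?F = "free3 R"
  interpret F: module_quotient_map R "free3 R" N h by (rule map)
  interpret M: module R ?M by (rule F.module_image)
  assume less: "\<not> gen R ?M \<ge> 3"
  let ?P = "\<lambda>n. \<exists>A. A \<subseteq> carrier ?M \<and> finite A \<and> card A = n \<and> generated_submodule R ?M A = carrier ?M"
  \<comment> \<open>The whole finite carrier is a generating set, so the minimum defining
    \<open>gen\<close> is attained.\<close>
  have "generated_submodule R ?M (carrier ?M) = carrier ?M"
    using generated_submodule_props(1,2)[OF M.module_axioms, of "carrier ?M"] M.submoduleE(1) by blast
  then have "?P (card (carrier ?M))" using fin by (auto simp: image_module_simps)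
  then have "?P (gen R ?M)" unfolding gen_def by (rule LeastI)
  then obtain A where A: "A \<subseteq> carrier ?M" "finite A" "card A \<le> 2" "generated_submodule R ?M A = carrier ?M"
    using less by auto
  \<comment> \<open>A set of at most two generators is padded to a pair whose members may
    coincide.\<close>
  have "\<exists>x\<in>carrier ?M. \<exists>y\<in>carrier ?M. A \<subseteq> {x, y}"
  proof -
    consider "card A = 0" | "card A = 1" | "card A = 2" using A(3) by linarith
    then show ?thesis
    proof cases
      case 1
      then show ?thesis using A(2) M.M.zero_closed by auto
    next
      case 2
      then show ?thesis using A(1) by (metis card_1_singletonE insert_subset insertI1 insertI2 subset_insertI)
    next
      case 3
      then show ?thesis using A(1) by (auto simp: card_2_iff)
    qed
  qed
  then obtain x y where xy: "x \<in> carrier ?F" "y \<in> carrier ?F" "A \<subseteq> {h x, h y}"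
    by (auto simp: image_module_simps)
  have hxy: "h x \<in> carrier ?M" "h y \<in> carrier ?M" using xy by (auto simp: image_module_simps)
  let ?X = "(\<lambda>r. r \<odot>\<^bsub>?M\<^esub> h x) ` carrier R" and ?Y = "(\<lambda>r. r \<odot>\<^bsub>?M\<^esub> h y) ` carrier R"
  let ?S = "{n \<oplus>\<^bsub>?M\<^esub> m | n m. n \<in> ?X \<and> m \<in> ?Y}"
  note XY = M.submodule_cyclic[OF hxy(1)] M.submodule_cyclic[OF hxy(2)]
  have "h x \<in> ?S" "h y \<in> ?S"
    using subsetD[OF M.submodule_sum_contains(1)[OF XY] M.cyclic_self[OF hxy(1)]]
      subsetD[OF M.submodule_sum_contains(2)[OF XY] M.cyclic_self[OF hxy(2)]] by simp_all
  then have "A \<subseteq> ?S" using xy(3) by (meson insert_subset subset_trans empty_subsetI)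
  then have S: "carrier ?M \<subseteq> ?S"
    using generated_submodule_props(3)[OF M.module_axioms A(1) M.submodule_sum[OF XY]] A(4) by simp
  obtain x1 x2 x3 y1 y2 y3 where x: "x = (x1, x2, x3)" "x1 \<in> carrier R" "x2 \<in> carrier R" "x3 \<in> carrier R"
    and y: "y = (y1, y2, y3)" "y1 \<in> carrier R" "y2 \<in> carrier R" "y3 \<in> carrier R"
    using xy by (auto simp: free3_simps)
  \<comment> \<open>\<open>g\<close> sends the residues of two coefficients to the residue triple of
    the combination of \<open>x\<close> and \<open>y\<close> with these coefficients.\<close>
  define g where "g = (\<lambda>(k, l). ((k * \<Phi> x1 + l * \<Phi> y1) mod 3, (k * \<Phi> x2 + l * \<Phi> y2) mod 3,
    (k * \<Phi> x3 + l * \<Phi> y3) mod 3))"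
  have "{0..2} \<times> {0..2} \<times> {0..2} \<subseteq> g ` ({0..2} \<times> {0..2})"
  proof
    fix t :: "int \<times> int \<times> int" assume "t \<in> {0..2} \<times> {0..2} \<times> {0..2}"
    then obtain t1 t2 t3 where t: "t = (t1, t2, t3)" "t1 mod 3 = t1" "t2 mod 3 = t2" "t3 mod 3 = t3"
      by (auto simp: mod_pos_pos_trivial)
    obtain z1 z2 z3 where z: "z1 \<in> carrier R" "\<Phi> z1 = t1" "z2 \<in> carrier R" "\<Phi> z2 = t2"
      "z3 \<in> carrier R" "\<Phi> z3 = t3"
      using Phi_onto[of t1] Phi_onto[of t2] Phi_onto[of t3] t by metis
    have zF: "(z1, z2, z3) \<in> carrier ?F" using z by (simp add: free3_simps)
    then have "h (z1, z2, z3) \<in> ?S" using S by (auto simp: image_module_simps)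
    then obtain a b where ab: "a \<in> carrier R" "b \<in> carrier R"
      "h (z1, z2, z3) = a \<odot>\<^bsub>?M\<^esub> h x \<oplus>\<^bsub>?M\<^esub> b \<odot>\<^bsub>?M\<^esub> h y" by blast
    let ?c = "a \<odot>\<^bsub>?F\<^esub> x \<oplus>\<^bsub>?F\<^esub> b \<odot>\<^bsub>?F\<^esub> y"
    have cF: "?c \<in> carrier ?F" using ab xy by simp
    have "h (z1, z2, z3) = h ?c" using ab xy by (simp add: F.image_add F.image_smult)
    then have "(z1, z2, z3) \<ominus>\<^bsub>?F\<^esub> ?c \<in> I \<times> I \<times> I" using F.kernel[OF zF cF] NI by blast
    moreover have "(z1, z2, z3) \<ominus>\<^bsub>?F\<^esub> ?c = (z1 \<ominus> (a \<otimes> x1 \<oplus> b \<otimes> y1), z2 \<ominus> (a \<otimes> x2 \<oplus> b \<otimes> y2),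
      z3 \<ominus> (a \<otimes> x3 \<oplus> b \<otimes> y3))"
      using x y z ab by (simp add: a_minus_def free3_simps free3_minus)
    ultimately have "\<Phi> z1 = \<Phi> (a \<otimes> x1 \<oplus> b \<otimes> y1)" "\<Phi> z2 = \<Phi> (a \<otimes> x2 \<oplus> b \<otimes> y2)"
      "\<Phi> z3 = \<Phi> (a \<otimes> x3 \<oplus> b \<otimes> y3)"
      using x y z ab by (simp_all add: diff_in_I)
    then have "t = g (\<Phi> a, \<Phi> b)"
      using x y z ab t by (simp add: g_def Phi_add Phi_mult mod_simps)
    moreover have "(\<Phi> a, \<Phi> b) \<in> {0..2} \<times> {0..2}" using Phi_range ab by simp
    ultimately show "t \<in> g ` ({0..2} \<times> {0..2})" by blast
  qed
  then have "card ({0..2} \<times> {0..2} \<times> {0..2} :: (int \<times> int \<times> int) set) \<le> card (g ` ({0..2} \<times> {0..2}))"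
    by (intro card_mono) auto
  also have "\<dots> \<le> card ({0..2} \<times> {0..2} :: (int \<times> int) set)" by (intro card_image_le) auto
  finally show False by (simp add: card_cartesian_product)
qed

text \<open>The quotient is formed twice: first with genuine cosets as elements, where it is shown
  to be finite, and then with the cosets injected into the type \<open>'m\<close>.\<close>

lemma exists_cocyclic_module:
  assumes noeth: "noetherian_ring R" and inf: "infinite (UNIV :: 'm set)"
    and N: "submodule N R (free3 R)" "N \<subseteq> I \<times> I \<times> I"
    and p: "p \<in> carrier (free3 R)" "p \<notin> N" "\<And>i. i \<in> I \<Longrightarrow> i \<odot>\<^bsub>free3 R\<^esub> p \<in> N"
    and ess: "\<And>x. \<lbrakk>x \<in> carrier (free3 R); x \<notin> N\<rbrakk> \<Longrightarrow>
      \<exists>r\<in>carrier R. \<exists>n\<in>N. p = n \<oplus>\<^bsub>free3 R\<^esub> r \<odot>\<^bsub>free3 R\<^esub> x"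
  shows "\<exists>M :: ('r, 'm) module.
    module R M \<and> finite (carrier M) \<and> cocyclic R M \<and> K_hat_torsion R \<Phi> M \<and> gen R M \<ge> 3"
proof -
  let ?F = "free3 R"
  interpret F: module R ?F by (rule module_free3)
  define h0 where "h0 x = {y \<in> carrier ?F. x \<ominus>\<^bsub>?F\<^esub> y \<in> N}" for x
  note E = F.submoduleE[OF N(1)]
  have h0: "h0 x = h0 y \<longleftrightarrow> x \<ominus>\<^bsub>?F\<^esub> y \<in> N" if xy: "x \<in> carrier ?F" "y \<in> carrier ?F" for x y
  proof
    assume "h0 x = h0 y"
    moreover have "y \<in> h0 y" using xy F.submodule_zero_mem[OF N(1)] by (simp add: h0_def F.M.r_neg a_minus_def)
    ultimately show "x \<ominus>\<^bsub>?F\<^esub> y \<in> N" by (auto simp: h0_def)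
  next
    assume d: "x \<ominus>\<^bsub>?F\<^esub> y \<in> N"
    have "x \<ominus>\<^bsub>?F\<^esub> z \<in> N \<longleftrightarrow> y \<ominus>\<^bsub>?F\<^esub> z \<in> N" if z: "z \<in> carrier ?F" for z
    proof
      assume "y \<ominus>\<^bsub>?F\<^esub> z \<in> N"
      then have "(x \<ominus>\<^bsub>?F\<^esub> y) \<oplus>\<^bsub>?F\<^esub> (y \<ominus>\<^bsub>?F\<^esub> z) \<in> N" using d E(5) by blast
      moreover have "(x \<ominus>\<^bsub>?F\<^esub> y) \<oplus>\<^bsub>?F\<^esub> (y \<ominus>\<^bsub>?F\<^esub> z) = x \<ominus>\<^bsub>?F\<^esub> z"
        using xy z by (simp add: a_minus_def F.M.a_assoc F.M.r_neg1)
      ultimately show "x \<ominus>\<^bsub>?F\<^esub> z \<in> N" by simp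
    next
      assume "x \<ominus>\<^bsub>?F\<^esub> z \<in> N"
      then have "\<ominus>\<^bsub>?F\<^esub> (x \<ominus>\<^bsub>?F\<^esub> y) \<oplus>\<^bsub>?F\<^esub> (x \<ominus>\<^bsub>?F\<^esub> z) \<in> N" using d E(3,5) by blast
      moreover have "\<ominus>\<^bsub>?F\<^esub> (x \<ominus>\<^bsub>?F\<^esub> y) \<oplus>\<^bsub>?F\<^esub> (x \<ominus>\<^bsub>?F\<^esub> z) = y \<ominus>\<^bsub>?F\<^esub> z"
        using xy z by (simp add: a_minus_def F.M.minus_add F.M.a_ac F.M.r_neg1 F.M.r_neg2)
      ultimately show "y \<ominus>\<^bsub>?F\<^esub> z \<in> N" by simp
    qed
    then show "h0 x = h0 y" by (auto simp: h0_def)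
  qed
  have map0: "module_quotient_map R ?F N h0"
    by (intro module_quotient_map.intro module_quotient_map_axioms.intro F.module_axioms N(1) h0)
  have "finite (h0 ` carrier ?F)"
    by (rule free3_quotient_finite[OF map0 free3_essential_quotient[OF map0 p ess] noeth])
  then obtain j :: "('r \<times> 'r \<times> 'r) set \<Rightarrow> 'm" where j: "inj_on j (h0 ` carrier ?F)"
    using finite_inj_into_infinite inf by blast
  let ?h = "j \<circ> h0"
  have map: "module_quotient_map R ?F N ?h"
  proof (intro module_quotient_map.intro module_quotient_map_axioms.intro F.module_axioms N(1))
    fix x y assume xy: "x \<in> carrier ?F" "y \<in> carrier ?F"
    then show "?h x = ?h y \<longleftrightarrow> x \<ominus>\<^bsub>?F\<^esub> y \<in> N"
      using h0[OF xy] inj_on_eq_iff[OF j, of "h0 x" "h0 y"] by simp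
  qed
  interpret M: socle_generator R \<Phi> "image_module ?F ?h" "?h p"
    by (rule free3_essential_quotient[OF map p ess])
  have fin: "finite (?h ` carrier ?F)" using finite_imageI[OF \<open>finite (h0 ` carrier ?F)\<close>, of j] unfolding image_comp .
  show ?thesis
    using M.module_axioms M.cocyclic M.K_hat_torsion[OF noeth] fin free3_quotient_gen[OF map N(2) fin]
    by (intro exI[of _ "image_module ?F ?h"]) (simp add: image_module_simps)
qed

end

section \<open>An essential submodule of R^3 from a non-zero defect\<close>

context hamiltonian
begin

lemma center_interchange:
  assumes "a \<in> center" "b \<in> center" "c \<in> center" "d \<in> center"
  shows "(a \<boxplus> b) \<boxplus> (c \<boxplus> d) = (a \<boxplus> c) \<boxplus> (b \<boxplus> d)"
proof -
  have *: "z \<boxplus> (x \<boxplus> y) = (z \<boxplus> x) \<boxplus> y" if "z \<in> center" "x \<in> center" "y \<in> center" for x y z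
    using that unfolding center_def by blast
  have "(a \<boxplus> b) \<boxplus> (c \<boxplus> d) = a \<boxplus> ((b \<boxplus> c) \<boxplus> d)"
    using * assms center_add by metis
  also have "\<dots> = a \<boxplus> ((c \<boxplus> b) \<boxplus> d)"
    using Q.commute assms center_closed by metis
  also have "\<dots> = (a \<boxplus> c) \<boxplus> (b \<boxplus> d)"
    using * assms center_add by metis
  finally show ?thesis .
qed

text \<open>All six terms are central because their coefficients lie in \<open>I\<close>, so they
  may be regrouped freely.\<close>

lemma combination_add:
  assumes c: "u \<in> carrier Q" "v \<in> carrier Q" "w \<in> carrier Q"
    and x: "x \<in> I \<times> I \<times> I" and y: "y \<in> I \<times> I \<times> I"
  shows "combination u v w (x \<oplus>\<^bsub>free3 R\<^esub> y) = combination u v w x \<boxplus> combination u v w y"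
proof -
  obtain a b d a' b' d' where x: "x = (a, b, d)" "a \<in> I" "b \<in> I" "d \<in> I"
    and y: "y = (a', b', d')" "a' \<in> I" "b' \<in> I" "d' \<in> I" using x y by auto
  have R: "a \<in> carrier R" "b \<in> carrier R" "d \<in> carrier R" "a' \<in> carrier R" "b' \<in> carrier R" "d' \<in> carrier R"
    using x y I_subset by auto
  note z = I_smult_center center_add
  have "((a \<cdot> u \<boxplus> b \<cdot> v) \<boxplus> d \<cdot> w) \<boxplus> ((a' \<cdot> u \<boxplus> b' \<cdot> v) \<boxplus> d' \<cdot> w)
      = ((a \<cdot> u \<boxplus> b \<cdot> v) \<boxplus> (a' \<cdot> u \<boxplus> b' \<cdot> v)) \<boxplus> (d \<cdot> w \<boxplus> d' \<cdot> w)"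
    by (rule center_interchange) (use x y c z in auto)
  also have "(a \<cdot> u \<boxplus> b \<cdot> v) \<boxplus> (a' \<cdot> u \<boxplus> b' \<cdot> v) = (a \<cdot> u \<boxplus> a' \<cdot> u) \<boxplus> (b \<cdot> v \<boxplus> b' \<cdot> v)"
    by (rule center_interchange) (use x y c z in auto)
  finally show ?thesis
    using c R by (simp add: combination_def x y free3_simps add_smult)
qed

lemma combination_smult:
  assumes c: "u \<in> carrier Q" "v \<in> carrier Q" "w \<in> carrier Q"
    and r: "r \<in> carrier R" and x: "x \<in> carrier (free3 R)"
  shows "combination u v w (r \<odot>\<^bsub>free3 R\<^esub> x) = r \<cdot> combination u v w x"
  using x c r by (auto simp: combination_def free3_simps mult_smult smult_add Q_closed)

text \<open>The relations among \<open>u\<close>, \<open>v\<close>, \<open>w\<close> form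
  \<open>N0\<close>, and \<open>p\<close> evaluates to the defect. Zorn's lemma enlarges
  \<open>N0\<close> to a submodule \<open>N\<close> maximal with respect to avoiding
  \<open>p\<close>, which makes the image of \<open>p\<close> a multiple of every non-zero element
  modulo \<open>N\<close>.\<close>

lemma exists_essential_submodule:
  assumes c: "u \<in> carrier Q" "v \<in> carrier Q" "w \<in> carrier Q"
    and nz: "defect u v w \<noteq> \<zero>\<^bsub>Q\<^esub>"
  shows "\<exists>N p. submodule N R (free3 R) \<and> N \<subseteq> I \<times> I \<times> I \<and> p \<in> carrier (free3 R) \<and> p \<notin> N \<and>
    (\<forall>i\<in>I. i \<odot>\<^bsub>free3 R\<^esub> p \<in> N) \<and>
    (\<forall>x\<in>carrier (free3 R). x \<notin> N \<longrightarrow> (\<exists>r\<in>carrier R. \<exists>n\<in>N. p = n \<oplus>\<^bsub>free3 R\<^esub> r \<odot>\<^bsub>free3 R\<^esub> x))"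
proof -
  let ?F = "free3 R" and ?\<pi> = "combination u v w" and ?III = "I \<times> I \<times> I"
  interpret F: module R ?F by (rule R.module_free3)
  have D: "defect u v w \<in> carrier Q" using c by (rule defect_closed)
  have I0: "\<zero> \<in> I" by (simp add: I_iff Phi_zero)
  have IF: "?III \<subseteq> carrier ?F" using I_subset by (auto simp: free3_simps)
  have outside: "\<exists>r\<in>I. defect u v w = r \<cdot> ?\<pi> x" if "x \<in> carrier ?F" "x \<notin> ?III" for x
    using that defect_in_I_combination[OF c] by (cases x) (auto simp: free3_simps)
  have iter: "r \<odot>\<^bsub>?F\<^esub> x \<in> ?III" if "r \<in> I" "x \<in> carrier ?F" for r x
    using that by (auto simp: free3_simps I_iff Phi_mult)
  \<comment> \<open>The defect is an \<open>I\<close>-multiple of its last argument; cyclic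
    invariance makes this \<open>u\<close>. This supplies a preimage \<open>p\<close> of the defect
    with coordinates in \<open>I\<close>.\<close>
  obtain r0 where r0: "r0 \<in> I" "defect u v w = r0 \<cdot> u"
    using defect_multiple[OF c(2,3,1)] defect_cyclic[OF c] by auto
  define p where "p = (r0, \<zero>, \<zero>)"
  have p: "p \<in> ?III" using r0 I0 by (simp add: p_def)
  have pF: "p \<in> carrier ?F" using p IF by blast
  have \<pi>p: "?\<pi> p = defect u v w"
    using r0 c I_subset by (auto simp: p_def combination_def zero_smult Q.zero_right Q_closed)
  define N0 where "N0 = {x \<in> carrier ?F. ?\<pi> x = \<zero>\<^bsub>Q\<^esub>}"
  have N0I: "N0 \<subseteq> ?III"
  proof
    fix x assume x: "x \<in> N0"
    show "x \<in> ?III"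
    proof (rule ccontr)
      assume "x \<notin> ?III"
      then obtain r where "r \<in> I" "defect u v w = r \<cdot> ?\<pi> x" using outside x unfolding N0_def by blast
      then show False using nz x I_subset smult_zero by (auto simp: N0_def)
    qed
  qed
  have N0: "submodule N0 R ?F"
  proof (rule F.submoduleI)
    show "\<zero>\<^bsub>?F\<^esub> \<in> N0"
      using c by (simp add: N0_def free3_simps combination_def zero_smult Q.zero_left Q_closed)
    fix x assume x: "x \<in> N0"
    show smult: "r \<odot>\<^bsub>?F\<^esub> x \<in> N0" if "r \<in> carrier R" for r
      using x that c by (simp add: N0_def combination_smult smult_zero)
    have "\<ominus>\<^bsub>?F\<^esub> x = (\<ominus> \<one>) \<odot>\<^bsub>?F\<^esub> x" using x by (simp add: N0_def F.smult_l_minus)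
    then show "\<ominus>\<^bsub>?F\<^esub> x \<in> N0" using smult[of "\<ominus> \<one>"] by simp
    fix y assume y: "y \<in> N0"
    \<comment> \<open>Evaluation is additive here only because \<open>N0\<close> was first shown to
      lie in \<open>?III\<close>.\<close>
    have "?\<pi> (x \<oplus>\<^bsub>?F\<^esub> y) = ?\<pi> x \<boxplus> ?\<pi> y" using combination_add[OF c] x y N0I by blast
    then show "x \<oplus>\<^bsub>?F\<^esub> y \<in> N0" using x y by (simp add: N0_def Q.zero_left Q.zero_closed)
  qed (auto simp: N0_def)
  let ?Fam = "{N. submodule N R ?F \<and> N0 \<subseteq> N \<and> p \<notin> N}"
  have "N0 \<in> ?Fam" using N0 \<pi>p nz by (simp add: N0_def)
  then have "?Fam \<noteq> {}" by blast
  then have "\<exists>N\<in>(?Fam). \<forall>L\<in>(?Fam). N \<subseteq> L \<longrightarrow> L = N"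
  proof (rule subset_Zorn_nonempty)
    fix C assume C: "C \<noteq> {}" "subset.chain ?Fam C"
    then have "C \<subseteq> ?Fam" and ch: "\<And>L L'. L \<in> C \<Longrightarrow> L' \<in> C \<Longrightarrow> L \<subseteq> L' \<or> L' \<subseteq> L"
      by (simp_all add: subset_chain_def)
    moreover from this have "submodule (\<Union>C) R ?F"
      by (intro F.submodule_Union[OF C(1)]) auto
    ultimately show "\<Union>C \<in> ?Fam" using C(1) by blast
  qed
  then obtain N where "N \<in> ?Fam" and max': "\<forall>L\<in>(?Fam). N \<subseteq> L \<longrightarrow> L = N" by (rule bexE)
  then have N: "submodule N R ?F" "N0 \<subseteq> N" "p \<notin> N" by simp_all
  have max: "L = N" if "submodule L R ?F" "N0 \<subseteq> L" "p \<notin> L" "N \<subseteq> L" for L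
    using max' that by simp
  note E = F.submoduleE[OF N(1)]
  \<comment> \<open>If \<open>x\<close> in \<open>N\<close> were outside, some multiple
    \<open>r x\<close> with \<open>r\<close> in \<open>I\<close> would have the same value as
    \<open>p\<close>. Then \<open>r x - p\<close> would lie in \<open>N0\<close>, which forces
    \<open>p\<close> into \<open>N\<close>.\<close>
  have "x \<in> ?III" if x: "x \<in> N" for x
  proof (rule ccontr)
    assume "x \<notin> ?III"
    then obtain r where r: "r \<in> I" "defect u v w = r \<cdot> ?\<pi> x" using outside x E(1) by blast
    have xF: "x \<in> carrier ?F" using x E(1) by blast
    have rR: "r \<in> carrier R" using r I_subset by blast
    let ?y = "r \<odot>\<^bsub>?F\<^esub> x" and ?m = "\<ominus>\<^bsub>?F\<^esub> p"
    have y: "?y \<in> ?III" using iter r xF by blast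
    have m: "?m = (\<ominus> \<one>) \<odot>\<^bsub>?F\<^esub> p" using pF by (simp add: F.smult_l_minus)
    have mI: "?m \<in> ?III"
      using p I_subset by (auto simp: p_def R.free3_minus subset_iff I_minus)
    have "?\<pi> (?y \<oplus>\<^bsub>?F\<^esub> ?m) = ?\<pi> ?y \<boxplus> ?\<pi> ?m" using combination_add[OF c y mI] .
    also have "\<dots> = \<zero>\<^bsub>Q\<^esub>"
      using combination_smult[OF c rR xF] combination_smult[OF c, of "\<ominus> \<one>" p] pF r \<pi>p smult_neg[OF D]
      by (simp add: m)
    finally have "?y \<oplus>\<^bsub>?F\<^esub> ?m \<in> N0" using F.M.a_closed[OF subsetD[OF IF y] subsetD[OF IF mI]] by (simp add: N0_def)
    then have "?y \<oplus>\<^bsub>?F\<^esub> \<ominus>\<^bsub>?F\<^esub> (?y \<oplus>\<^bsub>?F\<^esub> ?m) \<in> N" using N(2) E x rR by blast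
    moreover have "?y \<oplus>\<^bsub>?F\<^esub> \<ominus>\<^bsub>?F\<^esub> (?y \<oplus>\<^bsub>?F\<^esub> ?m) = p"
      using xF rR pF by (simp add: F.M.minus_add F.M.a_assoc[symmetric] F.M.r_neg)
    ultimately show False using N(3) by simp
  qed
  then have NI: "N \<subseteq> ?III" by blast
  have ann: "i \<odot>\<^bsub>?F\<^esub> p \<in> N" if i: "i \<in> I" for i
  proof -
    have iR: "i \<in> carrier R" using i I_subset by blast
    have "i \<odot>\<^bsub>?F\<^esub> p \<in> N0"
      using combination_smult[OF c iR pF] I_smult_defect[OF c i] \<pi>p iR pF by (simp add: N0_def)
    then show ?thesis using N(2) by blast
  qed
  \<comment> \<open>Otherwise the sum of \<open>N\<close> and \<open>Rx\<close> would avoid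
    \<open>p\<close> and properly contain \<open>N\<close>.\<close>
  have ess: "\<exists>r\<in>carrier R. \<exists>n\<in>N. p = n \<oplus>\<^bsub>?F\<^esub> r \<odot>\<^bsub>?F\<^esub> x" if x: "x \<in> carrier ?F" "x \<notin> N" for x
  proof (rule ccontr)
    let ?X = "{n \<oplus>\<^bsub>?F\<^esub> h | n h. n \<in> N \<and> h \<in> (\<lambda>r. r \<odot>\<^bsub>?F\<^esub> x) ` carrier R}"
    note C = F.submodule_cyclic[OF x(1)]
    assume "\<not> (\<exists>r\<in>carrier R. \<exists>n\<in>N. p = n \<oplus>\<^bsub>?F\<^esub> r \<odot>\<^bsub>?F\<^esub> x)"
    then have "p \<notin> ?X" by blast
    moreover have "N \<subseteq> ?X" using F.submodule_sum_contains(1)[OF N(1) C] .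
    ultimately have "?X = N"
      using F.submodule_sum[OF N(1) C] N(2) by (intro max) (assumption | rule subset_trans)+
    moreover have "x \<in> ?X" using F.submodule_sum_contains(2)[OF N(1) C] F.cyclic_self[OF x(1)] by (rule subsetD)
    ultimately show False using x(2) by blast
  qed
  show ?thesis using N(1,3) NI pF ann ess by blast
qed

end

section \<open>Twisting a module into a quasimodule\<close>

context Z3_module
begin

text \<open>These are the \<open>R\<close>-linear maps to Z_3, on which \<open>R\<close> acts
  through \<open>\<Phi>\<close>. The second condition at the unit forces the values on the carrier
  to be 0, 1 or 2.\<close>

definition Z3_functional :: "('m \<Rightarrow> int) \<Rightarrow> bool" where
  "Z3_functional f \<longleftrightarrow>
     (\<forall>x\<in>carrier M. \<forall>y\<in>carrier M. f (x \<oplus>\<^bsub>M\<^esub> y) = (f x + f y) mod 3) \<and>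
     (\<forall>r\<in>carrier R. \<forall>x\<in>carrier M. f (r \<odot>\<^bsub>M\<^esub> x) = (\<Phi> r * f x) mod 3)"

lemma functional_add:
  "\<lbrakk>Z3_functional f; x \<in> carrier M; y \<in> carrier M\<rbrakk> \<Longrightarrow> f (x \<oplus>\<^bsub>M\<^esub> y) = (f x + f y) mod 3"
  by (simp add: Z3_functional_def)

lemma functional_smult:
  "\<lbrakk>Z3_functional f; r \<in> carrier R; x \<in> carrier M\<rbrakk> \<Longrightarrow> f (r \<odot>\<^bsub>M\<^esub> x) = (\<Phi> r * f x) mod 3"
  by (simp add: Z3_functional_def)

lemma functional_minus:
  assumes f: "Z3_functional f" and x: "x \<in> carrier M"
  shows "f (\<ominus>\<^bsub>M\<^esub> x) = (- f x) mod 3"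
proof -
  have "\<ominus>\<^bsub>M\<^esub> x = (\<ominus> \<one>) \<odot>\<^bsub>M\<^esub> x" using x by (simp add: smult_l_minus)
  then have "f (\<ominus>\<^bsub>M\<^esub> x) = (((- 1) mod 3) * f x) mod 3"
    using functional_smult[OF f, of "\<ominus> \<one>" x] x by (simp add: Phi_minus Phi_one)
  then show ?thesis using mod_mult_left_eq[of "-1" 3 "f x"] by simp
qed

end

text \<open>The functionals vanish at \<open>s\<close>, so a summand from the socle never changes
  their values; nested twists can then be expanded.\<close>

locale twisted_module = socle_generator R \<Phi> M s
  for R :: "('r, 'a) ring_scheme" (structure) and \<Phi> and M :: "('r, 'm) module" (structure) and s +
  fixes f1 f2 f3 :: "'m \<Rightarrow> int"
  assumes f1: "Z3_functional f1" and f2: "Z3_functional f2" and f3: "Z3_functional f3"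
    and f_s: "f1 s = 0" "f2 s = 0" "f3 s = 0"
begin

text \<open>The integer multiple of \<open>s\<close> given by \<open>t\<close>, through any scalar
  with residue \<open>t\<close>; the choice is immaterial because \<open>I\<close> annihilates
  \<open>s\<close>.\<close>

definition socle_elem :: "int \<Rightarrow> 'm" where
  "socle_elem t = (SOME r. r \<in> carrier R \<and> \<Phi> r = t mod 3) \<odot>\<^bsub>M\<^esub> s"

lemma socle_elem_eq:
  assumes r: "r \<in> carrier R" "\<Phi> r = t mod 3"
  shows "socle_elem t = r \<odot>\<^bsub>M\<^esub> s"
proof -
  define r' where "r' = (SOME r. r \<in> carrier R \<and> \<Phi> r = t mod 3)"
  have "r' \<in> carrier R \<and> \<Phi> r' = t mod 3"
    unfolding r'_def by (rule someI[of _ r]) (use r in simp)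
  then show ?thesis
    using Z3_multiples[OF s(1) I_s, of r' r] r by (simp add: socle_elem_def r'_def[symmetric])
qed

lemma socle_elemE:
  obtains r where "r \<in> carrier R" "\<Phi> r = t mod 3" "socle_elem t = r \<odot>\<^bsub>M\<^esub> s"
  using Phi_onto[of t] socle_elem_eq by metis

lemma socle_elem_closed [simp]: "socle_elem t \<in> carrier M"
  by (rule socle_elemE[of t]) (simp add: s)

lemma socle_elem_add: "socle_elem t \<oplus>\<^bsub>M\<^esub> socle_elem u = socle_elem (t + u)"
proof -
  obtain r where r: "r \<in> carrier R" "\<Phi> r = t mod 3" "socle_elem t = r \<odot>\<^bsub>M\<^esub> s" by (rule socle_elemE)
  obtain q where q: "q \<in> carrier R" "\<Phi> q = u mod 3" "socle_elem u = q \<odot>\<^bsub>M\<^esub> s" by (rule socle_elemE)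
  have "socle_elem (t + u) = (r \<oplus> q) \<odot>\<^bsub>M\<^esub> s"
    by (rule socle_elem_eq) (use r q in \<open>simp_all add: Phi_add mod_simps\<close>)
  then show ?thesis using r q s by (simp add: smult_l_distr)
qed

lemma socle_elem_smult:
  assumes p: "p \<in> carrier R"
  shows "p \<odot>\<^bsub>M\<^esub> socle_elem t = socle_elem (\<Phi> p * t)"
proof -
  obtain r where r: "r \<in> carrier R" "\<Phi> r = t mod 3" "socle_elem t = r \<odot>\<^bsub>M\<^esub> s" by (rule socle_elemE)
  have "socle_elem (\<Phi> p * t) = (p \<otimes> r) \<odot>\<^bsub>M\<^esub> s"
    by (rule socle_elem_eq) (use r p in \<open>simp_all add: Phi_mult mod_simps\<close>)
  then show ?thesis using r p s by (simp add: smult_assoc1)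
qed

lemma socle_elem_cong: "3 dvd t - u \<Longrightarrow> socle_elem t = socle_elem u"
  by (simp add: socle_elem_def mod_eq_dvd_iff[symmetric])

lemma socle_elem_zero: "socle_elem 0 = \<zero>\<^bsub>M\<^esub>"
  using socle_elem_eq[of \<zero> 0] s by (simp add: Phi_zero)

lemma socle_elem_nonzero:
  assumes "\<not> 3 dvd t"
  shows "socle_elem t \<noteq> \<zero>\<^bsub>M\<^esub>"
proof
  assume z: "socle_elem t = \<zero>\<^bsub>M\<^esub>"
  obtain r where r: "r \<in> carrier R" "\<Phi> r = t mod 3" "socle_elem t = r \<odot>\<^bsub>M\<^esub> s" by (rule socle_elemE)
  have "\<Phi> r \<noteq> 0" using r assms by presburger
  then obtain q i where q: "q \<in> carrier R" "i \<in> I" "q \<otimes> r = \<one> \<oplus> i" using inverse_mod_I r(1) by blast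
  have i: "i \<in> carrier R" using q I_subset by blast
  have "r \<odot>\<^bsub>M\<^esub> s = \<zero>\<^bsub>M\<^esub>" using r(3) z by simp
  then have "(q \<otimes> r) \<odot>\<^bsub>M\<^esub> s = \<zero>\<^bsub>M\<^esub>" using q(1) r(1) s(1) by (simp add: smult_assoc1)
  then have "s = \<zero>\<^bsub>M\<^esub>" unfolding q(3) using i s I_s[OF q(2)] by (simp add: smult_l_distr)
  then show False using s by simp
qed

lemma functional_socle_elem:
  assumes f: "Z3_functional f" "f s = 0"
  shows "f (socle_elem t) = 0"
proof -
  obtain r where "r \<in> carrier R" "socle_elem t = r \<odot>\<^bsub>M\<^esub> s" by (rule socle_elemE[of t])
  then show ?thesis using functional_smult[OF f(1) _ s(1)] f(2) by simp
qed

text \<open>The first factor is a 2 by 2 determinant and changes sign when \<open>x\<close> and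
  \<open>y\<close> are exchanged, as does the second, so the product is symmetric. Modulo 3 the
  resulting defect of associativity is minus the determinant of the three functionals.\<close>

definition form :: "'m \<Rightarrow> 'm \<Rightarrow> int" where
  "form x y = (f1 x * f2 y - f2 x * f1 y) * (f3 x - f3 y)"

definition twist :: "'m \<Rightarrow> 'm \<Rightarrow> 'm" (infixl "\<star>" 65) where
  "x \<star> y = (x \<oplus>\<^bsub>M\<^esub> y) \<oplus>\<^bsub>M\<^esub> socle_elem (form x y)"

lemma twist_closed [simp]: "\<lbrakk>x \<in> carrier M; y \<in> carrier M\<rbrakk> \<Longrightarrow> x \<star> y \<in> carrier M"
  by (simp add: twist_def)

lemma functional_twist:
  assumes f: "Z3_functional f" "f s = 0" and c: "x \<in> carrier M" "y \<in> carrier M"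
  shows "f (x \<star> y) = (f x + f y) mod 3"
  using c by (simp add: twist_def functional_add[OF f(1)] functional_socle_elem[OF f])

lemma form_mod:
  assumes "f1 x mod 3 = p1 mod 3" "f2 x mod 3 = p2 mod 3" "f3 x mod 3 = p3 mod 3"
    "f1 y mod 3 = q1 mod 3" "f2 y mod 3 = q2 mod 3" "f3 y mod 3 = q3 mod 3"
  shows "3 dvd form x y - (p1 * q2 - p2 * q1) * (p3 - q3)"
  unfolding mod_eq_dvd_iff[symmetric] form_def
  by (intro mod_mult_cong mod_diff_cong assms)

lemma twist_commute: "\<lbrakk>x \<in> carrier M; y \<in> carrier M\<rbrakk> \<Longrightarrow> x \<star> y = y \<star> x"
  by (simp add: twist_def M.a_comm[of x y] form_def algebra_simps)

text \<open>The outer form may be evaluated at the plain sums modulo 3, since the inner corrections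
  lie in the socle; the three corrections then add up.\<close>

lemma twist_twist:
  assumes c: "x \<in> carrier M" "y \<in> carrier M" "a \<in> carrier M" "b \<in> carrier M"
  shows "(x \<star> y) \<star> (a \<star> b) =
    ((x \<oplus>\<^bsub>M\<^esub> y) \<oplus>\<^bsub>M\<^esub> (a \<oplus>\<^bsub>M\<^esub> b)) \<oplus>\<^bsub>M\<^esub> socle_elem (form x y + form a b +
      ((f1 x + f1 y) * (f2 a + f2 b) - (f2 x + f2 y) * (f1 a + f1 b)) * ((f3 x + f3 y) - (f3 a + f3 b)))"
    (is "_ = _ \<oplus>\<^bsub>M\<^esub> socle_elem (_ + _ + ?e)")
proof -
  have "3 dvd form (x \<star> y) (a \<star> b) - ?e"
    by (rule form_mod) (use c f1 f2 f3 f_s in \<open>simp_all add: functional_twist\<close>)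
  then have e: "socle_elem (form (x \<star> y) (a \<star> b)) = socle_elem ?e" by (rule socle_elem_cong)
  have "(((x \<oplus>\<^bsub>M\<^esub> y) \<oplus>\<^bsub>M\<^esub> p) \<oplus>\<^bsub>M\<^esub> ((a \<oplus>\<^bsub>M\<^esub> b) \<oplus>\<^bsub>M\<^esub> q)) \<oplus>\<^bsub>M\<^esub> r
      = ((x \<oplus>\<^bsub>M\<^esub> y) \<oplus>\<^bsub>M\<^esub> (a \<oplus>\<^bsub>M\<^esub> b)) \<oplus>\<^bsub>M\<^esub> ((p \<oplus>\<^bsub>M\<^esub> q) \<oplus>\<^bsub>M\<^esub> r)"
    if "p \<in> carrier M" "q \<in> carrier M" "r \<in> carrier M" for p q r
    using c that by (simp add: M.a_ac)
  then have "(x \<star> y) \<star> (a \<star> b) = ((x \<oplus>\<^bsub>M\<^esub> y) \<oplus>\<^bsub>M\<^esub> (a \<oplus>\<^bsub>M\<^esub> b)) \<oplus>\<^bsub>M\<^esub>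
      ((socle_elem (form x y) \<oplus>\<^bsub>M\<^esub> socle_elem (form a b)) \<oplus>\<^bsub>M\<^esub> socle_elem (form (x \<star> y) (a \<star> b)))"
    by (simp add: twist_def)
  then show ?thesis unfolding e socle_elem_add .
qed

lemma twist_zero: "x \<in> carrier M \<Longrightarrow> \<zero>\<^bsub>M\<^esub> \<star> x = x"
proof -
  assume x: "x \<in> carrier M"
  have z: "f \<zero>\<^bsub>M\<^esub> = 0" if "Z3_functional f" for f
    using functional_smult[OF that, of \<zero> "\<zero>\<^bsub>M\<^esub>"] by (simp add: Phi_zero)
  show ?thesis using x f1 f2 f3 by (simp add: twist_def form_def z socle_elem_zero)
qed

lemma twist_assoc_left:
  assumes c: "x \<in> carrier M" "y \<in> carrier M" "z \<in> carrier M"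
  shows "(x \<star> y) \<star> z = (x \<oplus>\<^bsub>M\<^esub> (y \<oplus>\<^bsub>M\<^esub> z)) \<oplus>\<^bsub>M\<^esub> socle_elem (form x y +
      ((f1 x + f1 y) * f2 z - (f2 x + f2 y) * f1 z) * ((f3 x + f3 y) - f3 z))"
    (is "_ = _ \<oplus>\<^bsub>M\<^esub> socle_elem (_ + ?e)")
proof -
  have "3 dvd form (x \<star> y) z - ?e"
    by (rule form_mod) (use c f1 f2 f3 f_s in \<open>simp_all add: functional_twist\<close>)
  then have e: "socle_elem (form (x \<star> y) z) = socle_elem ?e" by (rule socle_elem_cong)
  have "(((x \<oplus>\<^bsub>M\<^esub> y) \<oplus>\<^bsub>M\<^esub> p) \<oplus>\<^bsub>M\<^esub> z) \<oplus>\<^bsub>M\<^esub> q = (x \<oplus>\<^bsub>M\<^esub> (y \<oplus>\<^bsub>M\<^esub> z)) \<oplus>\<^bsub>M\<^esub> (p \<oplus>\<^bsub>M\<^esub> q)"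
    if "p \<in> carrier M" "q \<in> carrier M" for p q
    using c that by (simp add: M.a_ac)
  then have "(x \<star> y) \<star> z = (x \<oplus>\<^bsub>M\<^esub> (y \<oplus>\<^bsub>M\<^esub> z)) \<oplus>\<^bsub>M\<^esub> (socle_elem (form x y) \<oplus>\<^bsub>M\<^esub> socle_elem (form (x \<star> y) z))"
    by (simp add: twist_def)
  then show ?thesis unfolding e socle_elem_add .
qed

lemma twist_assoc_right:
  assumes c: "x \<in> carrier M" "y \<in> carrier M" "z \<in> carrier M"
  shows "x \<star> (y \<star> z) = (x \<oplus>\<^bsub>M\<^esub> (y \<oplus>\<^bsub>M\<^esub> z)) \<oplus>\<^bsub>M\<^esub> socle_elem (form y z +
      ((f1 y + f1 z) * f2 x - (f2 y + f2 z) * f1 x) * ((f3 y + f3 z) - f3 x))"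
  using twist_assoc_left[OF c(2,3,1)] twist_commute[of x "y \<star> z"] c by (simp add: M.a_ac)

text \<open>Modulo 3 the form at \<open>- a\<close> and \<open>a \<star> x\<close> is the negative
  of the form at \<open>a\<close> and \<open>x\<close>, so the two corrections cancel.\<close>

lemma twist_inverse:
  assumes c: "a \<in> carrier M" "x \<in> carrier M"
  shows "(\<ominus>\<^bsub>M\<^esub> a) \<star> (a \<star> x) = x"
proof -
  let ?n = "\<ominus>\<^bsub>M\<^esub> a"
  let ?B = "f1 a * f2 x - f2 a * f1 x"
  have n: "?n \<in> carrier M" using c by simp
  have "3 dvd form ?n (a \<star> x) - (- f1 a * (f2 a + f2 x) - - f2 a * (f1 a + f1 x)) * (- f3 a - (f3 a + f3 x))"
    by (rule form_mod) (use c f1 f2 f3 f_s in \<open>simp_all add: functional_twist functional_minus\<close>)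
  moreover have "(- f1 a * (f2 a + f2 x) - - f2 a * (f1 a + f1 x)) * (- f3 a - (f3 a + f3 x))
      = 3 * (f3 a * ?B) - form a x"
    by (simp add: form_def algebra_simps)
  ultimately have "3 dvd form ?n (a \<star> x) - (3 * (f3 a * ?B) - form a x)" by simp
  then have "3 dvd (form ?n (a \<star> x) - (3 * (f3 a * ?B) - form a x)) + 3 * (f3 a * ?B)"
    by (rule dvd_add) simp
  then have "3 dvd (form a x + form ?n (a \<star> x)) - 0" by (simp add: add.commute)
  then have z: "socle_elem (form a x + form ?n (a \<star> x)) = \<zero>\<^bsub>M\<^esub>"
    using socle_elem_cong socle_elem_zero by metis
  have "(?n \<oplus>\<^bsub>M\<^esub> ((a \<oplus>\<^bsub>M\<^esub> x) \<oplus>\<^bsub>M\<^esub> p)) \<oplus>\<^bsub>M\<^esub> q = (?n \<oplus>\<^bsub>M\<^esub> (a \<oplus>\<^bsub>M\<^esub> x)) \<oplus>\<^bsub>M\<^esub> (p \<oplus>\<^bsub>M\<^esub> q)"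
    if "p \<in> carrier M" "q \<in> carrier M" for p q
    using c n that by (simp add: M.a_assoc)
  then have "?n \<star> (a \<star> x) = (?n \<oplus>\<^bsub>M\<^esub> (a \<oplus>\<^bsub>M\<^esub> x)) \<oplus>\<^bsub>M\<^esub> (socle_elem (form a x) \<oplus>\<^bsub>M\<^esub> socle_elem (form ?n (a \<star> x)))"
    by (simp add: twist_def)
  then show ?thesis using c by (simp add: socle_elem_add z M.r_neg1 M.r_neg2)
qed

text \<open>Both sides have the same module part, and their multiples of \<open>s\<close> differ by
  three times an explicit polynomial in the values of the functionals.\<close>

lemma twist_moufang:
  assumes c: "x \<in> carrier M" "a \<in> carrier M" "b \<in> carrier M"
  shows "(x \<star> x) \<star> (a \<star> b) = (x \<star> a) \<star> (x \<star> b)"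
proof -
  let ?l = "form x x + form a b +
      ((f1 x + f1 x) * (f2 a + f2 b) - (f2 x + f2 x) * (f1 a + f1 b)) * ((f3 x + f3 x) - (f3 a + f3 b))"
  let ?r = "form x a + form x b +
      ((f1 x + f1 a) * (f2 x + f2 b) - (f2 x + f2 a) * (f1 x + f1 b)) * ((f3 x + f3 a) - (f3 x + f3 b))"
  have "?l - ?r = 3 * ((f1 x * f2 a - f2 x * f1 a) * (f3 x - f3 b) + (f1 x * f2 b - f2 x * f1 b) * (f3 x - f3 a))"
    by (simp add: form_def algebra_simps)
  then have "3 dvd ?l - ?r" by simp
  then have "socle_elem ?l = socle_elem ?r" by (rule socle_elem_cong)
  moreover have "(x \<oplus>\<^bsub>M\<^esub> x) \<oplus>\<^bsub>M\<^esub> (a \<oplus>\<^bsub>M\<^esub> b) = (x \<oplus>\<^bsub>M\<^esub> a) \<oplus>\<^bsub>M\<^esub> (x \<oplus>\<^bsub>M\<^esub> b)"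
    using c by (simp add: M.a_ac)
  ultimately show ?thesis by (simp only: twist_twist c)
qed

text \<open>The form is homogeneous of degree three, and cubing is the identity modulo 3.\<close>

lemma twist_smult:
  assumes c: "r \<in> carrier R" "x \<in> carrier M" "y \<in> carrier M"
  shows "r \<odot>\<^bsub>M\<^esub> (x \<star> y) = (r \<odot>\<^bsub>M\<^esub> x) \<star> (r \<odot>\<^bsub>M\<^esub> y)"
proof -
  have "3 dvd form (r \<odot>\<^bsub>M\<^esub> x) (r \<odot>\<^bsub>M\<^esub> y) - ((\<Phi> r * f1 x) * (\<Phi> r * f2 y) - (\<Phi> r * f2 x) * (\<Phi> r * f1 y)) * (\<Phi> r * f3 x - \<Phi> r * f3 y)"
    by (rule form_mod) (use c f1 f2 f3 in \<open>simp_all add: functional_smult\<close>)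
  moreover have "((\<Phi> r * f1 x) * (\<Phi> r * f2 y) - (\<Phi> r * f2 x) * (\<Phi> r * f1 y)) * (\<Phi> r * f3 x - \<Phi> r * f3 y) = \<Phi> r ^ 3 * form x y"
    by (simp add: form_def algebra_simps power3_eq_cube)
  moreover have "3 dvd \<Phi> r ^ 3 * form x y - \<Phi> r * form x y"
    using c(1) by (cases rule: Phi_cases) simp_all
  ultimately have "3 dvd form (r \<odot>\<^bsub>M\<^esub> x) (r \<odot>\<^bsub>M\<^esub> y) - \<Phi> r * form x y"
    using dvd_add by fastforce
  then have "socle_elem (form (r \<odot>\<^bsub>M\<^esub> x) (r \<odot>\<^bsub>M\<^esub> y)) = r \<odot>\<^bsub>M\<^esub> socle_elem (form x y)"
    using socle_elem_cong socle_elem_smult[OF c(1)] by simp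
  then show ?thesis using c by (simp add: twist_def smult_r_distr)
qed

text \<open>On multiples of one element the determinant in the form vanishes, so there the twisted
  sum is the module sum.\<close>

lemma twist_add_smult:
  assumes c: "r \<in> carrier R" "q \<in> carrier R" "x \<in> carrier M"
  shows "(r \<oplus> q) \<odot>\<^bsub>M\<^esub> x = (r \<odot>\<^bsub>M\<^esub> x) \<star> (q \<odot>\<^bsub>M\<^esub> x)"
proof -
  have "3 dvd form (r \<odot>\<^bsub>M\<^esub> x) (q \<odot>\<^bsub>M\<^esub> x) - ((\<Phi> r * f1 x) * (\<Phi> q * f2 x) - (\<Phi> r * f2 x) * (\<Phi> q * f1 x)) * (\<Phi> r * f3 x - \<Phi> q * f3 x)"
    by (rule form_mod) (use c f1 f2 f3 in \<open>simp_all add: functional_smult\<close>)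
  then have "3 dvd form (r \<odot>\<^bsub>M\<^esub> x) (q \<odot>\<^bsub>M\<^esub> x) - 0" by (simp add: algebra_simps)
  then have "socle_elem (form (r \<odot>\<^bsub>M\<^esub> x) (q \<odot>\<^bsub>M\<^esub> x)) = \<zero>\<^bsub>M\<^esub>"
    using socle_elem_cong socle_elem_zero by metis
  then show ?thesis using c by (simp add: twist_def smult_l_distr)
qed

text \<open>The functionals vanish at \<open>r x\<close>, and both corrections reduce to
  \<open>form y z\<close>.\<close>

lemma twist_kernel_assoc:
  assumes c: "r \<in> I" "x \<in> carrier M" "y \<in> carrier M" "z \<in> carrier M"
  shows "(r \<odot>\<^bsub>M\<^esub> x) \<star> (y \<star> z) = ((r \<odot>\<^bsub>M\<^esub> x) \<star> y) \<star> z"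
proof -
  have r: "r \<in> carrier R" "\<Phi> r = 0" using c by (simp_all add: I_iff)
  have "f1 (r \<odot>\<^bsub>M\<^esub> x) = 0" "f2 (r \<odot>\<^bsub>M\<^esub> x) = 0" "f3 (r \<odot>\<^bsub>M\<^esub> x) = 0"
    using functional_smult[OF _ r(1) c(2)] f1 f2 f3 r(2) by simp_all
  then have "form y z + ((f1 y + f1 z) * f2 (r \<odot>\<^bsub>M\<^esub> x) - (f2 y + f2 z) * f1 (r \<odot>\<^bsub>M\<^esub> x)) * ((f3 y + f3 z) - f3 (r \<odot>\<^bsub>M\<^esub> x))
      = form (r \<odot>\<^bsub>M\<^esub> x) y + ((f1 (r \<odot>\<^bsub>M\<^esub> x) + f1 y) * f2 z - (f2 (r \<odot>\<^bsub>M\<^esub> x) + f2 y) * f1 z) * ((f3 (r \<odot>\<^bsub>M\<^esub> x) + f3 y) - f3 z)"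
    by (simp add: form_def algebra_simps)
  then show ?thesis
    using c r by (simp only: twist_assoc_left twist_assoc_right smult_closed)
qed

section \<open>The twisted quasimodule and its congruences\<close>

definition twisted :: "('r, 'm) module" where
  "twisted = M\<lparr>add := (\<star>)\<rparr>"

lemma twisted_simps:
  "carrier twisted = carrier M" "\<zero>\<^bsub>twisted\<^esub> = \<zero>\<^bsub>M\<^esub>"
  "x \<oplus>\<^bsub>twisted\<^esub> y = x \<star> y" "r \<odot>\<^bsub>twisted\<^esub> x = r \<odot>\<^bsub>M\<^esub> x"
  by (simp_all add: twisted_def)

lemma twist_division:
  assumes c: "a \<in> carrier M" "b \<in> carrier M"
  shows "\<exists>!x. x \<in> carrier M \<and> a \<star> x = b"
proof (rule ex1I)
  have "a \<star> ((\<ominus>\<^bsub>M\<^esub> a) \<star> b) = b" using twist_inverse[of "\<ominus>\<^bsub>M\<^esub> a" b] c by simp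
  then show "(\<ominus>\<^bsub>M\<^esub> a) \<star> b \<in> carrier M \<and> a \<star> ((\<ominus>\<^bsub>M\<^esub> a) \<star> b) = b" using c by simp
qed (use twist_inverse c in auto)

lemma quasimodule_twisted: "quasimodule R \<Phi> twisted"
proof (intro quasimodule.intro commutative_moufang_loop.intro quasimodule_axioms.intro, goal_cases)
  case (5 a b)
  then have "x \<in> carrier M \<and> x \<star> a = b \<longleftrightarrow> x \<in> carrier M \<and> a \<star> x = b" for x
    using twist_commute[of x a] by (auto simp: twisted_simps)
  then show ?case using twist_division[of a b] 5 by (simp add: twisted_simps)
next
  case (8 x a b)
  then show ?case by (simp only: twisted_simps twist_moufang)
qed (auto simp: twisted_simps R.is_cring twist_division twist_zero twist_commute[of _ "\<zero>\<^bsub>M\<^esub>"] twist_moufang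
    twist_smult twist_add_smult smult_assoc1 twist_kernel_assoc)

text \<open>A non-zero \<open>H\<close> contains a multiple of a non-zero element equal to
  \<open>s\<close>, hence all of \<open>Rs\<close>. Twisting \<open>x \<star> y\<close> with the
  opposite correction then recovers the module sum inside \<open>H\<close>.\<close>

lemma subquasimodule_twisted:
  assumes H: "subquasimodule H R \<Phi> twisted" "H \<noteq> {\<zero>\<^bsub>M\<^esub>}"
  shows "submodule H R M" "socle_elem t \<in> H"
proof -
  interpret H: quasimodule R \<Phi> "twisted\<lparr>carrier := H\<rparr>"
    using H(1) by (simp add: subquasimodule_def)
  have sub: "H \<subseteq> carrier M" using H(1) by (simp add: subquasimodule_def twisted_simps)
  have zero: "\<zero>\<^bsub>M\<^esub> \<in> H" using H.Q.zero_closed by (simp add: twisted_simps)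
  have tw: "x \<star> y \<in> H" if "x \<in> H" "y \<in> H" for x y
    using H.Q.add_closed[of x y] that by (simp add: twisted_simps)
  have sm: "r \<odot>\<^bsub>M\<^esub> x \<in> H" if "r \<in> carrier R" "x \<in> H" for r x
    using H.smult_closed[of r x] that by (simp add: twisted_simps)
  obtain x where "x \<in> H" "x \<noteq> \<zero>\<^bsub>M\<^esub>" using zero H(2) by blast
  then have "s \<in> H" using s_in_cyclic[of x] sm sub by blast
  then have soc: "socle_elem t \<in> H" for t using sm by (rule_tac socle_elemE[of t]) simp
  then show "socle_elem t \<in> H" .
  show "submodule H R M"
  proof (rule submoduleI)
    fix x assume x: "x \<in> H"
    have "\<ominus>\<^bsub>M\<^esub> x = (\<ominus> \<one>) \<odot>\<^bsub>M\<^esub> x" using x sub by (auto simp: smult_l_minus)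
    then show "\<ominus>\<^bsub>M\<^esub> x \<in> H" using sm[OF _ x] by simp
    fix y assume y: "y \<in> H"
    have c: "x \<in> carrier M" "y \<in> carrier M" using x y sub by auto
    have "form (x \<star> y) (socle_elem t) = 0" for t
      using functional_socle_elem[OF f1] functional_socle_elem[OF f2] f_s by (simp add: form_def)
    then have "(x \<star> y) \<star> socle_elem (- form x y) = x \<oplus>\<^bsub>M\<^esub> y"
      using c unfolding twist_def[of "x \<star> y"]
      by (simp add: socle_elem_zero) (simp add: twist_def M.a_assoc socle_elem_add socle_elem_zero)
    then show "x \<oplus>\<^bsub>M\<^esub> y \<in> H" using tw[OF tw[OF x y] soc[of "- form x y"]] by simp
  qed (use sub zero sm in auto)
qed

text \<open>The zero subquasimodule is a block of equality. Any other is a submodule containing the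
  socle, and congruence modulo it in the module is also compatible with
  \<open>\<star>\<close>.\<close>

lemma hamiltonian_twisted: "hamiltonian_quasimodule R \<Phi> twisted"
  unfolding hamiltonian_quasimodule_def
proof (intro conjI allI impI)
  show "quasimodule R \<Phi> twisted" by (rule quasimodule_twisted)
  fix H assume H: "subquasimodule H R \<Phi> twisted"
  have "\<exists>\<theta>. quasimodule_congruence \<theta> R twisted \<and> H \<in> carrier twisted // \<theta>"
  proof (cases "H = {\<zero>\<^bsub>M\<^esub>}")
    case True
    have "quasimodule_congruence (Id_on (carrier M)) R twisted"
      by (auto simp: quasimodule_congruence_def twisted_simps equiv_def refl_on_def sym_def trans_def)
    moreover have "H = Id_on (carrier M) `` {\<zero>\<^bsub>M\<^esub>}" using True by auto
    ultimately show ?thesis by (metis M.zero_closed quotientI twisted_simps(1))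
  next
    case False
    note sub = subquasimodule_twisted(1)[OF H False] and soc = subquasimodule_twisted(2)[OF H False]
    note E = submoduleE[OF sub]
    let ?\<theta> = "{(x, y). x \<in> carrier M \<and> y \<in> carrier M \<and> x \<oplus>\<^bsub>M\<^esub> \<ominus>\<^bsub>M\<^esub> y \<in> H}"
    have refl: "x \<oplus>\<^bsub>M\<^esub> \<ominus>\<^bsub>M\<^esub> x \<in> H" if "x \<in> carrier M" for x
      using that submodule_zero_mem[OF sub] by (simp add: M.r_neg)
    have sym: "y \<oplus>\<^bsub>M\<^esub> \<ominus>\<^bsub>M\<^esub> x \<in> H" if "x \<in> carrier M" "y \<in> carrier M" "x \<oplus>\<^bsub>M\<^esub> \<ominus>\<^bsub>M\<^esub> y \<in> H" for x y
      using E(3)[OF that(3)] that(1,2) by (simp add: M.minus_add M.a_comm)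
    have trans: "x \<oplus>\<^bsub>M\<^esub> \<ominus>\<^bsub>M\<^esub> z \<in> H"
      if "x \<in> carrier M" "y \<in> carrier M" "z \<in> carrier M" "x \<oplus>\<^bsub>M\<^esub> \<ominus>\<^bsub>M\<^esub> y \<in> H" "y \<oplus>\<^bsub>M\<^esub> \<ominus>\<^bsub>M\<^esub> z \<in> H" for x y z
      using E(5)[OF that(4,5)] that(1,2,3) by (simp add: M.a_assoc M.r_neg1)
    have add: "(x \<star> u) \<oplus>\<^bsub>M\<^esub> \<ominus>\<^bsub>M\<^esub> (y \<star> v) \<in> H"
      if c: "x \<in> carrier M" "y \<in> carrier M" "u \<in> carrier M" "v \<in> carrier M"
        and h: "x \<oplus>\<^bsub>M\<^esub> \<ominus>\<^bsub>M\<^esub> y \<in> H" "u \<oplus>\<^bsub>M\<^esub> \<ominus>\<^bsub>M\<^esub> v \<in> H" for x y u v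
    proof -
      \<comment> \<open>The two corrections need not agree, but each of them lies in
        \<open>H\<close>.\<close>
      have "(x \<star> u) \<oplus>\<^bsub>M\<^esub> \<ominus>\<^bsub>M\<^esub> (y \<star> v) = ((x \<oplus>\<^bsub>M\<^esub> \<ominus>\<^bsub>M\<^esub> y) \<oplus>\<^bsub>M\<^esub> (u \<oplus>\<^bsub>M\<^esub> \<ominus>\<^bsub>M\<^esub> v)) \<oplus>\<^bsub>M\<^esub>
          (socle_elem (form x u) \<oplus>\<^bsub>M\<^esub> \<ominus>\<^bsub>M\<^esub> socle_elem (form y v))"
        using c by (simp add: twist_def M.minus_add M.a_ac)
      then show ?thesis using E(3,5) h soc by simp
    qed
    have smult: "r \<odot>\<^bsub>M\<^esub> x \<oplus>\<^bsub>M\<^esub> \<ominus>\<^bsub>M\<^esub> (r \<odot>\<^bsub>M\<^esub> y) \<in> H"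
      if "r \<in> carrier R" "x \<in> carrier M" "y \<in> carrier M" "x \<oplus>\<^bsub>M\<^esub> \<ominus>\<^bsub>M\<^esub> y \<in> H" for r x y
      using E(4)[OF that(1,4)] that(1,2,3) by (simp add: smult_r_distr smult_r_minus)
    have "equiv (carrier M) ?\<theta>"
    proof (rule equivI)
      show "?\<theta> \<subseteq> carrier M \<times> carrier M" by blast
      show "refl_on (carrier M) ?\<theta>" using refl by (simp add: refl_on_def)
      show "Relation.sym ?\<theta>" using sym by (auto intro!: symI)
      show "Relation.trans ?\<theta>" using trans by (intro transI) blast
    qed
    then have "quasimodule_congruence ?\<theta> R twisted"
      unfolding quasimodule_congruence_def twisted_simps using add smult by auto
    moreover have "H = ?\<theta> `` {\<zero>\<^bsub>M\<^esub>}"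
    proof (intro equalityI subsetI)
      fix x assume "x \<in> H"
      moreover from this have "x \<in> carrier M" using E(1) by blast
      ultimately show "x \<in> ?\<theta> `` {\<zero>\<^bsub>M\<^esub>}" using E(3) by simp
    next
      fix x assume "x \<in> ?\<theta> `` {\<zero>\<^bsub>M\<^esub>}"
      then have "x \<in> carrier M" "\<zero>\<^bsub>M\<^esub> \<oplus>\<^bsub>M\<^esub> \<ominus>\<^bsub>M\<^esub> x \<in> H"
        by (simp_all only: Image_singleton_iff mem_Collect_eq prod.case)
      then have "x \<in> carrier M" "\<ominus>\<^bsub>M\<^esub> x \<in> H" by simp_all
      then show "x \<in> H" using E(3)[of "\<ominus>\<^bsub>M\<^esub> x"] by simp
    qed
    moreover have "?\<theta> `` {\<zero>\<^bsub>M\<^esub>} \<in> carrier twisted // ?\<theta>"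
      unfolding twisted_simps by (rule quotientI) (rule M.zero_closed)
    ultimately show ?thesis by (intro exI[of _ ?\<theta>] conjI) (assumption | erule ssubst)+
  qed
  then show "normal_subquasimodule H R \<Phi> twisted" using H by (simp add: normal_subquasimodule_def)
qed

text \<open>On a dual triple the determinant of the functionals is 1; the two bracketings have
  corrections 0 and -1 times \<open>s\<close>, and \<open>s\<close> is not 0.\<close>

lemma nonassociative_twisted:
  assumes c: "a \<in> carrier M" "b \<in> carrier M" "c \<in> carrier M"
    and a: "f1 a = 1" "f2 a = 0" "f3 a = 0" and b: "f1 b = 0" "f2 b = 1" "f3 b = 0"
    and d: "f1 c = 0" "f2 c = 0" "f3 c = 1"
  shows "nonassociative_quasimodule R \<Phi> twisted"
proof -
  have "\<not> module R twisted"
  proof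
    assume "module R twisted"
    then interpret T: module R twisted .
    have "(a \<star> b) \<star> c = a \<star> (b \<star> c)"
      using T.M.a_assoc[of a b c] c by (simp add: twisted_simps)
    then have "(a \<oplus>\<^bsub>M\<^esub> (b \<oplus>\<^bsub>M\<^esub> c)) \<oplus>\<^bsub>M\<^esub> \<zero>\<^bsub>M\<^esub> = (a \<oplus>\<^bsub>M\<^esub> (b \<oplus>\<^bsub>M\<^esub> c)) \<oplus>\<^bsub>M\<^esub> socle_elem (- 1)"
      using c a b d by (simp add: twist_assoc_left twist_assoc_right form_def socle_elem_zero)
    then have "socle_elem (- 1) = \<zero>\<^bsub>M\<^esub>" using c by (simp del: M.r_zero)
    then show False using socle_elem_nonzero[of "- 1"] by simp
  qed
  then show ?thesis using quasimodule_twisted by (simp add: nonassociative_quasimodule_def)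
qed

end

section \<open>Socle and maximal submodules of torsion modules\<close>

context Z3_module
begin

text \<open>The property spreads along the members of \<open>K_sequence\<close>: a successor
  consists of the elements that \<open>I\<close> sends into its predecessor, and unions add no
  elements.\<close>

lemma K_hat_torsion_induct:
  assumes tors: "K_hat_torsion R \<Phi> M" and zero: "P \<zero>\<^bsub>M\<^esub>"
    and step: "\<And>x. \<lbrakk>x \<in> carrier M; \<And>r. r \<in> I \<Longrightarrow> P (r \<odot>\<^bsub>M\<^esub> x)\<rbrakk> \<Longrightarrow> P x"
    and x: "x \<in> carrier M"
  shows "P x"
proof -
  have "\<forall>x\<in>N. P x" if "N \<in> K_sequence R \<Phi> M" for N
    using that
  proof (induction rule: K_sequence.induct)
    case (succ N)
    show ?case
      unfolding Union_K_quotient_module[OF module_axioms K_sequence_submodule[OF succ(1)] I_subset]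
      using step succ(2) by blast
  qed (use zero in auto)
  then show ?thesis using x tors unfolding K_hat_torsion_def K_hat_def by blast
qed

lemma submodule_Int:
  assumes N: "submodule N R M" and H: "submodule H R M"
  shows "submodule (N \<inter> H) R M"
  by (rule submoduleI)
    (use submoduleE[OF N] submoduleE[OF H] submodule_zero_mem[OF N] submodule_zero_mem[OF H] in auto)

text \<open>If \<open>I\<close> annihilated no non-zero element of the socle \<open>S\<close>,
  torsion induction would make every element of \<open>S\<close> zero. Any such element serves as
  \<open>s\<close>.\<close>

lemma exists_socle_generator:
  assumes coc: "cocyclic R M" and tors: "K_hat_torsion R \<Phi> M"
  shows "\<exists>s. socle_generator R \<Phi> M s"
proof -
  define S where "S = socle R M"
  have S: "submodule S R M" "S \<noteq> {\<zero>\<^bsub>M\<^esub>}"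
    and simple: "\<And>T. \<lbrakk>submodule T R M; T \<subseteq> S\<rbrakk> \<Longrightarrow> T = {\<zero>\<^bsub>M\<^esub>} \<or> T = S"
    and ess: "\<And>N. \<lbrakk>submodule N R M; N \<noteq> {\<zero>\<^bsub>M\<^esub>}\<rbrakk> \<Longrightarrow> S \<inter> N \<noteq> {\<zero>\<^bsub>M\<^esub>}"
    using coc by (auto simp: cocyclic_def simple_submodule_def essential_submodule_def S_def)
  note E = submoduleE[OF S(1)]
  obtain s where s: "s \<in> S" "s \<noteq> \<zero>\<^bsub>M\<^esub>" "\<And>r. r \<in> I \<Longrightarrow> r \<odot>\<^bsub>M\<^esub> s = \<zero>\<^bsub>M\<^esub>"
  proof (rule ccontr)
    assume "\<not> thesis"
    then have no: "x = \<zero>\<^bsub>M\<^esub>" if "x \<in> S" "\<And>r. r \<in> I \<Longrightarrow> r \<odot>\<^bsub>M\<^esub> x = \<zero>\<^bsub>M\<^esub>" for x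
      using \<open>\<And>s. \<lbrakk>s \<in> S; s \<noteq> \<zero>\<^bsub>M\<^esub>; \<And>r. r \<in> I \<Longrightarrow> r \<odot>\<^bsub>M\<^esub> s = \<zero>\<^bsub>M\<^esub>\<rbrakk> \<Longrightarrow> thesis\<close> that by blast
    have "x \<in> S \<longrightarrow> x = \<zero>\<^bsub>M\<^esub>" if "x \<in> carrier M" for x
    proof (rule K_hat_torsion_induct[OF tors _ _ that])
      fix x assume IH: "\<And>r. r \<in> I \<Longrightarrow> r \<odot>\<^bsub>M\<^esub> x \<in> S \<longrightarrow> r \<odot>\<^bsub>M\<^esub> x = \<zero>\<^bsub>M\<^esub>"
      show "x \<in> S \<longrightarrow> x = \<zero>\<^bsub>M\<^esub>"
      proof
        assume x: "x \<in> S"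
        then have "r \<odot>\<^bsub>M\<^esub> x = \<zero>\<^bsub>M\<^esub>" if "r \<in> I" for r
          using IH[OF that] E(4)[OF _ x, of r] that I_subset by blast
        then show "x = \<zero>\<^bsub>M\<^esub>" by (rule no[OF x])
      qed
    qed simp
    then show False using S E(1) submodule_zero_mem[OF S(1)] by blast
  qed
  have sM: "s \<in> carrier M" using s E(1) by blast
  have "\<exists>r\<in>carrier R. r \<odot>\<^bsub>M\<^esub> x = s" if x: "x \<in> carrier M" "x \<noteq> \<zero>\<^bsub>M\<^esub>" for x
  proof -
    let ?C = "(\<lambda>r. r \<odot>\<^bsub>M\<^esub> x) ` carrier R"
    note C = submodule_cyclic[OF x(1)]
    have "?C \<noteq> {\<zero>\<^bsub>M\<^esub>}" using cyclic_self[OF x(1)] x(2) by blast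
    then have "S \<inter> ?C \<noteq> {\<zero>\<^bsub>M\<^esub>}" by (rule ess[OF C])
    \<comment> \<open>Essentiality makes \<open>S\<close> meet \<open>Rx\<close> non-trivially, and
      simplicity makes the intersection all of \<open>S\<close>.\<close>
    then have "S \<inter> ?C = S" using simple[OF submodule_Int[OF S(1) C]] by simp
    then have "s \<in> ?C" using s(1) by (metis IntD2)
    then show ?thesis by (metis imageE)
  qed
  then have "socle_generator R \<Phi> M s"
    using sM s by (intro socle_generator.intro socle_generator_axioms.intro Z3_module_axioms)
  then show ?thesis by blast
qed

text \<open>Otherwise \<open>Iy \<subseteq> L\<close> forces \<open>y \<in> L\<close> for every \<open>y\<close>, since \<open>M = L + Ry\<close> would give \<open>IM \<subseteq> L\<close>.\<close>

lemma maximal_submodule_contains_I: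
  assumes tors: "K_hat_torsion R \<Phi> M" and L: "submodule L R M" "L \<noteq> carrier M"
    and max: "\<And>N. \<lbrakk>submodule N R M; L \<subseteq> N; N \<noteq> L\<rbrakk> \<Longrightarrow> N = carrier M"
    and r: "r \<in> I" and x: "x \<in> carrier M"
  shows "r \<odot>\<^bsub>M\<^esub> x \<in> L"
proof (rule ccontr)
  assume no: "r \<odot>\<^bsub>M\<^esub> x \<notin> L"
  note E = submoduleE[OF L(1)]
  have rR: "r \<in> carrier R" using r I_subset by blast
  have "y \<in> L" if "y \<in> carrier M" for y
  proof (rule K_hat_torsion_induct[OF tors _ _ that])
    show "\<zero>\<^bsub>M\<^esub> \<in> L" by (rule submodule_zero_mem[OF L(1)])
    fix y assume y: "y \<in> carrier M" and IH: "\<And>r. r \<in> I \<Longrightarrow> r \<odot>\<^bsub>M\<^esub> y \<in> L"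
    show "y \<in> L"
    proof (rule ccontr)
      assume yL: "y \<notin> L"
      let ?C = "(\<lambda>r. r \<odot>\<^bsub>M\<^esub> y) ` carrier R"
      let ?N = "{n \<oplus>\<^bsub>M\<^esub> h | n h. n \<in> L \<and> h \<in> ?C}"
      note C = submodule_cyclic[OF y]
      have "y \<in> ?N" using submodule_sum_contains(2)[OF L(1) C] cyclic_self[OF y] by (rule subsetD)
      then have "?N \<noteq> L" using yL by (metis (lifting))
      then have "?N = carrier M"
        by (rule max[OF submodule_sum[OF L(1) C] submodule_sum_contains(1)[OF L(1) C]])
      then have "x \<in> ?N" using x by (rule ssubst)
      then obtain n q where n: "n \<in> L" "q \<in> carrier R" "x = n \<oplus>\<^bsub>M\<^esub> q \<odot>\<^bsub>M\<^esub> y" by blast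
      have nM: "n \<in> carrier M" using n(1) E(1) by (rule_tac subsetD)
      have "r \<odot>\<^bsub>M\<^esub> x = r \<odot>\<^bsub>M\<^esub> n \<oplus>\<^bsub>M\<^esub> q \<odot>\<^bsub>M\<^esub> (r \<odot>\<^bsub>M\<^esub> y)"
        using n nM rR y smult_assoc1[of r q y] smult_assoc1[of q r y] by (simp add: smult_r_distr R.m_comm)
      then show False using no E(4,5) n rR IH[OF r] by simp
    qed
  qed
  then show False using L(2) E(1) by blast
qed

text \<open>By maximality \<open>M = L + Ra\<close>, and \<open>M/L\<close> is a copy of Z_3 with
  \<open>a\<close> as its unit; \<open>f\<close> reads off the residue of the coefficient of
  \<open>a\<close>.\<close>

lemma functional_of_maximal_submodule:
  assumes L: "submodule L R M"
    and max: "\<And>N. \<lbrakk>submodule N R M; L \<subseteq> N; N \<noteq> L\<rbrakk> \<Longrightarrow> N = carrier M"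
    and IL: "\<And>r x. \<lbrakk>r \<in> I; x \<in> carrier M\<rbrakk> \<Longrightarrow> r \<odot>\<^bsub>M\<^esub> x \<in> L"
    and a: "a \<in> carrier M" "a \<notin> L"
  shows "\<exists>f. Z3_functional f \<and> f a = 1 \<and> (\<forall>x\<in>L. f x = 0)"
proof -
  note E = submoduleE[OF L]
  let ?R = "\<lambda>x r. r \<in> carrier R \<and> x \<oplus>\<^bsub>M\<^esub> \<ominus>\<^bsub>M\<^esub> (r \<odot>\<^bsub>M\<^esub> a) \<in> L"
  define f where "f x = \<Phi> (SOME r. ?R x r)" for x
  let ?C = "(\<lambda>r. r \<odot>\<^bsub>M\<^esub> a) ` carrier R"
  let ?N = "{n \<oplus>\<^bsub>M\<^esub> h | n h. n \<in> L \<and> h \<in> ?C}"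
  note C = submodule_cyclic[OF a(1)]
  have "a \<in> ?N" using submodule_sum_contains(2)[OF L C] cyclic_self[OF a(1)] by (rule subsetD)
  then have "?N \<noteq> L" using a(2) by (metis (lifting))
  then have N: "?N = carrier M"
    by (rule max[OF submodule_sum[OF L C] submodule_sum_contains(1)[OF L C]])
  have ex: "\<exists>r. ?R x r" if x: "x \<in> carrier M" for x
  proof -
    have "x \<in> ?N" using N x by (rule ssubst)
    then obtain n r where n: "n \<in> L" "r \<in> carrier R" "x = n \<oplus>\<^bsub>M\<^esub> r \<odot>\<^bsub>M\<^esub> a" by blast
    have nM: "n \<in> carrier M" using E(1) n(1) by (rule subsetD)
    have "x \<oplus>\<^bsub>M\<^esub> \<ominus>\<^bsub>M\<^esub> (r \<odot>\<^bsub>M\<^esub> a) = n" using n(2,3) nM a by (simp add: M.a_assoc M.r_neg)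
    then show ?thesis using n by (intro exI[of _ r]) simp
  qed
  \<comment> \<open>The residue is well defined: two coefficients with distinct residues have a
    difference invertible modulo \<open>I\<close>, which would put \<open>a\<close> into
    \<open>L\<close>.\<close>
  have eq: "f x = \<Phi> r" if x: "x \<in> carrier M" and r: "?R x r" for x r
  proof (rule ccontr)
    assume ne: "f x \<noteq> \<Phi> r"
    define q where "q = (SOME r. ?R x r)"
    have q: "?R x q" unfolding q_def using ex[OF x] by (rule someI_ex)
    have qr: "q \<in> carrier R" "r \<in> carrier R" using q r by auto
    have "\<Phi> q \<noteq> \<Phi> r" using ne by (simp add: f_def q_def)
    then have "r \<ominus> q \<notin> I" using qr diff_in_I[of r q] by auto
    then have "\<Phi> (r \<ominus> q) \<noteq> 0" using qr by (simp add: I_iff)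
    then obtain t i where t: "t \<in> carrier R" "i \<in> I" "t \<otimes> (r \<ominus> q) = \<one> \<oplus> i"
      using inverse_mod_I[of "r \<ominus> q"] qr by blast
    have i: "i \<in> carrier R" using t I_subset by blast
    have "(x \<oplus>\<^bsub>M\<^esub> \<ominus>\<^bsub>M\<^esub> (q \<odot>\<^bsub>M\<^esub> a)) \<oplus>\<^bsub>M\<^esub> \<ominus>\<^bsub>M\<^esub> (x \<oplus>\<^bsub>M\<^esub> \<ominus>\<^bsub>M\<^esub> (r \<odot>\<^bsub>M\<^esub> a)) \<in> L"
      using q r E(3,5) by blast
    moreover have "(x \<oplus>\<^bsub>M\<^esub> \<ominus>\<^bsub>M\<^esub> (q \<odot>\<^bsub>M\<^esub> a)) \<oplus>\<^bsub>M\<^esub> \<ominus>\<^bsub>M\<^esub> (x \<oplus>\<^bsub>M\<^esub> \<ominus>\<^bsub>M\<^esub> (r \<odot>\<^bsub>M\<^esub> a)) = (r \<ominus> q) \<odot>\<^bsub>M\<^esub> a"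
      using x qr a by (simp add: M.minus_add smult_l_distr smult_l_minus R.minus_eq M.a_ac M.r_neg1 M.r_neg2)
    ultimately have "t \<odot>\<^bsub>M\<^esub> ((r \<ominus> q) \<odot>\<^bsub>M\<^esub> a) \<in> L" using E(4) t(1) by simp
    then have "a \<oplus>\<^bsub>M\<^esub> i \<odot>\<^bsub>M\<^esub> a \<in> L"
      using smult_assoc1[of t "r \<ominus> q" a] t(1,3) qr a i by (simp add: smult_l_distr)
    then have "(a \<oplus>\<^bsub>M\<^esub> i \<odot>\<^bsub>M\<^esub> a) \<oplus>\<^bsub>M\<^esub> \<ominus>\<^bsub>M\<^esub> (i \<odot>\<^bsub>M\<^esub> a) \<in> L" using IL[OF t(2) a(1)] E(3,5) by blast
    then show False using a i by (simp add: M.a_assoc M.r_neg)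
  qed
  have ch: "\<exists>r. ?R x r \<and> f x = \<Phi> r" if "x \<in> carrier M" for x
    using ex[OF that] eq[OF that] by blast
  have "Z3_functional f"
    unfolding Z3_functional_def
  proof (intro conjI ballI)
    fix x y assume xy: "x \<in> carrier M" "y \<in> carrier M"
    obtain r q where r: "r \<in> carrier R" "x \<oplus>\<^bsub>M\<^esub> \<ominus>\<^bsub>M\<^esub> (r \<odot>\<^bsub>M\<^esub> a) \<in> L" "f x = \<Phi> r"
      and q: "q \<in> carrier R" "y \<oplus>\<^bsub>M\<^esub> \<ominus>\<^bsub>M\<^esub> (q \<odot>\<^bsub>M\<^esub> a) \<in> L" "f y = \<Phi> q"
      using ch xy by blast
    have "(x \<oplus>\<^bsub>M\<^esub> y) \<oplus>\<^bsub>M\<^esub> \<ominus>\<^bsub>M\<^esub> ((r \<oplus> q) \<odot>\<^bsub>M\<^esub> a)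
        = (x \<oplus>\<^bsub>M\<^esub> \<ominus>\<^bsub>M\<^esub> (r \<odot>\<^bsub>M\<^esub> a)) \<oplus>\<^bsub>M\<^esub> (y \<oplus>\<^bsub>M\<^esub> \<ominus>\<^bsub>M\<^esub> (q \<odot>\<^bsub>M\<^esub> a))"
      using xy r(1) q(1) a by (simp add: smult_l_distr M.minus_add M.a_ac)
    then have "?R (x \<oplus>\<^bsub>M\<^esub> y) (r \<oplus> q)" using E(5)[OF r(2) q(2)] r(1) q(1) by simp
    then show "f (x \<oplus>\<^bsub>M\<^esub> y) = (f x + f y) mod 3"
      using eq[of "x \<oplus>\<^bsub>M\<^esub> y" "r \<oplus> q"] xy r q by (simp add: Phi_add)
  next
    fix p x assume p: "p \<in> carrier R" and x: "x \<in> carrier M"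
    obtain r where r: "r \<in> carrier R" "x \<oplus>\<^bsub>M\<^esub> \<ominus>\<^bsub>M\<^esub> (r \<odot>\<^bsub>M\<^esub> a) \<in> L" "f x = \<Phi> r"
      using ch x by blast
    have "p \<odot>\<^bsub>M\<^esub> x \<oplus>\<^bsub>M\<^esub> \<ominus>\<^bsub>M\<^esub> ((p \<otimes> r) \<odot>\<^bsub>M\<^esub> a) = p \<odot>\<^bsub>M\<^esub> (x \<oplus>\<^bsub>M\<^esub> \<ominus>\<^bsub>M\<^esub> (r \<odot>\<^bsub>M\<^esub> a))"
      using p x r(1) a by (simp add: smult_assoc1 smult_r_distr smult_r_minus)
    then have "?R (p \<odot>\<^bsub>M\<^esub> x) (p \<otimes> r)" using E(4)[OF p r(2)] r(1) p by simp
    then show "f (p \<odot>\<^bsub>M\<^esub> x) = (\<Phi> p * f x) mod 3"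
      using eq[of "p \<odot>\<^bsub>M\<^esub> x" "p \<otimes> r"] p x r by (simp add: Phi_mult)
  qed
  moreover have "f a = 1"
    using eq[OF a(1), of \<one>] a submodule_zero_mem[OF L] by (simp add: M.r_neg Phi_one)
  moreover have "f x = 0" if "x \<in> L" for x
  proof -
    have x: "x \<in> carrier M" using E(1) that by (rule subsetD)
    have "\<ominus>\<^bsub>M\<^esub> \<zero>\<^bsub>M\<^esub> = \<zero>\<^bsub>M\<^esub>" by (rule M.minus_equality) simp_all
    then have "x \<oplus>\<^bsub>M\<^esub> \<ominus>\<^bsub>M\<^esub> (\<zero> \<odot>\<^bsub>M\<^esub> a) = x" using x a by (metis M.r_zero smult_l_null)
    then show ?thesis using eq[OF x, of \<zero>] that by (simp add: Phi_zero)
  qed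
  ultimately show ?thesis by blast
qed

end

section \<open>Functionals dual to three generators\<close>

context socle_generator
begin

text \<open>In a generating set of least size, all members but \<open>a\<close> generate a proper
  submodule. A maximal submodule above it omits \<open>a\<close> and is the kernel of the functional
  for \<open>a\<close>.\<close>

lemma exists_coordinate_functionals:
  assumes fin: "finite (carrier M)" and tors: "K_hat_torsion R \<Phi> M" and gen: "gen R M \<ge> 3"
  shows "\<exists>f1 f2 f3 a b c. twisted_module R \<Phi> M s f1 f2 f3 \<and>
    a \<in> carrier M \<and> b \<in> carrier M \<and> c \<in> carrier M \<and>
    f1 a = 1 \<and> f2 a = 0 \<and> f3 a = 0 \<and> f1 b = 0 \<and> f2 b = 1 \<and> f3 b = 0 \<and> f1 c = 0 \<and> f2 c = 0 \<and> f3 c = 1"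
proof -
  let ?P = "\<lambda>n. \<exists>A. A \<subseteq> carrier M \<and> finite A \<and> card A = n \<and> generated_submodule R M A = carrier M"
  note G = generated_submodule_props[OF module_axioms]
  have "generated_submodule R M (carrier M) = carrier M"
    using G(2)[of "carrier M"] submoduleE(1)[OF G(1)[of "carrier M"]] by blast
  then have "?P (card (carrier M))" using fin by blast
  then have "?P (gen R M)" unfolding gen_def by (rule LeastI)
  then obtain A where A: "A \<subseteq> carrier M" "finite A" "card A = gen R M" "generated_submodule R M A = carrier M"
    by blast
  have main: "\<exists>f. Z3_functional f \<and> f a = 1 \<and> (\<forall>x\<in>A - {a}. f x = 0) \<and> f s = 0" if a: "a \<in> A" for a
  proof -
    let ?G = "generated_submodule R M (A - {a})"
    have Aa: "A - {a} \<subseteq> carrier M" using A(1) by blast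
    have "card (A - {a}) < gen R M" using A(2,3) a by (metis card_Diff1_less)
    then have "\<not> ?P (card (A - {a}))" unfolding gen_def by (rule not_less_Least)
    then have ne: "?G \<noteq> carrier M" using Aa A(2) by blast
    let ?Fam = "{L. submodule L R M \<and> A - {a} \<subseteq> L \<and> L \<noteq> carrier M}"
    have "?Fam \<subseteq> Pow (carrier M)" using submoduleE(1) by blast
    then have "finite ?Fam" by (rule finite_subset) (use fin in simp)
    moreover have "?G \<in> ?Fam" using G(1,2)[OF Aa] ne by simp
    ultimately obtain L where "L \<in> ?Fam" and max': "\<forall>N\<in>(?Fam). L \<subseteq> N \<longrightarrow> L = N"
      using finite_has_maximal[of ?Fam] by auto
    then have L: "submodule L R M" "A - {a} \<subseteq> L" "L \<noteq> carrier M" by simp_all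
    have max: "N = carrier M" if "submodule N R M" "L \<subseteq> N" "N \<noteq> L" for N
      using max' that L(2) by blast
    have aM: "a \<in> carrier M" using A(1) a by blast
    have aL: "a \<notin> L"
    proof
      assume "a \<in> L"
      then have "A \<subseteq> L" using L(2) by blast
      then have "carrier M \<subseteq> L" using G(3)[OF A(1) L(1)] A(4) by simp
      then show False using L(3) submoduleE(1)[OF L(1)] by blast
    qed
    \<comment> \<open>The bound on \<open>gen\<close> is used here: at least two generators remain
      in \<open>L\<close>, so \<open>L\<close> is not zero and must contain
      \<open>s\<close>.\<close>
    have "s \<in> L"
    proof (rule s_in_submodule[OF L(1)])
      show "L \<noteq> {\<zero>\<^bsub>M\<^esub>}"
      proof
        assume "L = {\<zero>\<^bsub>M\<^esub>}"
        then have "card (A - {a}) \<le> card {\<zero>\<^bsub>M\<^esub>}" using L(2) by (intro card_mono) auto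
        moreover have "card (A - {a}) = card A - 1" using a by (rule card_Diff_singleton)
        moreover have "card {\<zero>\<^bsub>M\<^esub>} = 1" by simp
        ultimately show False using gen A(3) by linarith
      qed
    qed
    moreover obtain f where "Z3_functional f" "f a = 1" "\<forall>x\<in>L. f x = 0"
      using functional_of_maximal_submodule[OF L(1) max
          maximal_submodule_contains_I[OF tors L(1,3) max] aM aL] by blast
    ultimately show ?thesis using L(2) by blast
  qed
  obtain B where B: "B \<subseteq> A" "card B = 3" using obtain_subset_with_card_n[of 3 A] gen A(3) by metis
  then obtain a b c where abc: "B = {a, b, c}" "a \<noteq> b" "b \<noteq> c" "a \<noteq> c" by (auto simp: card_3_iff)
  then have in_A: "a \<in> A" "b \<in> A" "c \<in> A" using B by auto
  obtain f1 where f1: "Z3_functional f1" "f1 a = 1" "\<forall>x\<in>A - {a}. f1 x = 0" "f1 s = 0" using main[OF in_A(1)] by blast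
  obtain f2 where f2: "Z3_functional f2" "f2 b = 1" "\<forall>x\<in>A - {b}. f2 x = 0" "f2 s = 0" using main[OF in_A(2)] by blast
  obtain f3 where f3: "Z3_functional f3" "f3 c = 1" "\<forall>x\<in>A - {c}. f3 x = 0" "f3 s = 0" using main[OF in_A(3)] by blast
  have "twisted_module R \<Phi> M s f1 f2 f3"
    using f1 f2 f3 by (intro twisted_module.intro twisted_module_axioms.intro socle_generator_axioms)
  moreover have "f1 b = 0" "f1 c = 0" using f1(3) in_A abc(2-4) by simp_all
  moreover have "f2 a = 0" "f2 c = 0" using f2(3) in_A abc(2-4) by simp_all
  moreover have "f3 a = 0" "f3 b = 0" using f3(3) in_A abc(2-4) by simp_all
  moreover have "a \<in> carrier M" "b \<in> carrier M" "c \<in> carrier M" using in_A A(1) by auto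
  ultimately show ?thesis using f1(2) f2(2) f3(2) by blast
qed

end

section \<open>Transport to a prescribed carrier type\<close>

context twisted_module
begin

text \<open>An injective \<open>j\<close> is a quotient map with zero kernel, so the image is an
  isomorphic copy and the functionals are pulled back along the inverse of \<open>j\<close>.\<close>

lemma twisted_module_image:
  assumes inj: "inj_on j (carrier M)"
  shows "twisted_module R \<Phi> (image_module M j) (j s) (\<lambda>y. f1 (inv_into (carrier M) j y))
    (\<lambda>y. f2 (inv_into (carrier M) j y)) (\<lambda>y. f3 (inv_into (carrier M) j y))"
proof -
  let ?M = "image_module M j" and ?i = "inv_into (carrier M) j"
  have "x \<ominus>\<^bsub>M\<^esub> y = \<zero>\<^bsub>M\<^esub> \<longleftrightarrow> x = y" if "x \<in> carrier M" "y \<in> carrier M" for x y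
  proof
    assume "x \<ominus>\<^bsub>M\<^esub> y = \<zero>\<^bsub>M\<^esub>"
    then have "\<ominus>\<^bsub>M\<^esub> (\<ominus>\<^bsub>M\<^esub> y) = x"
      by (intro M.minus_equality) (use that in \<open>simp_all add: a_minus_def\<close>)
    then show "x = y" using that by simp
  qed (use that in \<open>simp add: a_minus_def M.r_neg\<close>)
  then have "j x = j y \<longleftrightarrow> x \<ominus>\<^bsub>M\<^esub> y \<in> {\<zero>\<^bsub>M\<^esub>}" if "x \<in> carrier M" "y \<in> carrier M" for x y
    using that inj_on_eq_iff[OF inj, of x y] by simp
  then interpret J: module_quotient_map R M "{\<zero>\<^bsub>M\<^esub>}" j
    by (intro module_quotient_map.intro module_quotient_map_axioms.intro module_axioms submodule_trivial)
  interpret J: Z3_module R \<Phi> ?M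
    by (intro Z3_module.intro J.module_image R.cring_onto_Z3_axioms)
  have i: "?i (j x) = x" if "x \<in> carrier M" for x using inv_into_f_f[OF inj that] .
  have functional: "J.Z3_functional (\<lambda>y. f (?i y))" if "Z3_functional f" for f
    unfolding J.Z3_functional_def
    by (auto simp: image_module_simps J.image_add J.image_smult i functional_add[OF that] functional_smult[OF that])
  have "socle_generator R \<Phi> ?M (j s)"
  proof (intro socle_generator.intro socle_generator_axioms.intro J.Z3_module_axioms)
    show "j s \<in> carrier ?M" using s by (simp add: image_module_simps)
    show "j s \<noteq> \<zero>\<^bsub>?M\<^esub>" using J.image_zero_iff s by simp
    show "r \<odot>\<^bsub>?M\<^esub> j s = \<zero>\<^bsub>?M\<^esub>" if "r \<in> I" for r
      using J.image_smult[of r s] that I_subset s I_s by (auto simp: image_module_simps)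
    fix y assume y: "y \<in> carrier ?M" "y \<noteq> \<zero>\<^bsub>?M\<^esub>"
    then obtain x where x: "x \<in> carrier M" "y = j x" "x \<noteq> \<zero>\<^bsub>M\<^esub>"
      by (auto simp: image_module_simps)
    then obtain r where "r \<in> carrier R" "r \<odot>\<^bsub>M\<^esub> x = s" using s_in_cyclic by blast
    then show "\<exists>r\<in>carrier R. r \<odot>\<^bsub>?M\<^esub> y = j s" using J.image_smult[of r x] x by auto
  qed
  then show ?thesis
    using functional f1 f2 f3 f_s i s
    by (intro twisted_module.intro twisted_module_axioms.intro) simp_all
qed

text \<open>The module is first copied into the type \<open>'q\<close> and twisted there, so no
  transport of quasimodules is involved.\<close>

lemma exists_hamiltonian_quasimodule:
  assumes fin: "finite (carrier M)" and inf: "infinite (UNIV :: 'q set)"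
    and c: "a \<in> carrier M" "b \<in> carrier M" "c \<in> carrier M"
    and f: "f1 a = 1" "f2 a = 0" "f3 a = 0" "f1 b = 0" "f2 b = 1" "f3 b = 0" "f1 c = 0" "f2 c = 0" "f3 c = 1"
  shows "\<exists>Q :: ('r, 'q) module. nonassociative_quasimodule R \<Phi> Q \<and> hamiltonian_quasimodule R \<Phi> Q"
proof -
  obtain j :: "'m \<Rightarrow> 'q" where j: "inj_on j (carrier M)"
    using finite_inj_into_infinite[OF fin inf] by blast
  interpret J: twisted_module R \<Phi> "image_module M j" "j s" "\<lambda>y. f1 (inv_into (carrier M) j y)"
    "\<lambda>y. f2 (inv_into (carrier M) j y)" "\<lambda>y. f3 (inv_into (carrier M) j y)"
    by (rule twisted_module_image[OF j])
  have "nonassociative_quasimodule R \<Phi> J.twisted"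
    by (rule J.nonassociative_twisted[of "j a" "j b" "j c"])
      (use c f in \<open>simp_all add: image_module_simps inv_into_f_f[OF j]\<close>)
  then show ?thesis using J.hamiltonian_twisted by blast
qed

end

section \<open>Equivalence between hamiltonian quasimodules and finite cocyclic modules\<close>

theorem theorem7p8:
  fixes R :: "('r, 'a) ring_scheme" and \<Phi> :: "'r \<Rightarrow> int"
  assumes "cring R" and "\<one>\<^bsub>R\<^esub> \<noteq> \<zero>\<^bsub>R\<^esub>" and "noetherian_ring R"
    and "\<Phi> \<in> ring_hom R (residue_ring 3)"
    and "\<Phi> ` carrier R = carrier (residue_ring 3)"
    and "infinite (UNIV :: 'q set)" and "infinite (UNIV :: 'm set)"
  shows "(\<exists>Q :: ('r, 'q) module.
            nonassociative_quasimodule R \<Phi> Q \<and> hamiltonian_quasimodule R \<Phi> Q) \<longleftrightarrow>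
         (\<exists>M :: ('r, 'm) module.
            module R M \<and> finite (carrier M) \<and> cocyclic R M \<and> K_hat_torsion R \<Phi> M \<and>
            gen R M \<ge> 3)"
proof
  interpret R: cring_onto_Z3 R \<Phi>
    using assms(1,4,5) by (intro cring_onto_Z3.intro cring_onto_Z3_axioms.intro)
  assume "\<exists>Q :: ('r, 'q) module. nonassociative_quasimodule R \<Phi> Q \<and> hamiltonian_quasimodule R \<Phi> Q"
  then obtain Q :: "('r, 'q) module"
    where Q: "quasimodule R \<Phi> Q" "\<not> module R Q" "hamiltonian_quasimodule R \<Phi> Q"
    by (auto simp: nonassociative_quasimodule_def)
  interpret Q: hamiltonian R \<Phi> Q
    using Q by (intro hamiltonian.intro hamiltonian_axioms.intro R.cring_onto_Z3_axioms)
  obtain u v w where c: "u \<in> carrier Q" "v \<in> carrier Q" "w \<in> carrier Q"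
    and ne: "(u \<oplus>\<^bsub>Q\<^esub> v) \<oplus>\<^bsub>Q\<^esub> w \<noteq> u \<oplus>\<^bsub>Q\<^esub> (v \<oplus>\<^bsub>Q\<^esub> w)"
    using Q(2) unfolding Q.module_iff_associative by blast
  \<comment> \<open>A zero defect would make the two bracketings of the non-associating triple
    equal.\<close>
  have "Q.defect u v w \<noteq> \<zero>\<^bsub>Q\<^esub>"
    using Q.defect_eq[OF c] ne c by (auto simp: Q.Q.zero_right Q.Q.add_closed)
  then obtain N p where N: "submodule N R (free3 R)" "N \<subseteq> R.I \<times> R.I \<times> R.I"
    and p: "p \<in> carrier (free3 R)" "p \<notin> N" "\<forall>i\<in>R.I. i \<odot>\<^bsub>free3 R\<^esub> p \<in> N"
    and ess: "\<forall>x\<in>carrier (free3 R). x \<notin> N \<longrightarrow>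
      (\<exists>r\<in>carrier R. \<exists>n\<in>N. p = n \<oplus>\<^bsub>free3 R\<^esub> r \<odot>\<^bsub>free3 R\<^esub> x)"
    using Q.exists_essential_submodule[OF c] by blast
  show "\<exists>M :: ('r, 'm) module.
      module R M \<and> finite (carrier M) \<and> cocyclic R M \<and> K_hat_torsion R \<Phi> M \<and> gen R M \<ge> 3"
    by (rule R.exists_cocyclic_module[OF assms(3,7) N p(1,2) bspec[OF p(3)]]) (use ess in blast)+
next
  interpret R: cring_onto_Z3 R \<Phi>
    using assms(1,4,5) by (intro cring_onto_Z3.intro cring_onto_Z3_axioms.intro)
  assume "\<exists>M :: ('r, 'm) module.
      module R M \<and> finite (carrier M) \<and> cocyclic R M \<and> K_hat_torsion R \<Phi> M \<and> gen R M \<ge> 3"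
  then obtain M :: "('r, 'm) module" where M: "module R M" "finite (carrier M)" "cocyclic R M"
    "K_hat_torsion R \<Phi> M" "gen R M \<ge> 3"
    by blast
  interpret M: Z3_module R \<Phi> M using M(1) by (intro Z3_module.intro R.cring_onto_Z3_axioms)
  obtain s where s: "socle_generator R \<Phi> M s" using M.exists_socle_generator[OF M(3,4)] by blast
  obtain f1 f2 f3 a b c where T: "twisted_module R \<Phi> M s f1 f2 f3"
    and abc: "a \<in> carrier M" "b \<in> carrier M" "c \<in> carrier M" "f1 a = 1" "f2 a = 0" "f3 a = 0"
      "f1 b = 0" "f2 b = 1" "f3 b = 0" "f1 c = 0" "f2 c = 0" "f3 c = 1"
    using socle_generator.exists_coordinate_functionals[OF s M(2,4,5)] by blast
  show "\<exists>Q :: ('r, 'q) module. nonassociative_quasimodule R \<Phi> Q \<and> hamiltonian_quasimodule R \<Phi> Q"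
    by (rule twisted_module.exists_hamiltonian_quasimodule[OF T M(2) assms(6) abc])
qed

end
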